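(* Let $\Phi,\Psi\in\overline{\varPhi}_Y$, $\varphi\in\mathcal{G}^{\rm dec}$ and $\rho:(0,\infty)\to(0,\infty)$. (i) Assume that $\lim_{r\to\infty}\varphi(r)=0$ or that $\Psi^{-1}(t)/\Phi^{-1}(t)$ is almost decreasing on $(0,\infty)$. If there exists a positive constant $A$ such that, for all $r\in(0,\infty)$, $$\Big(\sup_{0<t\le r}\rho(t)\Big)\Phi^{-1}(\varphi(r))\le A\,\Psi^{-1}(\varphi(r)),\qquad( * )$$ then, for any positive constant $C_0$, there exists a positive constant $C_1$ such that, for all $f\in L^{(\Phi,\varphi)}(\mathbb{R}^n)$ with $f\not\equiv0$, $$\Psi\left(\frac{M_\rho f(x)}{C_1\|f\|_{L^{(\Phi,\varphi)}}}\right)\le\Phi\left(\frac{Mf(x)}{C_0\|f\|_{L^{(\Phi,\varphi)}}}\right),\quad x\in\mathbb{R}^n.$$ Consequently, $M_\rho$ is bounded from $L^{(\Phi,\varphi)}(\mathbb{R}^n)$ to $\mathrm{w}L^{(\Psi,\varphi)}(\mathbb{R}^n)$. Moreover, if $\Phi\in\overline\nabla_2$, then, for all $f\in\mathrm{w}L^{(\Phi,\varphi)}(\mathbb{R}^n)$ with $f\not\equiv0$, $$\Psi\left(\frac{M_\rho f(x)}{C_1\|f\|_{\mathrm{w}L^{(\Phi,\varphi)}}}\right)\le\Phi\left(\frac{Mf(x)}{C_0\|f\|_{\mathrm{w}L^{(\Phi,\varphi)}}}\right),\quad x\in\mathbb{R}^n.$$ Consequently, if $\Phi\in\overline\nabla_2$,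 then $M_\rho$ is bounded from $L^{(\Phi,\varphi)}(\mathbb{R}^n)$ to $L^{(\Psi,\varphi)}(\mathbb{R}^n)$ and from $\mathrm{w}L^{(\Phi,\varphi)}(\mathbb{R}^n)$ to $\mathrm{w}L^{(\Psi,\varphi)}(\mathbb{R}^n)$. (ii) If $M_\rho$ is bounded from $L^{(\Phi,\varphi)}(\mathbb{R}^n)$ to $\mathrm{w}L^{(\Psi,\varphi)}(\mathbb{R}^n)$, then $( * )$ holds for some $A\in(0,\infty)$ and for all $r\in(0,\infty)$. (iii) In part (ii), the boundedness from $L^{(\Phi,\varphi)}(\mathbb{R}^n)$ to $\mathrm{w}L^{(\Psi,\varphi)}(\mathbb{R}^n)$ can be replaced by the boundedness from $L^{(\Phi,\varphi)}(\mathbb{R}^n)$ to $L^{(1,\Psi^{-1}(\varphi))}(\mathbb{R}^n)$; that is, if $M_\rho$ is bounded from $L^{(\Phi,\varphi)}(\mathbb{R}^n)$ to $L^{(1,\Psi^{-1}(\varphi))}(\mathbb{R}^n)$, then $( * )$ holds for some $A\in(0,\infty)$ and for all $r\in(0,\infty)$.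
   Context: $|G|$ is the Lebesgue measure of $G\subset\mathbb{R}^n$; $B(a,r)$ is the open ball with center $a$ and radius $r$; $m(G,f,t)=|\{x\in G:|f(x)|>t\}|$. The generalized fractional maximal operator is $M_\rho f(x)=\sup_{B(a,r)\ni x}\rho(r)\frac1{|B(a,r)|}\int_{B(a,r)}|f(y)|\,dy$, supremum over all balls $B(a,r)$ containing $x$; $M$ is the Hardy-Littlewood maximal operator, i.e. $M_\rho$ with $\rho\equiv1$. No conditions on $\rho$ other than positivity are imposed. An operator $T$ is bounded from $X$ to $Y$ if there is a constant $C>0$ with $\|Tf\|_Y\le C\|f\|_X$ for all $f\in X$. A function $\theta:(0,\infty)\to(0,\infty)$ is almost decreasing if there is $C>0$ with $\theta(s)\le C\theta(r)$ whenever $r<s$. "Increasing" means nondecreasing. For an increasing $\Phi:[0,\infty]\to[0,\infty]$ let $a(\Phi)=\sup\{t\ge0:\Phi(t)=0\}$ and $b(\Phi)=\inf\{t\ge0:\Phi(t)=\infty\}$, with $\sup\emptyset=0$, $\inf\emptyset=\infty$. $\overline{\varPhi}$ is the set of all increasing $\Phi:[0,\infty]\to[0,\infty]$ such that: $0\le a(\Phi)<\infty$ and $0<b(\Phi)\le\infty$; $\lim_{t\to+0}\Phi(t)=\Phi(0)=0$; $\Phi$ is left continuous on $[0,b(\Phi))$; if $b(\Phi)=\infty$ then $\lim_{t\to\infty}\Phi(t)=\Phi(\infty)=\infty$; if $b(\Phi)<\infty$ then $\lim_{t\to b(\Phi)-0}\Phi(t)=\Phi(b(\Phi))$ $(\le\infty)$.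 For $\Phi\in\overline{\varPhi}$ the generalized inverse is $\Phi^{-1}(u)=\inf\{t\ge0:\Phi(t)>u\}$ for $u\in[0,\infty)$ and $\Phi^{-1}(\infty)=\infty$. $\Phi\in\overline{\varPhi}$ is a Young function if it is convex on $[0,b(\Phi))$; $\varPhi_Y$ is the set of Young functions. $\Phi\approx\Psi$ means there is $C>0$ with $\Phi(C^{-1}t)\le\Psi(t)\le\Phi(Ct)$ for all $t\in[0,\infty]$. $\overline{\varPhi}_Y$ is the set of all $\Phi\in\overline{\varPhi}$ such that $\Phi\approx\Psi$ for some $\Psi\in\varPhi_Y$. $\overline\nabla_2$ is the set of all $\Phi\in\overline{\varPhi}$ for which there is $k>1$ with $\Phi(t)\le\frac1{2k}\Phi(kt)$ for all $t>0$. $\mathcal{G}^{\rm dec}$ is the set of all $\varphi:(0,\infty)\to(0,\infty)$ for which there is $C>0$ such that $C\varphi(r)\ge\varphi(s)$ and $\varphi(r)r^n\le C\varphi(s)s^n$ whenever $0<r<s<\infty$. For $\Phi\in\overline{\varPhi}_Y$, $\varphi:(0,\infty)\to(0,\infty)$ and $B=B(a,r)$, let $$\|f\|_{\Phi,\varphi,B}=\inf\Big\{\lambda>0:\frac1{\varphi(r)|B|}\int_B\Phi\Big(\frac{|f(x)|}\lambda\Big)dx\le1\Big\},\quad \|f\|_{\Phi,\varphi,B,\mathrm{weak}}=\inf\Big\{\lambda>0:\sup_{t\in(0,\infty)}\frac{\Phi(t)\,m(B,f/\lambda,t)}{|B|\varphi(r)}\le1\Big\}$$ (with $0\cdot\infty=0$).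 $L^{(\Phi,\varphi)}(\mathbb{R}^n)$ and $\mathrm{w}L^{(\Phi,\varphi)}(\mathbb{R}^n)$ are the sets of measurable $f$ on $\mathbb{R}^n$ with, respectively, $\|f\|_{L^{(\Phi,\varphi)}}=\sup_B\|f\|_{\Phi,\varphi,B}<\infty$ and $\|f\|_{\mathrm{w}L^{(\Phi,\varphi)}}=\sup_B\|f\|_{\Phi,\varphi,B,\mathrm{weak}}<\infty$, suprema over all balls $B$ in $\mathbb{R}^n$. $L^{(1,\psi)}(\mathbb{R}^n)$ is $L^{(\Phi,\psi)}(\mathbb{R}^n)$ for $\Phi(t)=t$, i.e. $\|f\|_{L^{(1,\psi)}}=\sup_{B=B(a,r)}\frac1{\psi(r)|B|}\int_B|f(x)|\,dx$; $\Psi^{-1}(\varphi)$ denotes the function $r\mapsto\Psi^{-1}(\varphi(r))$. *)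

theory Defs
  imports "HOL-Analysis.Analysis"
begin

section \<open>Generalized Young functions\<close>

definition a_inf :: "(ennreal \<Rightarrow> ennreal) \<Rightarrow> ennreal" where
  "a_inf \<Phi> = Sup {t. \<Phi> t = 0}"

definition b_sup :: "(ennreal \<Rightarrow> ennreal) \<Rightarrow> ennreal" where
  "b_sup \<Phi> = Inf {t. \<Phi> t = \<infinity>}"

definition Phi_bar :: "(ennreal \<Rightarrow> ennreal) set" where
  "Phi_bar = {\<Phi>. mono \<Phi> \<and>
     a_inf \<Phi> < \<infinity> \<and> 0 < b_sup \<Phi> \<and>
     (\<Phi> \<longlongrightarrow> 0) (at_right 0) \<and> \<Phi> 0 = 0 \<and>
     (\<forall>t < b_sup \<Phi>. (\<Phi> \<longlongrightarrow> \<Phi> t) (at_left t)) \<and>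
     (b_sup \<Phi> = \<infinity> \<longrightarrow> (\<Phi> \<longlongrightarrow> \<infinity>) (at_left \<infinity>) \<and> \<Phi> \<infinity> = \<infinity>) \<and>
     (b_sup \<Phi> < \<infinity> \<longrightarrow> (\<Phi> \<longlongrightarrow> \<Phi> (b_sup \<Phi>)) (at_left (b_sup \<Phi>)))}"

definition gen_inv :: "(ennreal \<Rightarrow> ennreal) \<Rightarrow> ennreal \<Rightarrow> ennreal" where
  "gen_inv \<Phi> u = (if u = \<infinity> then \<infinity> else Inf {t. \<Phi> t > u})"

text \<open>\<^const>\<open>convex_on\<close> needs a real vector space. No information is lost by passing to reals,
  since \<open>\<Phi>\<close> takes finite values on \<open>[0, b_sup \<Phi>)\<close> by definition of \<^const>\<open>b_sup\<close>.\<close>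

definition Phi_Young :: "(ennreal \<Rightarrow> ennreal) set" where
  "Phi_Young = {\<Phi> \<in> Phi_bar.
     convex_on {t::real. 0 \<le> t \<and> ennreal t < b_sup \<Phi>} (\<lambda>t. enn2real (\<Phi> (ennreal t)))}"

definition Phi_equiv :: "(ennreal \<Rightarrow> ennreal) \<Rightarrow> (ennreal \<Rightarrow> ennreal) \<Rightarrow> bool" where
  "Phi_equiv \<Phi> \<Psi> \<longleftrightarrow> (\<exists>C::real. C > 0 \<and>
     (\<forall>t. \<Phi> (ennreal (inverse C) * t) \<le> \<Psi> t \<and> \<Psi> t \<le> \<Phi> (ennreal C * t)))"

definition Phi_bar_Young :: "(ennreal \<Rightarrow> ennreal) set" where
  "Phi_bar_Young = {\<Phi> \<in> Phi_bar. \<exists>\<Psi> \<in> Phi_Young. Phi_equiv \<Phi> \<Psi>}"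

definition Nabla2_bar :: "(ennreal \<Rightarrow> ennreal) set" where
  "Nabla2_bar = {\<Phi> \<in> Phi_bar. \<exists>k::real. k > 1 \<and>
     (\<forall>t > 0. \<Phi> t \<le> ennreal (1 / (2 * k)) * \<Phi> (ennreal k * t))}"


section \<open>Growth functions\<close>

text \<open>A function \<open>(0,\<infinity>) \<rightarrow> (0,\<infinity>)\<close> is represented by a function on \<^typ>\<open>real\<close> whose values
  at nonpositive arguments are never used.\<close>

definition G_dec :: "nat \<Rightarrow> (real \<Rightarrow> real) set" where
  "G_dec n = {\<phi>. (\<forall>r > 0. \<phi> r > 0) \<and>
     (\<exists>C > 0. \<forall>r s. 0 < r \<and> r < s \<longrightarrow>
        C * \<phi> r \<ge> \<phi> s \<and> \<phi> r * r ^ n \<le> C * (\<phi> s * s ^ n))}"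

definition almost_decreasing :: "(real \<Rightarrow> ennreal) \<Rightarrow> bool" where
  "almost_decreasing \<theta> \<longleftrightarrow>
     (\<exists>C::real. C > 0 \<and> (\<forall>r s. 0 < r \<and> r < s \<longrightarrow> \<theta> s \<le> ennreal C * \<theta> r))"


section \<open>Orlicz--Morrey spaces\<close>

text \<open>Measurable functions are Lebesgue measurable and extended-real valued, so that maximal
  functions, which may be infinite at some points, belong to the same class. The quasi-norms take
  values in \<open>[0,\<infinity>]\<close>.\<close>

definition distr_fun :: "'a::euclidean_space set \<Rightarrow> ('a \<Rightarrow> ereal) \<Rightarrow> real \<Rightarrow> ennreal" where
  "distr_fun G f t = emeasure lebesgue {x \<in> G. \<bar>f x\<bar> > ereal t}"

definition ball_norm ::
  "(ennreal \<Rightarrow> ennreal) \<Rightarrow> (real \<Rightarrow> real) \<Rightarrow> 'a::euclidean_space \<Rightarrow> real \<Rightarrow> ('a \<Rightarrow> ereal) \<Rightarrow> ennreal"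
where
  "ball_norm \<Phi> \<phi> a r f = Inf {ennreal l | l. l > 0 \<and>
     (\<integral>\<^sup>+x \<in> ball a r. \<Phi> (e2ennreal (\<bar>f x\<bar> / ereal l)) \<partial>lebesgue)
       / (ennreal (\<phi> r) * emeasure lebesgue (ball a r)) \<le> 1}"

definition ball_norm_weak ::
  "(ennreal \<Rightarrow> ennreal) \<Rightarrow> (real \<Rightarrow> real) \<Rightarrow> 'a::euclidean_space \<Rightarrow> real \<Rightarrow> ('a \<Rightarrow> ereal) \<Rightarrow> ennreal"
where
  "ball_norm_weak \<Phi> \<phi> a r f = Inf {ennreal l | l. l > 0 \<and>
     (SUP t \<in> {0<..}. \<Phi> (ennreal t) * distr_fun (ball a r) (\<lambda>x. f x / ereal l) t
       / (emeasure lebesgue (ball a r) * ennreal (\<phi> r))) \<le> 1}"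

definition L_norm ::
  "(ennreal \<Rightarrow> ennreal) \<Rightarrow> (real \<Rightarrow> real) \<Rightarrow> ('a::euclidean_space \<Rightarrow> ereal) \<Rightarrow> ennreal" where
  "L_norm \<Phi> \<phi> f = (SUP (a, r) \<in> UNIV \<times> {0<..}. ball_norm \<Phi> \<phi> a r f)"

definition wL_norm ::
  "(ennreal \<Rightarrow> ennreal) \<Rightarrow> (real \<Rightarrow> real) \<Rightarrow> ('a::euclidean_space \<Rightarrow> ereal) \<Rightarrow> ennreal" where
  "wL_norm \<Phi> \<phi> f = (SUP (a, r) \<in> UNIV \<times> {0<..}. ball_norm_weak \<Phi> \<phi> a r f)"

definition L_space ::
  "(ennreal \<Rightarrow> ennreal) \<Rightarrow> (real \<Rightarrow> real) \<Rightarrow> ('a::euclidean_space \<Rightarrow> ereal) set" where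
  "L_space \<Phi> \<phi> = {f \<in> borel_measurable lebesgue. L_norm \<Phi> \<phi> f < \<infinity>}"

definition wL_space ::
  "(ennreal \<Rightarrow> ennreal) \<Rightarrow> (real \<Rightarrow> real) \<Rightarrow> ('a::euclidean_space \<Rightarrow> ereal) set" where
  "wL_space \<Phi> \<phi> = {f \<in> borel_measurable lebesgue. wL_norm \<Phi> \<phi> f < \<infinity>}"

abbreviation L1_norm :: "(real \<Rightarrow> real) \<Rightarrow> ('a::euclidean_space \<Rightarrow> ereal) \<Rightarrow> ennreal" where
  "L1_norm \<equiv> L_norm (\<lambda>t. t)"

abbreviation L1_space :: "(real \<Rightarrow> real) \<Rightarrow> ('a::euclidean_space \<Rightarrow> ereal) set" where
  "L1_space \<equiv> L_space (\<lambda>t. t)"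

text \<open>The function \<open>r \<mapsto> \<Psi>\<^sup>-\<^sup>1(\<phi>(r))\<close>. For \<open>\<Psi> \<in> Phi_bar\<close> and \<open>\<phi> r > 0\<close> the value of
  \<^const>\<open>gen_inv\<close> is positive and finite, so the conversion to \<^typ>\<open>real\<close> is harmless.\<close>

definition inv_comp :: "(ennreal \<Rightarrow> ennreal) \<Rightarrow> (real \<Rightarrow> real) \<Rightarrow> real \<Rightarrow> real" where
  "inv_comp \<Psi> \<phi> r = enn2real (gen_inv \<Psi> (ennreal (\<phi> r)))"


section \<open>Generalized fractional maximal operators\<close>

definition M_frac :: "(real \<Rightarrow> real) \<Rightarrow> ('a::euclidean_space \<Rightarrow> ereal) \<Rightarrow> 'a \<Rightarrow> ennreal" where
  "M_frac \<rho> f x = (SUP (a, r) \<in> {(a, r). 0 < r \<and> x \<in> ball a r}.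
     ennreal (\<rho> r) * ((\<integral>\<^sup>+y \<in> ball a r. e2ennreal \<bar>f y\<bar> \<partial>lebesgue) / emeasure lebesgue (ball a r)))"

abbreviation M_HL :: "('a::euclidean_space \<Rightarrow> ereal) \<Rightarrow> 'a \<Rightarrow> ennreal" where
  "M_HL \<equiv> M_frac (\<lambda>_. 1)"

abbreviation M_op :: "(real \<Rightarrow> real) \<Rightarrow> ('a::euclidean_space \<Rightarrow> ereal) \<Rightarrow> 'a \<Rightarrow> ereal" where
  "M_op \<rho> f \<equiv> (\<lambda>x. enn2ereal (M_frac \<rho> f x))"

definition bounded_from_to ::
  "(('a \<Rightarrow> ereal) \<Rightarrow> 'a \<Rightarrow> ereal) \<Rightarrow> ('a \<Rightarrow> ereal) set \<Rightarrow> (('a \<Rightarrow> ereal) \<Rightarrow> ennreal)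
    \<Rightarrow> ('a \<Rightarrow> ereal) set \<Rightarrow> (('a \<Rightarrow> ereal) \<Rightarrow> ennreal) \<Rightarrow> bool" where
  "bounded_from_to T X normX Y normY \<longleftrightarrow>
     (\<exists>C::real. C > 0 \<and> (\<forall>f \<in> X. T f \<in> Y \<and> normY (T f) \<le> ennreal C * normX f))"

definition rho_condition ::
  "(real \<Rightarrow> real) \<Rightarrow> (ennreal \<Rightarrow> ennreal) \<Rightarrow> (ennreal \<Rightarrow> ennreal) \<Rightarrow> (real \<Rightarrow> real) \<Rightarrow> bool" where
  "rho_condition \<rho> \<Phi> \<Psi> \<phi> \<longleftrightarrow> (\<exists>A::real. A > 0 \<and> (\<forall>r > 0.
     (SUP t \<in> {0<..r}. ennreal (\<rho> t)) * gen_inv \<Phi> (ennreal (\<phi> r))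
       \<le> ennreal A * gen_inv \<Psi> (ennreal (\<phi> r))))"

end

theory Submission
  imports Defs
begin

text \<open>
  If \<open>f\<close> has norm at most 1, its average over a ball of radius \<open>r\<close> is at most a constant times
  \<open>\<Phi>\<^sup>-\<^sup>1(\<phi>(r))\<close>. Put \<open>u = \<Phi>(M f(x) / C\<^sub>0)\<close>. For a ball with \<open>\<phi>(r) \<le> u\<close> this bound and the condition on \<open>\<rho>\<close> give
  \<open>\<rho>(r) avg |f| \<lesssim> \<Psi>\<^sup>-\<^sup>1(\<phi>(r)) \<le> \<Psi>\<^sup>-\<^sup>1(u)\<close>. For a ball with \<open>u < \<phi>(r)\<close> one has
  \<open>avg |f| \<le> M f(x) \<lesssim> \<Phi>\<^sup>-\<^sup>1(u)\<close>, and either almost monotonicity of \<open>\<Psi>\<^sup>-\<^sup>1 / \<Phi>\<^sup>-\<^sup>1\<close>, or that condition at a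
  radius \<open>s \<ge> r\<close> with \<open>\<phi>(s)\<close> comparable to \<open>u\<close>, again gives \<open>\<rho>(r) \<Phi>\<^sup>-\<^sup>1(u) \<lesssim> \<Psi>\<^sup>-\<^sup>1(u)\<close>. This is the
  pointwise inequality, which reduces the norm inequalities to those for \<open>M\<close>: on \<open>B(a,r)\<close>, balls
  of radius larger than \<open>r\<close> contribute at most a constant times \<open>\<Phi>\<^sup>-\<^sup>1(\<phi>(r))\<close>, and the others see
  only \<open>f\<close> restricted to \<open>B(a,3r)\<close>, to which the weak type (1,1) inequality applies after
  truncation at height \<open>t\<close>. For the necessity of the condition on \<open>\<rho>\<close>, test with the indicator of \<open>B(0,r)\<close>: its
  norm is at most a constant over \<open>\<Phi>\<^sup>-\<^sup>1(\<phi>(r))\<close>, while every point of \<open>B(0,r)\<close> lies in a ball of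
  radius \<open>t\<close> contained in \<open>B(0,r)\<close>, for each \<open>t \<le> r\<close>.
\<close>

section \<open>Generalized Young functions and their inverses\<close>

text \<open>A function in \<open>Phi_bar\<close> may vanish near 0, jump, stay constant on intervals
  or become infinite at a finite point. Inversion is replaced by two one-sided facts, t \<le>
  \<Phi>^-1(\<Phi>(t)) and \<Phi>(\<Phi>^-1(u)) \<le> u. As \<Phi> need not be differentiable,
  integrals of \<Phi> are compared with sums over geometric levels e k^j. A constant c in front of
  \<Phi> is absorbed by enlarging its argument by K c; most factors K below arise in this way. The
  constant C0 of the pointwise inequality is free, so the norm estimates for M can take it large
  enough to turn all their constants into 1.

  Norms are infima over admissible l. Every estimate is therefore made in modular form for a
  function divided by some l strictly above its norm. Letting l decrease gives the norm
  inequalities; taking l to be twice the norm gives the pointwise one. Since \<phi> may be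
  discontinuous, a prescribed level need not be a value of \<phi>; the growth of \<phi>(r) r^n
  supplies a radius where \<phi> is within a fixed factor of it.\<close>

lemma ennreal_divide_le_iff:
  fixes v :: ennreal
  assumes "0 < v" "v < \<infinity>"
  shows "X / v \<le> c \<longleftrightarrow> X \<le> c * v"
proof
  assume "X / v \<le> c"
  then have "X / v * v \<le> c * v" by (rule mult_right_mono) simp
  then show "X \<le> c * v"
    using assms by (simp add: ennreal_divide_times)
next
  assume "X \<le> c * v"
  then show "X / v \<le> c"
    using assms by (intro divide_le_posI_ennreal) (auto simp: mult.commute)
qed

lemma ennreal_le_mult_of_divide_le: "0 < c \<Longrightarrow> X / ennreal c \<le> Y \<Longrightarrow> X \<le> ennreal c * Y"
  by (simp add: ennreal_divide_le_iff mult.commute)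

lemma ennreal_less_divide_real_iff: "0 < c \<Longrightarrow> Y < X / ennreal c \<longleftrightarrow> ennreal c * Y < X"
  unfolding not_le[symmetric] by (subst ennreal_divide_le_iff) (simp_all add: mult.commute)

lemma ennreal_divide_divide:
  "0 < a \<Longrightarrow> 0 < b \<Longrightarrow> x / ennreal a / ennreal b = x / ennreal (a * b)"
  by (simp add: divide_ennreal_def ennreal_mult ennreal_inverse_mult mult.assoc)

text \<open>Meant for v = \<Psi>(t), which may be infinite: below it only finite levels w have to be
  handled, and these have a finite inverse.\<close>

lemma ennreal_mult_le_dense:
  fixes v e X :: ennreal
  assumes "e < \<infinity>" "\<And>w. w < v \<Longrightarrow> w * e \<le> X"
  shows "v * e \<le> X"
proof (cases "e = 0")
  case False
  have "v \<le> X / e"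
  proof (rule dense_le)
    fix w assume "w < v"
    have "w = w * e / e" using False assms(1) by (simp add: ennreal_mult_divide_eq)
    also have "\<dots> \<le> X / e" using assms(2)[OF \<open>w < v\<close>] by (rule divide_right_mono_ennreal)
    finally show "w \<le> X / e" .
  qed
  then have "v * e \<le> X / e * e" by (rule mult_right_mono) simp
  also have "\<dots> = X" using False assms(1) by (simp add: ennreal_divide_times)
  finally show ?thesis .
qed simp

text \<open>A superlevel set of a monotone function is a ray starting at its infimum, closed or open
  according to whether the infimum itself belongs to it.\<close>

lemma borel_measurable_mono_ennreal:
  fixes \<Phi> :: "ennreal \<Rightarrow> ennreal"
  assumes "mono \<Phi>"
  shows "\<Phi> \<in> borel_measurable borel"
proof (rule borel_measurableI_greater)
  fix t
  let ?s = "Inf {x. t < \<Phi> x}"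
  have "{x. t < \<Phi> x} = {?s..} \<or> {x. t < \<Phi> x} = {?s<..}"
  proof (cases "t < \<Phi> ?s")
    case True
    have "t < \<Phi> x" if "?s \<le> x" for x
      using True monoD[OF assms that] by (rule less_le_trans)
    moreover have "?s \<le> x" if "t < \<Phi> x" for x
      using that by (intro Inf_lower) simp
    ultimately have "{x. t < \<Phi> x} = {?s..}" by blast
    then show ?thesis ..
  next
    case False
    have "{x. t < \<Phi> x} = {?s<..}"
    proof (intro set_eqI iffI)
      fix x assume "x \<in> {x. t < \<Phi> x}"
      then have "t < \<Phi> x" by simp
      then have "?s \<le> x" by (intro Inf_lower) simp
      moreover have "?s \<noteq> x" using False \<open>t < \<Phi> x\<close> by blast
      ultimately show "x \<in> {?s<..}" by simp
    next
      fix x assume "x \<in> {?s<..}"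
      then obtain y where "t < \<Phi> y" "y < x" unfolding greaterThan_iff Inf_less_iff by blast
      then show "x \<in> {x. t < \<Phi> x}" using monoD[OF assms, of y x] by (blast intro: less_le_trans less_imp_le)
    qed
    then show ?thesis ..
  qed
  then have "{x. t < \<Phi> x} \<in> sets borel"
    using atLeast_borel[of ?s] greaterThan_borel[of ?s] by (elim disjE) (erule ssubst, assumption)+
  then show "{x \<in> space borel. t < \<Phi> x} \<in> sets borel" by simp
qed

section \<open>Inverting the functions in \<open>Phi_bar\<close>\<close>

lemma Phi_bar_mono: "\<Phi> \<in> Phi_bar \<Longrightarrow> mono \<Phi>"
  and Phi_bar_0: "\<Phi> \<in> Phi_bar \<Longrightarrow> \<Phi> 0 = 0"
  by (simp_all add: Phi_bar_def)

lemma Phi_bar_top: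
  assumes "\<Phi> \<in> Phi_bar"
  shows "\<Phi> \<infinity> = \<infinity>"
proof (cases "b_sup \<Phi> = \<infinity>")
  case True
  then show ?thesis using assms by (simp add: Phi_bar_def)
next
  case False
  then have "b_sup \<Phi> < top" by (simp add: less_top)
  then obtain t where "\<Phi> t = \<infinity>" unfolding b_sup_def Inf_less_iff by blast
  then show ?thesis
    using monoD[OF Phi_bar_mono[OF assms], of t \<infinity>] by (simp add: top_unique)
qed

lemma gen_inv_less_imp:
  assumes "mono \<Phi>" "u < \<infinity>" "gen_inv \<Phi> u < t"
  shows "u < \<Phi> t"
proof -
  have "Inf {t. u < \<Phi> t} < t" using assms(2,3) by (simp add: gen_inv_def split: if_splits)
  then obtain s where "u < \<Phi> s" "s < t" unfolding Inf_less_iff by blast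
  then show ?thesis using monoD[OF assms(1), of s t] by (meson less_imp_le less_le_trans)
qed

lemma le_gen_inv:
  assumes "mono \<Phi>" "\<Phi> t \<le> u"
  shows "t \<le> gen_inv \<Phi> u"
proof (cases "u = \<infinity>")
  case False
  then show ?thesis
    using gen_inv_less_imp[OF assms(1), of u t] assms(2)
    by (auto simp: less_top not_less[symmetric])
qed (simp add: gen_inv_def)

lemma gen_inv_le: "u < \<Phi> t \<Longrightarrow> gen_inv \<Phi> u \<le> t"
  by (cases "u = \<infinity>") (auto simp: gen_inv_def intro: Inf_lower)

lemma gen_inv_mono: "u \<le> v \<Longrightarrow> gen_inv \<Phi> u \<le> gen_inv \<Phi> v"
  by (auto simp: gen_inv_def top_unique intro!: Inf_superset_mono)

text \<open>Since \<Phi> tends to 0 at 0, it stays below u on some interval (0, d), so no point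
  below d competes in the infimum.\<close>

lemma gen_inv_pos:
  assumes "\<Phi> \<in> Phi_bar" "0 < u"
  shows "0 < gen_inv \<Phi> u"
proof (cases "u = \<infinity>")
  case False
  have "\<forall>\<^sub>F t in at_right 0. \<Phi> t < u"
    using assms by (intro order_tendstoD) (auto simp: Phi_bar_def)
  then obtain d where d: "0 < d" "\<And>t. 0 < t \<Longrightarrow> t < d \<Longrightarrow> \<Phi> t < u"
    by (auto simp: eventually_at_right[of 0 top])
  have "d \<le> gen_inv \<Phi> u"
    unfolding gen_inv_def using False d Phi_bar_0[OF assms(1)]
    by (auto intro!: Inf_greatest) (metis leI less_asym not_gr_zero)
  then show ?thesis using d by auto
qed (simp add: gen_inv_def)

text \<open>Either \<Phi> tends to infinity along finite arguments, or it is already infinite at one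
  of them. In both cases some finite t satisfies \<Phi>(t) > u.\<close>

lemma gen_inv_finite:
  assumes "\<Phi> \<in> Phi_bar" "u < \<infinity>"
  shows "gen_inv \<Phi> u < \<infinity>"
proof (cases "b_sup \<Phi> = \<infinity>")
  case True
  then have "(\<Phi> \<longlongrightarrow> \<infinity>) (at_left \<infinity>)" using assms by (simp add: Phi_bar_def)
  then have "\<forall>\<^sub>F t in at_left \<infinity>. u < \<Phi> t"
    using assms(2) by (rule order_tendstoD)
  then obtain b where "b < (\<infinity>::ennreal)" "\<And>t. b < t \<Longrightarrow> t < \<infinity> \<Longrightarrow> u < \<Phi> t"
    by (auto simp: eventually_at_left[of 0 top])
  moreover then obtain t where "b < t" "t < \<infinity>" using dense by blast
  ultimately show ?thesis using gen_inv_le by (metis le_less_trans)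
next
  case False
  then have "b_sup \<Phi> < \<infinity>" by (simp add: less_top)
  then obtain t where "\<Phi> t = \<infinity>" "t < \<infinity>" unfolding b_sup_def Inf_less_iff by blast
  then show ?thesis using gen_inv_le[of u \<Phi> t] assms(2) by (metis le_less_trans)
qed

text \<open>Strictly below \<Phi>^-1(u) all values are at most u, and left continuity carries this
  bound to the point itself.\<close>

lemma Phi_gen_inv_le:
  assumes "\<Phi> \<in> Phi_bar"
  shows "\<Phi> (gen_inv \<Phi> u) \<le> u"
proof (cases "gen_inv \<Phi> u = 0 \<or> u = \<infinity>")
  case False
  define s where "s = gen_inv \<Phi> u"
  have "0 < s" using False by (auto simp: s_def zero_less_iff_neq_zero)
  \<comment> \<open>Beyond \<open>b_sup\<close> nothing is known about left limits. Up to and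
    including it, one of the clauses of \<open>Phi_bar\<close> provides the limit.\<close>
  have "s \<le> b_sup \<Phi>"
    unfolding s_def b_sup_def using False
    by (intro Inf_greatest gen_inv_le) (auto simp: less_top)
  then have "(\<Phi> \<longlongrightarrow> \<Phi> s) (at_left s)"
    using assms by (cases "s = b_sup \<Phi>"; cases "b_sup \<Phi> = \<infinity>") (auto simp: Phi_bar_def less_top)
  moreover have "\<forall>\<^sub>F t in at_left s. \<Phi> t \<le> u"
    using gen_inv_le[of u \<Phi>] unfolding s_def[symmetric]
    by (auto simp: eventually_at_left[OF \<open>0 < s\<close>] intro!: exI[of _ 0] \<open>0 < s\<close>) (meson leD leI)
  moreover have "at_left s \<noteq> bot"
    unfolding trivial_limit_def eventually_at_left[OF \<open>0 < s\<close>] using dense by blast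
  ultimately have "\<Phi> s \<le> u" by (intro tendsto_upperbound)
  then show ?thesis by (simp add: s_def)
qed (auto simp: Phi_bar_0[OF assms])

text \<open>A point t with \<Phi>(t) > 0 has \<Phi>(t) > v for all small v > 0, so a bound by the
  inverse at small positive levels passes to level 0. That level occurs whenever \<Phi>(M f(x) / C0)
  = 0, while the hypotheses on \<phi> and on the quotient of the inverses speak of positive
  levels.\<close>

lemma le_gen_inv_0:
  assumes "0 < d" "\<And>v. 0 < v \<Longrightarrow> v < d \<Longrightarrow> X \<le> ennreal c * gen_inv \<Phi> v" "0 < c"
  shows "X \<le> ennreal c * gen_inv \<Phi> 0"
proof -
  have "X / ennreal c \<le> gen_inv \<Phi> 0"
    unfolding gen_inv_def
  proof (simp, rule Inf_greatest, simp)
    fix t assume t: "0 < \<Phi> t"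
    obtain v where v: "0 < v" "v < min (\<Phi> t) d"
      using dense[of 0 "min (\<Phi> t) d"] t assms(1) by auto
    then have "X \<le> ennreal c * t"
      using assms(2)[of v] gen_inv_le[of v \<Phi> t]
      by (meson dual_order.trans min_less_iff_conj mult_left_mono zero_le)
    then show "X / ennreal c \<le> t"
      using assms(3) by (intro divide_le_posI_ennreal) (auto simp: mult.commute)
  qed
  then show ?thesis
    using assms(3)
    by (intro ennreal_le_mult_of_divide_le)
qed

text \<open>Unlike convexity, this property survives the passage to an equivalent function; it is
  all that is needed of convexity, and Jensen's inequality is never used.\<close>

definition superhomogeneous :: "real \<Rightarrow> (ennreal \<Rightarrow> ennreal) \<Rightarrow> bool" where
  "superhomogeneous K \<Phi> \<longleftrightarrow> 1 \<le> K \<and> (\<forall>c\<ge>1. \<forall>t. ennreal c * \<Phi> t \<le> \<Phi> (ennreal (K * c) * t))"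

text \<open>Doubling the argument on the right avoids the endpoint \<open>b_sup \<Phi>\<close>, where convexity is not
  assumed.\<close>

lemma Young_superhomogeneous:
  assumes "\<Phi> \<in> Phi_Young" "1 \<le> c"
  shows "ennreal c * \<Phi> t \<le> \<Phi> (ennreal (2 * c) * t)"
proof -
  have P: "\<Phi> \<in> Phi_bar" and conv: "convex_on {t::real. 0 \<le> t \<and> ennreal t < b_sup \<Phi>} (\<lambda>t. enn2real (\<Phi> (ennreal t)))"
    using assms by (auto simp: Phi_Young_def)
  have m: "mono \<Phi>" using P by (rule Phi_bar_mono)
  have bpos: "0 < b_sup \<Phi>" using P by (simp add: Phi_bar_def)
  have above: "\<Phi> s = \<infinity>" if "b_sup \<Phi> < s" for s
  proof -
    obtain r where "\<Phi> r = \<infinity>" "r < s" using \<open>b_sup \<Phi> < s\<close> unfolding b_sup_def Inf_less_iff by blast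
    then show ?thesis using monoD[OF m, of r s] by (simp add: top_unique)
  qed
  have below: "\<Phi> s < \<infinity>" if "s < b_sup \<Phi>" for s
  proof (rule ccontr)
    assume "\<not> \<Phi> s < \<infinity>"
    then have "b_sup \<Phi> \<le> s" unfolding b_sup_def by (intro Inf_lower) (auto simp: less_top[symmetric])
    then show False using that by auto
  qed
  show ?thesis
  proof (cases "t = \<infinity>")
    case True
    then have "ennreal (2 * c) * t = \<infinity>" using assms(2) by (simp add: ennreal_mult_top)
    then show ?thesis using Phi_bar_top[OF P] by simp
  next
    case False
    then obtain x where x: "t = ennreal x" "0 \<le> x" by (cases t) auto
    have ct: "ennreal c * t = ennreal (c * x)" "ennreal (2 * c) * t = ennreal (2 * c * x)"
      using x assms(2) by (simp_all add: ennreal_mult)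
    show ?thesis
    proof (cases "ennreal (c * x) < b_sup \<Phi>")
      case True
      \<comment> \<open>The point \<open>x\<close> divides the segment from 0 to
        \<open>c * x\<close> with weight 1/c, and \<Phi>(0) = 0 removes the other term.\<close>
      have "enn2real (\<Phi> (ennreal ((1 - 1 / c) *\<^sub>R 0 + (1 / c) *\<^sub>R (c * x))))
          \<le> (1 - 1 / c) * enn2real (\<Phi> (ennreal 0)) + (1 / c) * enn2real (\<Phi> (ennreal (c * x)))"
        using assms(2) x True bpos by (intro convex_onD[OF conv]) auto
      then have 1: "enn2real (\<Phi> t) \<le> enn2real (\<Phi> (ennreal (c * x))) / c"
        using assms(2) x by (simp add: Phi_bar_0[OF P])
      have "\<Phi> (ennreal (c * x)) < \<infinity>" using True by (rule below)
      moreover have "\<Phi> t \<le> \<Phi> (ennreal (c * x))"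
        using assms(2) x by (intro monoD[OF m]) (simp add: mult_le_cancel_right1)
      ultimately have "\<Phi> t < \<infinity>" by auto
      have "ennreal c * \<Phi> t = ennreal (c * enn2real (\<Phi> t))"
        using \<open>\<Phi> t < \<infinity>\<close> assms(2) by (simp add: ennreal_mult ennreal_enn2real_if less_top)
      also have "\<dots> \<le> ennreal (enn2real (\<Phi> (ennreal (c * x))))"
        using 1 assms(2) by (intro ennreal_leI) (simp add: field_simps)
      also have "\<dots> = \<Phi> (ennreal (c * x))"
        using \<open>\<Phi> (ennreal (c * x)) < \<infinity>\<close> by (simp add: ennreal_enn2real_if less_top)
      also have "\<dots> \<le> \<Phi> (ennreal (2 * c) * t)"
        unfolding ct using x assms(2) by (intro monoD[OF m] ennreal_leI) simp
      finally show ?thesis .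
    next
      case False
      with False bpos have "0 < c * x" by (metis ennreal_less_zero_iff leI order_less_le_trans)
      then have "ennreal (c * x) < ennreal (2 * c * x)" by (intro ennreal_lessI) auto
      with False have "b_sup \<Phi> < ennreal (2 * c) * t" unfolding ct by auto
      then show ?thesis using above by simp
    qed
  qed
qed

lemma Phi_bar_Young_superhomogeneous:
  assumes "\<Phi> \<in> Phi_bar_Young"
  obtains K where "superhomogeneous K \<Phi>"
proof -
  obtain Y C where Y: "Y \<in> Phi_Young" and C: "0 < C"
    and le: "\<And>t. \<Phi> (ennreal (inverse C) * t) \<le> Y t" "\<And>t. Y t \<le> \<Phi> (ennreal C * t)"
    using assms by (auto simp: Phi_bar_Young_def Phi_equiv_def)
  have m: "mono \<Phi>" using assms by (auto simp: Phi_bar_Young_def intro: Phi_bar_mono)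
  \<comment> \<open>Each side of the equivalence contributes one factor C, and the Young function
    contributes the 2.\<close>
  define K where "K = max 1 (2 * C * C)"
  have "ennreal c * \<Phi> t \<le> \<Phi> (ennreal (K * c) * t)" if "1 \<le> c" for c t
  proof -
    have "ennreal (inverse C) * (ennreal C * t) = t"
      using C by (simp add: mult.assoc[symmetric] ennreal_mult[symmetric])
    then have "\<Phi> t \<le> Y (ennreal C * t)" using le(1)[of "ennreal C * t"] by simp
    then have "ennreal c * \<Phi> t \<le> ennreal c * Y (ennreal C * t)" by (rule mult_left_mono) simp
    also have "\<dots> \<le> Y (ennreal (2 * c) * (ennreal C * t))" by (rule Young_superhomogeneous[OF Y that])
    also have "\<dots> \<le> \<Phi> (ennreal C * (ennreal (2 * c) * (ennreal C * t)))" by (rule le)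
    also have "ennreal C * (ennreal (2 * c) * (ennreal C * t)) = ennreal (2 * C * C * c) * t"
      using C that by (simp add: ennreal_mult mult_ac)
    also have "\<Phi> \<dots> \<le> \<Phi> (ennreal (K * c) * t)"
      using that by (intro monoD[OF m] mult_right_mono ennreal_leI) (auto simp: K_def)
    finally show ?thesis .
  qed
  then show ?thesis using that[of K] by (auto simp: superhomogeneous_def K_def)
qed

lemma superhomogeneousD: "superhomogeneous K \<Phi> \<Longrightarrow> 1 \<le> c \<Longrightarrow> ennreal c * \<Phi> t \<le> \<Phi> (ennreal (K * c) * t)"
  by (simp add: superhomogeneous_def)

text \<open>If t competes in the infimum at level u, then K c t competes at level c u. This moves
  the constants of the growth conditions on \<phi> out of the inverse.\<close>

lemma gen_inv_doubling:
  assumes q: "superhomogeneous K \<Phi>" and "1 \<le> c" 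
  shows "gen_inv \<Phi> (ennreal c * u) \<le> ennreal (K * c) * gen_inv \<Phi> u"
proof (cases "u = \<infinity>")
  case True
  then show ?thesis using assms by (auto simp: gen_inv_def superhomogeneous_def ennreal_mult_top)
next
  case False
  have K: "1 \<le> K" using q by (simp add: superhomogeneous_def)
  have "gen_inv \<Phi> (ennreal c * u) / ennreal (K * c) \<le> t" if "u < \<Phi> t" for t
  proof -
    have "ennreal c * u < ennreal c * \<Phi> t"
      using that \<open>1 \<le> c\<close> by (intro ennreal_mult_strict_left_mono) auto
    also have "\<dots> \<le> \<Phi> (ennreal (K * c) * t)" using q \<open>1 \<le> c\<close> by (rule superhomogeneousD)
    finally have "gen_inv \<Phi> (ennreal c * u) \<le> ennreal (K * c) * t" by (rule gen_inv_le)
    then show ?thesis using K \<open>1 \<le> c\<close>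
      by (intro divide_le_posI_ennreal) (auto simp: mult.commute intro: mult_pos_pos)
  qed
  then have "gen_inv \<Phi> (ennreal c * u) / ennreal (K * c) \<le> gen_inv \<Phi> u"
    using False unfolding gen_inv_def[of \<Phi> u] by (auto intro: Inf_greatest)
  moreover have "0 < K * c" using K \<open>1 \<le> c\<close> by (intro mult_pos_pos) auto
  ultimately show ?thesis
    by (intro ennreal_le_mult_of_divide_le)
qed

section \<open>Averages and maximal operators\<close>

declare emeasure_completion [simp del]

lemma ball_sets_lebesgue [measurable]: "ball a r \<in> sets lebesgue"
  by simp

lemma emeasure_lebesgue_ball:
  "0 < r \<Longrightarrow> emeasure lebesgue (ball (a::'a::euclidean_space) r)
    = ennreal (unit_ball_vol (real DIM('a)) * r ^ DIM('a))"
  by (simp add: emeasure_completion emeasure_ball)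

lemma emeasure_ball_pos: "0 < r \<Longrightarrow> 0 < emeasure lebesgue (ball (a::'a::euclidean_space) r)"
  by (simp add: emeasure_lebesgue_ball)

lemma emeasure_ball_finite: "0 < r \<Longrightarrow> emeasure lebesgue (ball (a::'a::euclidean_space) r) < \<infinity>"
  by (simp add: emeasure_lebesgue_ball)

lemma emeasure_ball_scale:
  fixes a b :: "'a::euclidean_space"
  assumes "0 < c" "0 < r"
  shows "emeasure lebesgue (ball a (c * r)) = ennreal (c ^ DIM('a)) * emeasure lebesgue (ball b r)"
  using assms
  by (simp add: emeasure_lebesgue_ball power_mult_distrib ennreal_mult[symmetric] mult_ac)

definition avg :: "('a::euclidean_space \<Rightarrow> ennreal) \<Rightarrow> 'a \<Rightarrow> real \<Rightarrow> ennreal" where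
  "avg F a r = (\<integral>\<^sup>+y\<in>ball a r. F y \<partial>lebesgue) / emeasure lebesgue (ball a r)"

definition maxop :: "(real \<Rightarrow> real) \<Rightarrow> ('a::euclidean_space \<Rightarrow> ennreal) \<Rightarrow> 'a \<Rightarrow> ennreal" where
  "maxop \<rho> F x = (SUP (a, r) \<in> {(a, r). 0 < r \<and> x \<in> ball a r}. ennreal (\<rho> r) * avg F a r)"

lemma M_frac_eq_maxop: "M_frac \<rho> f = maxop \<rho> (\<lambda>y. e2ennreal \<bar>f y\<bar>)"
  by (simp add: M_frac_def maxop_def avg_def fun_eq_iff)

lemma less_maxop_iff:
  "t < maxop \<rho> F x \<longleftrightarrow> (\<exists>a r. 0 < r \<and> x \<in> ball a r \<and> t < ennreal (\<rho> r) * avg F a r)"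
  by (auto simp: maxop_def less_SUP_iff)

lemma maxop_upper: "0 < r \<Longrightarrow> x \<in> ball a r \<Longrightarrow> ennreal (\<rho> r) * avg F a r \<le> maxop \<rho> F x"
  unfolding maxop_def by (rule SUP_upper2[of "(a, r)"]) auto

lemma maxop_least:
  "(\<And>a r. 0 < r \<Longrightarrow> x \<in> ball a r \<Longrightarrow> ennreal (\<rho> r) * avg F a r \<le> c) \<Longrightarrow> maxop \<rho> F x \<le> c"
  unfolding maxop_def by (rule SUP_least) auto

text \<open>Because the supremum runs over all balls containing x, and not only those centred at x,
  a superlevel set is a union of open balls and hence open.\<close>

lemma maxop_measurable [measurable]: "maxop \<rho> F \<in> borel_measurable lebesgue"
proof (rule borel_measurableI_greater)
  fix t
  have "{x. t < maxop \<rho> F x} = (\<Union>(a, r)\<in>{(a, r). 0 < r \<and> t < ennreal (\<rho> r) * avg F a r}. ball a r)"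
    by (fastforce simp: less_maxop_iff)
  then have "open {x. t < maxop \<rho> F x}" by auto
  then show "{x \<in> space lebesgue. t < maxop \<rho> F x} \<in> sets lebesgue"
    by (simp add: borel_open)
qed

lemma avg_le_iff:
  "0 < r \<Longrightarrow> avg F a r \<le> c \<longleftrightarrow> (\<integral>\<^sup>+y\<in>ball a r. F y \<partial>lebesgue) \<le> c * emeasure lebesgue (ball a r)"
  unfolding avg_def by (intro ennreal_divide_le_iff emeasure_ball_pos emeasure_ball_finite)

lemma less_avg_iff:
  "0 < r \<Longrightarrow> c < avg F a r \<longleftrightarrow> c * emeasure lebesgue (ball a r) < (\<integral>\<^sup>+y\<in>ball a r. F y \<partial>lebesgue)"
  using avg_le_iff[of r F a c] by (simp add: not_le[symmetric])

lemma avg_mono: "(\<And>y. y \<in> ball a r \<Longrightarrow> F y \<le> G y) \<Longrightarrow> avg F a r \<le> avg G a r"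
  unfolding avg_def
  by (intro divide_right_mono_ennreal nn_integral_mono) (auto split: split_indicator)

lemma avg_cdiv:
  assumes "F \<in> borel_measurable lebesgue"
  shows "avg (\<lambda>y. F y / ennreal l) a r = avg F a r / ennreal l"
proof -
  have "(\<lambda>y. F y * indicator (ball a r) y) \<in> borel_measurable lebesgue"
    using assms by measurable
  then have "(\<integral>\<^sup>+y\<in>ball a r. (F y / ennreal l) \<partial>lebesgue) = (\<integral>\<^sup>+y\<in>ball a r. F y \<partial>lebesgue) / ennreal l"
    unfolding divide_ennreal_def
    by (subst nn_integral_multc[symmetric]) (auto simp: mult_ac)
  then show ?thesis
    by (simp add: avg_def divide_ennreal_def mult_ac)
qed

lemma maxop_cdiv:
  assumes "F \<in> borel_measurable lebesgue"
  shows "maxop \<rho> (\<lambda>y. F y / ennreal l) x = maxop \<rho> F x / ennreal l"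
  unfolding maxop_def SUP_divide_ennreal avg_cdiv[OF assms]
  by (intro SUP_cong) (auto simp: ennreal_times_divide)

text \<open>The superlevel set is covered by balls on which the average of G exceeds t. The Vitali
  covering lemma selects countably many disjoint ones whose fivefold enlargements still cover it;
  each enlargement costs 5^n in volume, and disjointness bounds the sum of the integrals of G by the
  whole integral.\<close>

theorem maxop_weak_type:
  fixes G :: "'a::euclidean_space \<Rightarrow> ennreal"
  assumes G[measurable]: "G \<in> borel_measurable lebesgue" and t: "0 < t"
  shows "ennreal t * emeasure lebesgue {x. ennreal t < maxop (\<lambda>_. 1) G x}
    \<le> ennreal (5 ^ DIM('a)) * (\<integral>\<^sup>+x. G x \<partial>lebesgue)"
proof (cases "(\<integral>\<^sup>+x. G x \<partial>lebesgue) = \<infinity>")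
  case True
  then show ?thesis by (simp add: ennreal_mult_top)
next
  case False
  then obtain I where I: "(\<integral>\<^sup>+x. G x \<partial>lebesgue) = ennreal I" "0 \<le> I"
    by (cases "\<integral>\<^sup>+x. G x \<partial>lebesgue") auto
  define S where "S = {x. ennreal t < maxop (\<lambda>_. 1) G x}"
  define K where "K = {(a::'a, r). 0 < r \<and> ennreal t < avg G a r}"
  define u where "u = unit_ball_vol (real DIM('a))"
  have u: "0 < u" by (simp add: u_def)
  have S: "S \<subseteq> (\<Union>i\<in>K. ball (fst i) (snd i))"
    by (auto simp: S_def K_def less_maxop_iff)
  \<comment> \<open>The covering lemma needs bounded radii. An average above t forces t |B| \<le> I,
    which bounds r^n, and r \<le> r^n once r is at least 1.\<close>
  have bd: "0 < snd i \<and> snd i \<le> max 1 (I / (t * u))" if "i \<in> K" for i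
  proof -
    obtain a r where i: "i = (a, r)" and r: "0 < r" "ennreal t < avg G a r"
      using \<open>i \<in> K\<close> by (cases i) (auto simp: K_def)
    have "ennreal t * emeasure lebesgue (ball a r) \<le> (\<integral>\<^sup>+x\<in>ball a r. G x \<partial>lebesgue)"
      using r by (simp add: less_avg_iff)
    also have "\<dots> \<le> (\<integral>\<^sup>+x. G x \<partial>lebesgue)"
      by (intro nn_integral_mono) (auto split: split_indicator)
    finally have "ennreal (t * (u * r ^ DIM('a))) \<le> ennreal I"
      using r t u I by (simp add: emeasure_lebesgue_ball u_def[symmetric] ennreal_mult[symmetric]
         )
    then have "r ^ DIM('a) \<le> I / (t * u)"
      using I t u by (simp add: field_simps)
    moreover have "r \<le> r ^ DIM('a)" if "1 \<le> r"
      using that by (intro self_le_power) auto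
    ultimately show ?thesis using r i by (cases "1 \<le> r") auto
  qed
  obtain C where C: "countable C" "C \<subseteq> K"
    "pairwise (\<lambda>i j. disjnt (ball (fst i) (snd i)) (ball (fst j) (snd j))) C"
    "S \<subseteq> (\<Union>i\<in>C. ball (fst i) (5 * snd i))"
    by (rule Vitali_covering_lemma_balls[OF S bd])
  \<comment> \<open>The sum over C is written as an integral over the counting measure, so that it
    can be exchanged with the Lebesgue integral.\<close>
  have "ennreal t * emeasure lebesgue S
      \<le> ennreal t * (\<integral>\<^sup>+x. (\<integral>\<^sup>+i. indicator (ball (fst i) (5 * snd i)) x \<partial>count_space C) \<partial>lebesgue)"
  proof (intro mult_left_mono)
    have "S \<in> sets lebesgue"
      unfolding S_def using measurable_sets[OF maxop_measurable[of "\<lambda>_. 1" G], of "{ennreal t<..}"]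
      by (simp add: vimage_def)
    have "indicator S x \<le> (\<integral>\<^sup>+i. indicator (ball (fst i) (5 * snd i)) x \<partial>count_space C)" for x
    proof (cases "x \<in> S")
      case True
      then obtain j where j: "j \<in> C" "x \<in> ball (fst j) (5 * snd j)" using C(4) by blast
      have "1 = (\<integral>\<^sup>+i. indicator {j} i \<partial>count_space C)"
        using j by (simp add: nn_integral_indicator one_ereal_def)
      also have "\<dots> \<le> (\<integral>\<^sup>+i. indicator (ball (fst i) (5 * snd i)) x \<partial>count_space C)"
        using j by (intro nn_integral_mono) (auto split: split_indicator)
      finally show ?thesis using True by simp
    qed simp
    then have "(\<integral>\<^sup>+x. indicator S x \<partial>lebesgue)
        \<le> (\<integral>\<^sup>+x. (\<integral>\<^sup>+i. indicator (ball (fst i) (5 * snd i)) x \<partial>count_space C) \<partial>lebesgue)"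
      by (intro nn_integral_mono)
    then show "emeasure lebesgue S
        \<le> (\<integral>\<^sup>+x. (\<integral>\<^sup>+i. indicator (ball (fst i) (5 * snd i)) x \<partial>count_space C) \<partial>lebesgue)"
      using \<open>S \<in> sets lebesgue\<close> by (simp)
  qed simp
  also have "\<dots> = ennreal t * (\<integral>\<^sup>+i. emeasure lebesgue (ball (fst i) (5 * snd i)) \<partial>count_space C)"
    by (subst nn_integral_count_space_nn_integral[OF C(1)]) auto
  also have "\<dots> = (\<integral>\<^sup>+i. ennreal t * emeasure lebesgue (ball (fst i) (5 * snd i)) \<partial>count_space C)"
    by (simp add: nn_integral_cmult)
  also have "\<dots> \<le> (\<integral>\<^sup>+i. ennreal (5 ^ DIM('a)) * (\<integral>\<^sup>+x\<in>ball (fst i) (snd i). G x \<partial>lebesgue) \<partial>count_space C)"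
  proof (intro nn_integral_mono)
    fix i assume "i \<in> space (count_space C)"
    then have i: "0 < snd i" "ennreal t < avg G (fst i) (snd i)"
      using C(2) by (auto simp: K_def)
    have "ennreal t * emeasure lebesgue (ball (fst i) (5 * snd i))
        = ennreal (5 ^ DIM('a)) * (ennreal t * emeasure lebesgue (ball (fst i) (snd i)))"
      using emeasure_ball_scale[of 5 "snd i" "fst i" "fst i"] i by (simp only: mult_ac)
    also have "\<dots> \<le> ennreal (5 ^ DIM('a)) * (\<integral>\<^sup>+x\<in>ball (fst i) (snd i). G x \<partial>lebesgue)"
      using i by (intro mult_left_mono) (auto simp: less_avg_iff)
    finally show "ennreal t * emeasure lebesgue (ball (fst i) (5 * snd i)) \<le> \<dots>" .
  qed
  also have "\<dots> = ennreal (5 ^ DIM('a)) * (\<integral>\<^sup>+i. (\<integral>\<^sup>+x\<in>ball (fst i) (snd i). G x \<partial>lebesgue) \<partial>count_space C)"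
    by (simp add: nn_integral_cmult)
  \<comment> \<open>Read as measures with density G, the integrals over the disjoint balls add up to
    the measure of their union.\<close>
  also have "(\<integral>\<^sup>+i. (\<integral>\<^sup>+x\<in>ball (fst i) (snd i). G x \<partial>lebesgue) \<partial>count_space C)
      = (\<integral>\<^sup>+i. emeasure (density lebesgue G) (ball (fst i) (snd i)) \<partial>count_space C)"
    by (intro nn_integral_cong) (simp add: emeasure_density)
  also have "\<dots> = emeasure (density lebesgue G) (\<Union>i\<in>C. ball (fst i) (snd i))"
    using C by (intro emeasure_UN_countable[symmetric])
      (auto simp: disjoint_family_on_def pairwise_def disjnt_def)
  also have "\<dots> \<le> emeasure (density lebesgue G) UNIV"
    by (intro emeasure_mono) auto
  also have "\<dots> = (\<integral>\<^sup>+x. G x \<partial>lebesgue)"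
    by (simp add: emeasure_density)
  finally show ?thesis by (simp add: S_def mult_left_mono)
qed

section \<open>Truncation\<close>

definition tail :: "ennreal \<Rightarrow> ('a \<Rightarrow> ennreal) \<Rightarrow> 'a \<Rightarrow> ennreal" where
  "tail t G y = (if t < G y then G y else 0)"

lemma tail_measurable [measurable]:
  "G \<in> borel_measurable M \<Longrightarrow> tail t G \<in> borel_measurable M"
proof -
  assume [measurable]: "G \<in> borel_measurable M"
  have "(\<lambda>y. if t < G y then G y else 0) \<in> borel_measurable M" by measurable
  then show ?thesis by (simp add: tail_def[abs_def])
qed

lemma avg_le_tail:
  assumes [measurable]: "G \<in> borel_measurable lebesgue" and r: "0 < r"
  shows "avg G a r \<le> t + avg (tail t G) a r"
proof -
  have "(\<integral>\<^sup>+y\<in>ball a r. G y \<partial>lebesgue)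
      \<le> (\<integral>\<^sup>+y. t * indicator (ball a r) y + tail t G y * indicator (ball a r) y \<partial>lebesgue)"
    by (intro nn_integral_mono) (auto simp: tail_def split: split_indicator)
  also have "\<dots> = t * emeasure lebesgue (ball a r) + (\<integral>\<^sup>+y\<in>ball a r. tail t G y \<partial>lebesgue)"
    by (subst nn_integral_add) (simp_all add: nn_integral_cmult_indicator)
  also have "\<dots> \<le> t * emeasure lebesgue (ball a r)
      + avg (tail t G) a r * emeasure lebesgue (ball a r)"
    using avg_le_iff[OF r, of "tail t G" a "avg (tail t G) a r"] by (intro add_left_mono) simp
  finally show ?thesis
    by (simp add: avg_le_iff[OF r] distrib_right)
qed

text \<open>Only the part of \<^term>\<open>G\<close> above height \<^term>\<open>t\<close> can push an average above \<^term>\<open>2 * t\<close>.\<close>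

lemma maxop_weak_type_tail:
  fixes G :: "'a::euclidean_space \<Rightarrow> ennreal"
  assumes [measurable]: "G \<in> borel_measurable lebesgue" and t: "0 < t"
  shows "ennreal t * emeasure lebesgue {x. ennreal (2 * t) < maxop (\<lambda>_. 1) G x}
    \<le> ennreal (5 ^ DIM('a)) * (\<integral>\<^sup>+x. tail (ennreal t) G x \<partial>lebesgue)"
proof -
  let ?T = "tail (ennreal t) G"
  have "{x. ennreal (2 * t) < maxop (\<lambda>_. 1) G x} \<subseteq> {x. ennreal t < maxop (\<lambda>_. 1) ?T x}"
  proof safe
    fix x assume "ennreal (2 * t) < maxop (\<lambda>_. 1) G x"
    then obtain a r where ar: "0 < r" "x \<in> ball a r" "ennreal (2 * t) < avg G a r"
      by (auto simp: less_maxop_iff)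
    have "ennreal t + ennreal t < ennreal t + avg ?T a r"
      using ar avg_le_tail[of G r a "ennreal t"] t
      by (simp add: ennreal_plus[symmetric] del: ennreal_plus)
    then have "ennreal t < avg ?T a r" by (metis add_left_mono leD leI)
    with ar show "ennreal t < maxop (\<lambda>_. 1) ?T x"
      using maxop_upper[of r x a "\<lambda>_. 1" ?T] by (simp add: less_le_trans)
  qed
  then have "emeasure lebesgue {x. ennreal (2 * t) < maxop (\<lambda>_. 1) G x}
      \<le> emeasure lebesgue {x. ennreal t < maxop (\<lambda>_. 1) ?T x}"
    using measurable_sets[OF maxop_measurable[of "\<lambda>_. 1" ?T], of "{ennreal t<..}"]
    by (intro emeasure_mono) (auto simp: vimage_def)
  then have "ennreal t * emeasure lebesgue {x. ennreal (2 * t) < maxop (\<lambda>_. 1) G x}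
      \<le> ennreal t * emeasure lebesgue {x. ennreal t < maxop (\<lambda>_. 1) ?T x}"
    by (rule mult_left_mono) simp
  also have "\<dots> \<le> ennreal (5 ^ DIM('a)) * (\<integral>\<^sup>+x. ?T x \<partial>lebesgue)"
    using t by (intro maxop_weak_type) auto
  finally show ?thesis .
qed

text \<open>This says that \<Phi>(t)/t is almost increasing: where g = G(y) > t, superhomogeneity
  with factor g/t at the point t gives (g/t) \<Phi>(t) \<le> \<Phi>(K g).\<close>

lemma superhomogeneous_tail:
  assumes "\<Phi> \<in> Phi_bar" "superhomogeneous K \<Phi>" "0 < t"
  shows "\<Phi> (ennreal t) * tail (ennreal t) G y \<le> ennreal t * \<Phi> (ennreal K * G y)"
proof (cases "ennreal t < G y")
  case True
  have K: "1 \<le> K" using assms by (simp add: superhomogeneous_def)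
  show ?thesis
  proof (cases "G y = \<infinity>")
    case True
    then show ?thesis using K \<open>0 < t\<close> Phi_bar_top[OF assms(1)] by (simp add: ennreal_mult_top)
  next
    case False
    then obtain g where g: "G y = ennreal g" "0 \<le> g" by (cases "G y") auto
    with True \<open>0 < t\<close> have "t < g" by (auto simp: ennreal_less_iff)
    then have "ennreal (g / t) * \<Phi> (ennreal t) \<le> \<Phi> (ennreal (K * (g / t)) * ennreal t)"
      using \<open>0 < t\<close> by (intro superhomogeneousD[OF assms(2)]) simp
    also have "ennreal (K * (g / t)) * ennreal t = ennreal K * G y"
      using \<open>0 < t\<close> K g by (simp add: ennreal_mult[symmetric])
    finally have "ennreal t * (ennreal (g / t) * \<Phi> (ennreal t)) \<le> ennreal t * \<Phi> (ennreal K * G y)"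
      by (rule mult_left_mono) simp
    moreover have "ennreal t * ennreal (g / t) = G y"
      using \<open>0 < t\<close> g by (simp add: ennreal_mult[symmetric])
    ultimately show ?thesis using True by (simp add: tail_def mult.assoc[symmetric] mult.commute)
  qed
qed (simp add: tail_def)

section \<open>Geometric levels and tails under the nabla-2 condition\<close>

definition nabla2 :: "real \<Rightarrow> (ennreal \<Rightarrow> ennreal) \<Rightarrow> bool" where
  "nabla2 k \<Phi> \<longleftrightarrow> 1 < k \<and> (\<forall>t>0. \<Phi> t \<le> ennreal (1 / (2 * k)) * \<Phi> (ennreal k * t))"

text \<open>After j steps \<Phi> has gained a factor (2k)^j while its argument has gained only k^j.
  The surplus 2^j is what makes the level sums converge.\<close>

lemma nabla2_iterate:
  assumes N: "nabla2 k \<Phi>" and "0 < t"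
  shows "\<Phi> t \<le> ennreal ((1 / (2 * k)) ^ j) * \<Phi> (ennreal (k ^ j) * t)"
proof (induction j)
  case (Suc j)
  have k: "1 < k" using N by (simp add: nabla2_def)
  have "\<Phi> (ennreal (k ^ j) * t)
      \<le> ennreal (1 / (2 * k)) * \<Phi> (ennreal k * (ennreal (k ^ j) * t))"
    using N k \<open>0 < t\<close> by (auto simp: nabla2_def ennreal_zero_less_mult_iff)
  also have "ennreal k * (ennreal (k ^ j) * t) = ennreal (k ^ Suc j) * t"
    using k by (simp add: ennreal_mult mult_ac)
  finally have "ennreal ((1 / (2 * k)) ^ j) * \<Phi> (ennreal (k ^ j) * t)
      \<le> ennreal ((1 / (2 * k)) ^ j) * (ennreal (1 / (2 * k)) * \<Phi> (ennreal (k ^ Suc j) * t))"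
    by (rule mult_left_mono) simp
  also have "\<dots> = ennreal ((1 / (2 * k)) ^ Suc j) * \<Phi> (ennreal (k ^ Suc j) * t)"
    using k by (simp add: ennreal_mult[symmetric] mult.assoc[symmetric] mult.commute[of "1 / (2 * k)"] del: ennreal_mult)
  finally show ?case using Suc by (meson order_trans)
qed simp

text \<open>With m the least index for which t k^(m+1) reaches w, minimality puts t k^m below w, or
  m = 0 and t < g is used. The detour through w < g allows g to be infinite, where no level reaches
  g.\<close>

lemma ex_geometric_level:
  assumes k: "1 < (k::real)" and t: "0 < t" "ennreal t < g" and w: "w < g"
  obtains m where "w \<le> ennreal (t * k ^ Suc m)" "ennreal (t * k ^ m) < g"
proof -
  obtain x where x: "w = ennreal x" "0 \<le> x" using w by (cases w) auto
  obtain n where "x / t < k ^ n" using real_arch_pow[OF k] by blast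
  also have "k ^ n \<le> k ^ Suc n" using k by simp
  finally have ex: "x \<le> t * k ^ Suc n" using t by (simp add: field_simps)
  define m where "m = (LEAST m. x \<le> t * k ^ Suc m)"
  have m: "x \<le> t * k ^ Suc m" unfolding m_def using ex by (rule LeastI)
  have "ennreal (t * k ^ m) < g"
  proof (cases m)
    case (Suc i)
    have "\<not> x \<le> t * k ^ Suc i"
      using not_less_Least[of i "\<lambda>m. x \<le> t * k ^ Suc m"] Suc by (simp add: m_def)
    then have "ennreal (t * k ^ m) \<le> ennreal x" using Suc by (intro ennreal_leI) simp
    also have "\<dots> < g" using w x by simp
    finally show ?thesis .
  qed (use t in simp)
  then show ?thesis using m x by (intro that[of m]) (simp_all only: ennreal_leI)
qed

text \<open>For each z below G(y) a single term of the sum already dominates z: the one whose level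
  G(y) has passed and whose successor is at least z.\<close>

lemma tail_le_geometric_levels:
  assumes k: "1 < (k::real)" and t: "0 < t"
  shows "tail (ennreal t) G y
    \<le> (\<Sum>j. ennreal (t * k ^ Suc j) * indicator {y. ennreal (t * k ^ j) < G y} y)"
    (is "_ \<le> suminf ?f")
proof (cases "ennreal t < G y")
  case True
  have "z \<le> suminf ?f" if z: "z < G y" for z
  proof -
    obtain m where m: "z \<le> ennreal (t * k ^ Suc m)" "ennreal (t * k ^ m) < G y"
      by (rule ex_geometric_level[OF k t True z])
    then have "z \<le> ?f m" by simp
    also have "\<dots> \<le> suminf ?f"
      using sum_le_suminf[of ?f "{m}"] by (simp del: sum_mult_indicator sum_indicator_mult power_Suc)
    finally show ?thesis .
  qed
  then have "G y \<le> suminf ?f" by (rule dense_le)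
  then show ?thesis by (simp add: tail_def)
qed (simp add: tail_def)

text \<open>A discrete layer-cake estimate. The set where G exceeds t k^j has its measure controlled
  by the weak bound at that height, and iterating the nabla-2 condition transfers this control to
  \<Phi>(t) with a summable factor.\<close>

lemma nabla2_tail:
  assumes N: "nabla2 k \<Phi>"
    and [measurable]: "G \<in> borel_measurable lebesgue" "B \<in> sets lebesgue"
    and weak: "\<And>s. 0 < s \<Longrightarrow> \<Phi> (ennreal s) * emeasure lebesgue {y \<in> B. ennreal s < G y} \<le> D"
    and t: "0 < t"
  shows "\<Phi> (ennreal t) * (\<integral>\<^sup>+y\<in>B. tail (ennreal t) G y \<partial>lebesgue) \<le> ennreal t * (ennreal (2 * k) * D)"
proof -
  have k: "1 < k" using N by (simp add: nabla2_def)
  let ?E = "\<lambda>j. {y \<in> B. ennreal (t * k ^ j) < G y}"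
  have "(\<integral>\<^sup>+y\<in>B. tail (ennreal t) G y \<partial>lebesgue)
      \<le> (\<integral>\<^sup>+y. (\<Sum>j. ennreal (t * k ^ Suc j) * indicator (?E j) y) \<partial>lebesgue)"
  proof (intro nn_integral_mono)
    fix y
    show "tail (ennreal t) G y * indicator B y \<le> (\<Sum>j. ennreal (t * k ^ Suc j) * indicator (?E j) y)"
      using tail_le_geometric_levels[OF k t, of G y]
      by (cases "y \<in> B") (simp_all add: indicator_def)
  qed
  also have "\<dots> = (\<Sum>j. ennreal (t * k ^ Suc j) * emeasure lebesgue (?E j))"
    by (subst nn_integral_suminf) (simp_all add: nn_integral_cmult_indicator)
  finally have "\<Phi> (ennreal t) * (\<integral>\<^sup>+y\<in>B. tail (ennreal t) G y \<partial>lebesgue)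
      \<le> \<Phi> (ennreal t) * (\<Sum>j. ennreal (t * k ^ Suc j) * emeasure lebesgue (?E j))"
    by (rule mult_left_mono) simp
  also have "\<dots> = (\<Sum>j. \<Phi> (ennreal t) * (ennreal (t * k ^ Suc j) * emeasure lebesgue (?E j)))"
    by simp
  also have "\<dots> \<le> (\<Sum>j. ennreal (k * t) * D * ennreal ((1/2) ^ j))"
  proof (intro suminf_le summableI)
    fix j
    have "\<Phi> (ennreal t) * (ennreal (t * k ^ Suc j) * emeasure lebesgue (?E j))
        \<le> (ennreal ((1 / (2 * k)) ^ j) * \<Phi> (ennreal (k ^ j) * ennreal t))
          * (ennreal (t * k ^ Suc j) * emeasure lebesgue (?E j))"
      using t by (intro mult_right_mono nabla2_iterate N) auto
    also have "\<dots> = ennreal ((1 / (2 * k)) ^ j) * ennreal (t * k ^ Suc j)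
        * (\<Phi> (ennreal (t * k ^ j)) * emeasure lebesgue (?E j))"
      using k t ennreal_mult[of t "k ^ j"] by (simp only: mult_ac) simp
    also have "\<dots> \<le> ennreal ((1 / (2 * k)) ^ j) * ennreal (t * k ^ Suc j) * D"
      using k t by (intro mult_left_mono weak) auto
    \<comment> \<open>The level contributes k^(j+1) and the iteration (2k)^(-j). What remains is k
      2^(-j), whose sum is 2k.\<close>
    also have "ennreal ((1 / (2 * k)) ^ j) * ennreal (t * k ^ Suc j) = ennreal (k * t * (1/2) ^ j)"
      using k t by (simp add: ennreal_mult[symmetric] power_divide power_mult_distrib)
    also have "\<dots> * D = ennreal (k * t) * D * ennreal ((1/2) ^ j)"
      using k t by (subst ennreal_mult) (auto simp: mult_ac)
    finally show "\<Phi> (ennreal t) * (ennreal (t * k ^ Suc j) * emeasure lebesgue (?E j)) \<le> \<dots>" .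
  qed
  also have "\<dots> = ennreal (k * t) * D * (\<Sum>j. ennreal ((1/2) ^ j))"
    by simp
  also have "(\<Sum>j. ennreal ((1/2) ^ j)) = ennreal 2"
    by (subst suminf_ennreal2) (auto simp: suminf_geometric)
  also have "ennreal (k * t) * D * ennreal 2 = ennreal t * (ennreal (2 * k) * D)"
    using k t by (simp add: ennreal_mult mult_ac)
  finally show ?thesis .
qed

text \<open>The modular form of a norm at most 1, with the division by \<phi>(r)|B| cleared. It is
  tied to the norm in two directions: a norm below l puts f/l here, and f/l here gives norm at most
  l.\<close>

definition in_unit_ball ::
  "(ennreal \<Rightarrow> ennreal) \<Rightarrow> (real \<Rightarrow> real) \<Rightarrow> ('a::euclidean_space \<Rightarrow> ennreal) \<Rightarrow> bool" where
  "in_unit_ball \<Phi> \<phi> G \<longleftrightarrow> (\<forall>a r. 0 < r \<longrightarrow>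
    (\<integral>\<^sup>+y\<in>ball a r. \<Phi> (G y) \<partial>lebesgue) \<le> ennreal (\<phi> r) * emeasure lebesgue (ball a r))"

definition in_weak_unit_ball ::
  "(ennreal \<Rightarrow> ennreal) \<Rightarrow> (real \<Rightarrow> real) \<Rightarrow> ('a::euclidean_space \<Rightarrow> ennreal) \<Rightarrow> bool" where
  "in_weak_unit_ball \<Phi> \<phi> G \<longleftrightarrow> (\<forall>a r t. 0 < r \<longrightarrow> 0 < t \<longrightarrow>
    \<Phi> (ennreal t) * emeasure lebesgue {y \<in> ball a r. ennreal t < G y}
      \<le> ennreal (\<phi> r) * emeasure lebesgue (ball a r))"

text \<open>The common consequence of membership in the strong space, and, under the
  \<open>\<nabla>\<^sub>2\<close>-condition, in the weak space.\<close>

definition tail_bound ::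
  "(ennreal \<Rightarrow> ennreal) \<Rightarrow> (real \<Rightarrow> real) \<Rightarrow> real \<Rightarrow> ('a::euclidean_space \<Rightarrow> ennreal) \<Rightarrow> bool" where
  "tail_bound \<Phi> \<phi> D G \<longleftrightarrow> (\<forall>a r t. 0 < r \<longrightarrow> 0 < t \<longrightarrow>
     \<Phi> (ennreal t) * (\<integral>\<^sup>+y\<in>ball a r. tail (ennreal t) G y \<partial>lebesgue)
       \<le> ennreal t * (ennreal (D * \<phi> r) * emeasure lebesgue (ball a r)))"

text \<open>Integrating \<open>superhomogeneous_tail\<close> produces \<Phi>(K G) on the right.
  Dividing G by K beforehand turns this into the modular of G itself.\<close>

lemma tail_bound_strong:
  fixes G :: "'a::euclidean_space \<Rightarrow> ennreal"
  assumes "\<Phi> \<in> Phi_bar" "superhomogeneous K \<Phi>" and [measurable]: "G \<in> borel_measurable lebesgue"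
    and strong: "in_unit_ball \<Phi> \<phi> G"
  shows "tail_bound \<Phi> \<phi> 1 (\<lambda>y. G y / ennreal K)"
  unfolding tail_bound_def
proof (intro allI impI)
  fix a :: 'a and r t :: real assume r: "0 < r" and t: "0 < t"
  have K: "1 \<le> K" using assms(2) by (simp add: superhomogeneous_def)
  have [measurable]: "\<Phi> \<in> borel_measurable borel"
    using Phi_bar_mono[OF assms(1)] by (rule borel_measurable_mono_ennreal)
  have KG: "ennreal K * (G y / ennreal K) = G y" for y
    using K by (simp add: ennreal_times_divide mult.commute[of "ennreal K"] ennreal_mult_divide_eq)
  have "\<Phi> (ennreal t) * (\<integral>\<^sup>+y\<in>ball a r. tail (ennreal t) (\<lambda>y. G y / ennreal K) y \<partial>lebesgue)
      = (\<integral>\<^sup>+y. \<Phi> (ennreal t) * (tail (ennreal t) (\<lambda>y. G y / ennreal K) y * indicator (ball a r) y) \<partial>lebesgue)"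
    by (subst nn_integral_cmult) auto
  also have "\<dots> \<le> (\<integral>\<^sup>+y. ennreal t * (\<Phi> (G y) * indicator (ball a r) y) \<partial>lebesgue)"
    using superhomogeneous_tail[OF assms(1,2) t, of "\<lambda>y. G y / ennreal K"]
    by (intro nn_integral_mono) (auto simp: KG split: split_indicator)
  also have "\<dots> = ennreal t * (\<integral>\<^sup>+y\<in>ball a r. \<Phi> (G y) \<partial>lebesgue)"
    by (subst nn_integral_cmult) auto
  also have "\<dots> \<le> ennreal t * (ennreal (1 * \<phi> r) * emeasure lebesgue (ball a r))"
    using strong r by (intro mult_left_mono) (simp_all add: in_unit_ball_def)
  finally show "\<Phi> (ennreal t) * (\<integral>\<^sup>+y\<in>ball a r. tail (ennreal t) (\<lambda>y. G y / ennreal K) y \<partial>lebesgue) \<le> \<dots>" .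
qed

lemma tail_bound_weak:
  fixes G :: "'a::euclidean_space \<Rightarrow> ennreal"
  assumes N: "nabla2 k \<Phi>"
    and [measurable]: "G \<in> borel_measurable lebesgue"
    and weak: "in_weak_unit_ball \<Phi> \<phi> G"
    and pos: "\<And>r. 0 < r \<Longrightarrow> 0 < \<phi> r"
  shows "tail_bound \<Phi> \<phi> (2 * k) G"
  unfolding tail_bound_def
proof (intro allI impI)
  fix a :: 'a and r t :: real assume r: "0 < r" and t: "0 < t"
  have *: "ennreal (2 * k * \<phi> r) * emeasure lebesgue (ball a r)
      = ennreal (2 * k) * (ennreal (\<phi> r) * emeasure lebesgue (ball a r))"
    using N pos[OF r] by (simp add: nabla2_def ennreal_mult mult.assoc)
  show "\<Phi> (ennreal t) * (\<integral>\<^sup>+y\<in>ball a r. tail (ennreal t) G y \<partial>lebesgue)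
       \<le> ennreal t * (ennreal (2 * k * \<phi> r) * emeasure lebesgue (ball a r))"
    unfolding * using weak r
    by (intro nabla2_tail[OF N] assms(2) ball_sets_lebesgue t) (simp add: in_weak_unit_ball_def)
qed

text \<open>The function is truncated at height 2g with g = \<Phi>^-1(\<phi>(r)). The part below
  contributes at most 2g to the average, and the tail bound limits the part above to 2gD.\<close>

lemma tail_bound_avg:
  assumes P: "\<Phi> \<in> Phi_bar" and [measurable]: "G \<in> borel_measurable lebesgue"
    and T: "tail_bound \<Phi> \<phi> D G" and D: "0 \<le> D" and \<phi>: "0 < \<phi> r" and r: "0 < r"
  shows "avg G a r \<le> ennreal (2 * (1 + D)) * gen_inv \<Phi> (ennreal (\<phi> r))"
proof -
  have "0 < gen_inv \<Phi> (ennreal (\<phi> r))" "gen_inv \<Phi> (ennreal (\<phi> r)) < \<infinity>"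
    using \<phi> by (auto intro!: gen_inv_pos gen_inv_finite[OF P, simplified] P)
  then obtain g where g: "gen_inv \<Phi> (ennreal (\<phi> r)) = ennreal g" "0 < g"
    by (cases "gen_inv \<Phi> (ennreal (\<phi> r))") auto
  let ?v = "emeasure lebesgue (ball a r)" and ?I = "\<integral>\<^sup>+y\<in>ball a r. tail (ennreal (2 * g)) G y \<partial>lebesgue"
  \<comment> \<open>The height must lie strictly above the inverse for \<Phi> to exceed \<phi>(r);
    at g itself only the opposite inequality \<Phi>(g) \<le> \<phi>(r) is available.\<close>
  have "ennreal (\<phi> r) < \<Phi> (ennreal (2 * g))"
    using g by (intro gen_inv_less_imp[OF Phi_bar_mono[OF P]]) (auto intro: ennreal_lessI)
  then have "ennreal (\<phi> r) * ?I \<le> \<Phi> (ennreal (2 * g)) * ?I" by (intro mult_right_mono) auto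
  also have "\<dots> \<le> ennreal (2 * g) * (ennreal (D * \<phi> r) * ?v)"
    using T g r by (simp add: tail_bound_def)
  also have "\<dots> = ennreal (\<phi> r) * (ennreal (2 * g * D) * ?v)"
    using g D \<phi> by (simp add: ennreal_mult mult_ac)
  finally have "?I \<le> ennreal (2 * g * D) * ?v"
    using \<phi> by (simp add: ennreal_mult_le_mult_iff)
  then have "avg (tail (ennreal (2 * g)) G) a r \<le> ennreal (2 * g * D)" using r by (simp add: avg_le_iff)
  then have "avg G a r \<le> ennreal (2 * g) + ennreal (2 * g * D)"
    using avg_le_tail[of G r a "ennreal (2 * g)"] r by (meson add_left_mono assms(2) order_trans)
  also have "\<dots> = ennreal (2 * (1 + D)) * ennreal g"
    using g D by (simp add: ennreal_mult[symmetric] ennreal_plus[symmetric] algebra_simps del: ennreal_plus)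
  finally show ?thesis by (simp add: g)
qed

section \<open>The pointwise inequality\<close>

lemma G_decE:
  assumes "\<phi> \<in> G_dec n"
  obtains C where "1 \<le> C" "\<And>r. 0 < r \<Longrightarrow> 0 < \<phi> r"
    "\<And>r s. 0 < r \<Longrightarrow> r \<le> s \<Longrightarrow> \<phi> s \<le> C * \<phi> r"
    "\<And>r s. 0 < r \<Longrightarrow> r \<le> s \<Longrightarrow> \<phi> r * r ^ n \<le> C * (\<phi> s * s ^ n)"
proof -
  obtain C where C: "0 < C" and pos: "\<And>r. 0 < r \<Longrightarrow> 0 < \<phi> r"
    and le: "\<And>r s. 0 < r \<Longrightarrow> r < s \<Longrightarrow> \<phi> s \<le> C * \<phi> r \<and> \<phi> r * r ^ n \<le> C * (\<phi> s * s ^ n)"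
    using assms by (auto simp: G_dec_def)
  have max: "C * x \<le> max 1 C * x" "x \<le> max 1 C * x" if "0 \<le> x" for x
    using that mult_right_mono[of 1 "max 1 C" x] by (auto intro: mult_right_mono)
  show ?thesis
  proof (rule that[of "max 1 C"])
    fix r s :: real assume rs: "0 < r" "r \<le> s"
    have "0 \<le> \<phi> r" "0 \<le> \<phi> s * s ^ n" using rs pos[of r] pos[of s] by auto
    moreover have "r = s \<or> (\<phi> s \<le> C * \<phi> r \<and> \<phi> r * r ^ n \<le> C * (\<phi> s * s ^ n))"
      using le[of r s] rs by (auto simp: less_le)
    ultimately show "\<phi> s \<le> max 1 C * \<phi> r" "\<phi> r * r ^ n \<le> max 1 C * (\<phi> s * s ^ n)"
      using max by (blast intro: order_trans)+
  qed (use pos in auto)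
qed

text \<open>A substitute for the intermediate value theorem. The radii s \<ge> r with \<phi>(s)
  \<ge> v are bounded because \<phi> tends to 0. One of them exceeds half their supremum, so its
  double is no longer among them, and the growth of \<phi>(s) s^n between s and 2s bounds \<phi>(s)
  by C 2^n \<phi>(2s) < C 2^n v.\<close>

lemma G_dec_comparable_value:
  fixes \<phi> :: "real \<Rightarrow> real"
  assumes C: "1 \<le> C" "\<And>r s. 0 < r \<Longrightarrow> r \<le> s \<Longrightarrow> \<phi> r * r ^ n \<le> C * (\<phi> s * s ^ n)"
    and lim: "(\<phi> \<longlongrightarrow> 0) at_top" and v: "0 < v" "v \<le> \<phi> r" and r: "0 < r"
  obtains s where "r \<le> s" "v \<le> \<phi> s" "\<phi> s \<le> C * 2 ^ n * v"
proof -
  define S where "S = {s. r \<le> s \<and> v \<le> \<phi> s}"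
  have "\<forall>\<^sub>F s in at_top. \<phi> s < v" using lim v(1) by (rule order_tendstoD(2))
  then obtain N where N: "\<And>s. N \<le> s \<Longrightarrow> \<phi> s < v" by (auto simp: eventually_at_top_linorder)
  have bdd: "bdd_above S" unfolding S_def using N
    by (intro bdd_aboveI[of _ N]) (metis (no_types, lifting) leD le_cases mem_Collect_eq)
  have "r \<in> S" using v by (simp add: S_def)
  then have "r \<le> Sup S" using bdd by (rule cSup_upper)
  then have "Sup S / 2 < Sup S" using r by simp
  then obtain s where s: "s \<in> S" "Sup S / 2 < s" using less_cSupE[of "Sup S / 2" S] \<open>r \<in> S\<close> by blast
  have "2 * s \<notin> S" using s cSup_upper[OF _ bdd, of "2 * s"] by auto
  then have "\<phi> (2 * s) < v" using s r by (auto simp: S_def)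
  have "0 < s" using s r by (simp add: S_def)
  have "\<phi> s * s ^ n \<le> C * (\<phi> (2 * s) * (2 * s) ^ n)" using \<open>0 < s\<close> by (intro C) auto
  then have "\<phi> s * s ^ n \<le> (C * 2 ^ n * \<phi> (2 * s)) * s ^ n" by (simp add: power_mult_distrib mult_ac)
  then have "\<phi> s \<le> C * 2 ^ n * \<phi> (2 * s)" using \<open>0 < s\<close> by simp
  also have "\<dots> \<le> C * 2 ^ n * v" using \<open>\<phi> (2 * s) < v\<close> C(1) by (intro mult_left_mono) auto
  finally show ?thesis using that[of s] s by (simp add: S_def)
qed

text \<open>The supremum over all t \<le> s in the condition allows \<rho>(r) to be tested against
  \<phi> at any larger radius s.\<close>

lemma rho_le:
  fixes \<rho> \<phi> :: "real \<Rightarrow> real"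
  assumes "\<And>r. 0 < r \<Longrightarrow> (SUP t\<in>{0<..r}. ennreal (\<rho> t)) * gen_inv \<Phi> (ennreal (\<phi> r))
      \<le> ennreal A * gen_inv \<Psi> (ennreal (\<phi> r))"
    and "0 < r" "r \<le> s"
  shows "ennreal (\<rho> r) * gen_inv \<Phi> (ennreal (\<phi> s)) \<le> ennreal A * gen_inv \<Psi> (ennreal (\<phi> s))"
proof -
  have "ennreal (\<rho> r) \<le> (SUP t\<in>{0<..s}. ennreal (\<rho> t))" using assms by (intro SUP_upper) auto
  then have "ennreal (\<rho> r) * gen_inv \<Phi> (ennreal (\<phi> s))
      \<le> (SUP t\<in>{0<..s}. ennreal (\<rho> t)) * gen_inv \<Phi> (ennreal (\<phi> s))"
    by (rule mult_right_mono) simp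
  also have "\<dots> \<le> ennreal A * gen_inv \<Psi> (ennreal (\<phi> s))" using assms(2,3) by (intro assms(1)) simp
  finally show ?thesis .
qed

text \<open>The two alternative hypotheses are used nowhere else: both are reduced to this estimate.
  In the first the condition is read at a larger radius where \<phi> is comparable to u; in the
  second the quotient of the inverses at u is compared with the one at \<phi>(r).\<close>

lemma rho_le_below:
  fixes \<rho> \<phi> :: "real \<Rightarrow> real"
  assumes P: "\<Phi> \<in> Phi_bar" and q: "superhomogeneous K \<Psi>" and \<phi>: "\<phi> \<in> G_dec n"
    and alt: "(\<phi> \<longlongrightarrow> 0) at_top \<or> almost_decreasing (\<lambda>t. gen_inv \<Psi> (ennreal t) / gen_inv \<Phi> (ennreal t))"
    and A: "0 < A" "\<And>r. 0 < r \<Longrightarrow> (SUP t\<in>{0<..r}. ennreal (\<rho> t)) * gen_inv \<Phi> (ennreal (\<phi> r))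
      \<le> ennreal A * gen_inv \<Psi> (ennreal (\<phi> r))"
  obtains D where "0 < D"
    "\<And>u r. 0 < r \<Longrightarrow> u < ennreal (\<phi> r) \<Longrightarrow> ennreal (\<rho> r) * gen_inv \<Phi> u \<le> ennreal D * gen_inv \<Psi> u"
proof -
  obtain C where C: "1 \<le> C" "\<And>r. 0 < r \<Longrightarrow> 0 < \<phi> r"
    "\<And>r s. 0 < r \<Longrightarrow> r \<le> s \<Longrightarrow> \<phi> r * r ^ n \<le> C * (\<phi> s * s ^ n)"
    using \<phi> by (elim G_decE) blast
  have "\<exists>D>0. \<forall>v r. 0 < r \<longrightarrow> 0 < v \<longrightarrow> v < \<phi> r \<longrightarrow>
      ennreal (\<rho> r) * gen_inv \<Phi> (ennreal v) \<le> ennreal D * gen_inv \<Psi> (ennreal v)"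
    using alt
  proof
    assume lim: "(\<phi> \<longlongrightarrow> 0) at_top"
    have K: "1 \<le> K" using q by (simp add: superhomogeneous_def)
    have C2: "1 \<le> C * 2 ^ n" using mult_mono[of 1 C 1 "2 ^ n"] C(1) by simp
    \<comment> \<open>A comes from the condition on \<rho>, C 2^n from \<phi>(s) \<le> C 2^n v, and
      K from taking that factor out of \<Psi>^-1.\<close>
    show ?thesis
    proof (intro exI[of _ "A * (K * (C * 2 ^ n))"] conjI allI impI)
      show "0 < A * (K * (C * 2 ^ n))" using A K C2 C(1) by simp
      fix v r :: real assume r: "0 < r" and v: "0 < v" "v < \<phi> r"
      obtain s where s: "r \<le> s" "v \<le> \<phi> s" "\<phi> s \<le> C * 2 ^ n * v"
        by (rule G_dec_comparable_value[of C \<phi> n v r]) (use C lim v r in auto)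
      have "ennreal (\<rho> r) * gen_inv \<Phi> (ennreal v) \<le> ennreal (\<rho> r) * gen_inv \<Phi> (ennreal (\<phi> s))"
        using s by (intro mult_left_mono gen_inv_mono ennreal_leI) auto
      also have "\<dots> \<le> ennreal A * gen_inv \<Psi> (ennreal (\<phi> s))" using A(2) r s(1) by (rule rho_le)
      also have "\<dots> \<le> ennreal A * gen_inv \<Psi> (ennreal (C * 2 ^ n) * ennreal v)"
        using s C(1) v by (intro mult_left_mono gen_inv_mono) (simp_all add: ennreal_mult[symmetric])
      also have "\<dots> \<le> ennreal A * (ennreal (K * (C * 2 ^ n)) * gen_inv \<Psi> (ennreal v))"
        using q C2 by (intro mult_left_mono gen_inv_doubling) auto
      also have "\<dots> = ennreal (A * (K * (C * 2 ^ n))) * gen_inv \<Psi> (ennreal v)"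
        using A C2 K by (simp add: ennreal_mult mult.assoc)
      finally show "ennreal (\<rho> r) * gen_inv \<Phi> (ennreal v) \<le> \<dots>" .
    qed
  next
    assume "almost_decreasing (\<lambda>t. gen_inv \<Psi> (ennreal t) / gen_inv \<Phi> (ennreal t))"
    then obtain D where D: "0 < D" "\<And>r s. 0 < r \<Longrightarrow> r < s \<Longrightarrow>
        gen_inv \<Psi> (ennreal s) / gen_inv \<Phi> (ennreal s) \<le> ennreal D * (gen_inv \<Psi> (ennreal r) / gen_inv \<Phi> (ennreal r))"
      by (auto simp: almost_decreasing_def)
    show ?thesis
    proof (intro exI[of _ "A * D"] conjI allI impI)
      show "0 < A * D" using A D by simp
      fix v r :: real assume r: "0 < r" and v: "0 < v" "v < \<phi> r"
      have fin: "0 < gen_inv \<Phi> (ennreal v)" "gen_inv \<Phi> (ennreal v) < \<infinity>"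
        "0 < gen_inv \<Phi> (ennreal (\<phi> r))" "gen_inv \<Phi> (ennreal (\<phi> r)) < \<infinity>"
        using v gen_inv_finite[OF P] by (auto intro!: gen_inv_pos P)
      have "ennreal (\<rho> r) = ennreal (\<rho> r) * gen_inv \<Phi> (ennreal (\<phi> r)) / gen_inv \<Phi> (ennreal (\<phi> r))"
        using fin by (simp add: ennreal_mult_divide_eq)
      also have "\<dots> \<le> ennreal A * gen_inv \<Psi> (ennreal (\<phi> r)) / gen_inv \<Phi> (ennreal (\<phi> r))"
        using rho_le[OF A(2) r, of r] by (intro divide_right_mono_ennreal) simp
      also have "\<dots> \<le> ennreal A * (ennreal D * (gen_inv \<Psi> (ennreal v) / gen_inv \<Phi> (ennreal v)))"
        using D(2)[of v "\<phi> r"] v unfolding ennreal_times_divide[symmetric] by (intro mult_left_mono) auto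
      finally have "ennreal (\<rho> r) * gen_inv \<Phi> (ennreal v)
          \<le> ennreal A * (ennreal D * (gen_inv \<Psi> (ennreal v) / gen_inv \<Phi> (ennreal v))) * gen_inv \<Phi> (ennreal v)"
        by (rule mult_right_mono) simp
      also have "\<dots> = ennreal (A * D) * (gen_inv \<Psi> (ennreal v) / gen_inv \<Phi> (ennreal v) * gen_inv \<Phi> (ennreal v))"
        using A D by (simp add: ennreal_mult mult_ac)
      also have "\<dots> = ennreal (A * D) * gen_inv \<Psi> (ennreal v)"
        using fin by (simp add: ennreal_divide_times)
      finally show "ennreal (\<rho> r) * gen_inv \<Phi> (ennreal v) \<le> \<dots>" .
    qed
  qed
  then obtain D where D: "0 < D" "\<And>v r. 0 < r \<Longrightarrow> 0 < v \<Longrightarrow> v < \<phi> r \<Longrightarrow>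
      ennreal (\<rho> r) * gen_inv \<Phi> (ennreal v) \<le> ennreal D * gen_inv \<Psi> (ennreal v)"
    by blast
  have *: "ennreal (\<rho> r) * gen_inv \<Phi> u \<le> ennreal D * gen_inv \<Psi> u"
    if r: "0 < r" and u: "u < ennreal (\<phi> r)" "0 < u" for u r
  proof -
    obtain v where "u = ennreal v" using u by (cases u) auto
    then show ?thesis using D(2)[of r v] u r by (simp add: ennreal_less_iff)
  qed
  have "ennreal (\<rho> r) * gen_inv \<Phi> u \<le> ennreal D * gen_inv \<Psi> u"
    if r: "0 < r" and u: "u < ennreal (\<phi> r)" for u r
  proof (cases "u = 0")
    case True
    have "ennreal (\<rho> r) * gen_inv \<Phi> 0 \<le> ennreal D * gen_inv \<Psi> 0"
    proof (rule le_gen_inv_0[OF _ _ D(1)])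
      show "0 < ennreal (\<phi> r)" using C(2)[OF r] by simp
      fix v assume v: "0 < v" "v < ennreal (\<phi> r)"
      have "ennreal (\<rho> r) * gen_inv \<Phi> 0 \<le> ennreal (\<rho> r) * gen_inv \<Phi> v"
        by (intro mult_left_mono gen_inv_mono) auto
      also have "\<dots> \<le> ennreal D * gen_inv \<Psi> v" using r v by (intro *)
      finally show "ennreal (\<rho> r) * gen_inv \<Phi> 0 \<le> ennreal D * gen_inv \<Psi> v" .
    qed
    then show ?thesis using True by simp
  next
    case False
    then show ?thesis using r u by (intro *) (auto simp: zero_less_iff_neq_zero)
  qed
  with D(1) show ?thesis using that by blast
qed

text \<open>The function is normalised only through its averages, so the same inequality serves the
  strong and the weak norm. After the two cases are settled, \<Psi> is applied to M_\<rho> G / C1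
  \<le> \<Psi>^-1(u), using \<Psi>(\<Psi>^-1(u)) \<le> u.\<close>

lemma maxop_pointwise:
  assumes P: "\<Phi> \<in> Phi_bar" "\<Psi> \<in> Phi_bar" and q: "superhomogeneous K \<Psi>" and \<phi>: "\<phi> \<in> G_dec n"
    and alt: "(\<phi> \<longlongrightarrow> 0) at_top \<or> almost_decreasing (\<lambda>t. gen_inv \<Psi> (ennreal t) / gen_inv \<Phi> (ennreal t))"
    and rho: "rho_condition \<rho> \<Phi> \<Psi> \<phi>" and C0: "0 < C0" and Cs: "0 < Cs"
  shows "\<exists>C1>0. \<forall>(G::'a::euclidean_space \<Rightarrow> ennreal) x.
      (\<forall>a r. 0 < r \<longrightarrow> avg G a r \<le> ennreal Cs * gen_inv \<Phi> (ennreal (\<phi> r))) \<longrightarrow>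
      \<Psi> (maxop \<rho> G x / ennreal C1) \<le> \<Phi> (maxop (\<lambda>_. 1) G x / ennreal C0)"
proof -
  obtain A where A: "0 < A" "\<And>r. 0 < r \<Longrightarrow> (SUP t\<in>{0<..r}. ennreal (\<rho> t)) * gen_inv \<Phi> (ennreal (\<phi> r))
      \<le> ennreal A * gen_inv \<Psi> (ennreal (\<phi> r))"
    using rho by (auto simp: rho_condition_def)
  obtain D where D: "0 < D"
    "\<And>u r. 0 < r \<Longrightarrow> u < ennreal (\<phi> r) \<Longrightarrow> ennreal (\<rho> r) * gen_inv \<Phi> u \<le> ennreal D * gen_inv \<Psi> u"
    using rho_le_below[OF P(1) q \<phi> alt A] by blast
  \<comment> \<open>One entry for balls with \<phi>(r) \<le> u, where averages are at most Cs
    \<Phi>^-1(\<phi>(r)), and one for the others, where they are at most C0 \<Phi>^-1(u).\<close>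
  define C1 where "C1 = max (Cs * A) (C0 * D)"
  have C1: "0 < C1" using A D C0 Cs by (simp add: C1_def less_max_iff_disj)
  have main: "\<Psi> (maxop \<rho> G x / ennreal C1) \<le> \<Phi> (maxop (\<lambda>_. 1) G x / ennreal C0)"
    if avg: "\<And>a r. 0 < r \<Longrightarrow> avg G a r \<le> ennreal Cs * gen_inv \<Phi> (ennreal (\<phi> r))"
    for G :: "'a \<Rightarrow> ennreal" and x
  proof -
    define T where "T = maxop (\<lambda>_. 1) G x / ennreal C0"
    have T: "T \<le> gen_inv \<Phi> (\<Phi> T)" by (intro le_gen_inv Phi_bar_mono P) simp
    have "maxop \<rho> G x \<le> ennreal C1 * gen_inv \<Psi> (\<Phi> T)"
    proof (rule maxop_least)
      fix a r assume r: "0 < r" "x \<in> ball a r"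
      show "ennreal (\<rho> r) * avg G a r \<le> ennreal C1 * gen_inv \<Psi> (\<Phi> T)"
      proof (cases "\<Phi> T < ennreal (\<phi> r)")
        case False
        have "ennreal (\<rho> r) * avg G a r \<le> ennreal (\<rho> r) * (ennreal Cs * gen_inv \<Phi> (ennreal (\<phi> r)))"
          using avg[OF r(1)] by (rule mult_left_mono) simp
        also have "\<dots> = ennreal Cs * (ennreal (\<rho> r) * gen_inv \<Phi> (ennreal (\<phi> r)))" by (simp only: mult_ac)
        also have "\<dots> \<le> ennreal Cs * (ennreal A * gen_inv \<Psi> (ennreal (\<phi> r)))"
          using r by (intro mult_left_mono rho_le A) auto
        also have "\<dots> = ennreal (Cs * A) * gen_inv \<Psi> (ennreal (\<phi> r))"
          using A Cs by (simp add: ennreal_mult mult.assoc)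
        also have "\<dots> \<le> ennreal C1 * gen_inv \<Psi> (\<Phi> T)"
          using False by (intro mult_mono gen_inv_mono ennreal_leI) (auto simp: C1_def)
        finally show ?thesis .
      next
        case True
        have "avg G a r \<le> maxop (\<lambda>_. 1) G x" using maxop_upper[OF r, of "\<lambda>_. 1" G] by simp
        also have "\<dots> = ennreal C0 * T"
          unfolding T_def using C0 by (simp add: ennreal_times_divide mult.commute[of "ennreal C0"] ennreal_mult_divide_eq)
        also have "\<dots> \<le> ennreal C0 * gen_inv \<Phi> (\<Phi> T)" using T by (rule mult_left_mono) simp
        finally have "ennreal (\<rho> r) * avg G a r \<le> ennreal (\<rho> r) * (ennreal C0 * gen_inv \<Phi> (\<Phi> T))"
          by (rule mult_left_mono) simp
        also have "\<dots> = ennreal C0 * (ennreal (\<rho> r) * gen_inv \<Phi> (\<Phi> T))" by (simp only: mult_ac)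
        also have "\<dots> \<le> ennreal C0 * (ennreal D * gen_inv \<Psi> (\<Phi> T))"
          using r True by (intro mult_left_mono D) auto
        also have "\<dots> = ennreal (C0 * D) * gen_inv \<Psi> (\<Phi> T)" using C0 D by (simp add: ennreal_mult mult.assoc)
        also have "\<dots> \<le> ennreal C1 * gen_inv \<Psi> (\<Phi> T)"
          by (intro mult_right_mono ennreal_leI) (auto simp: C1_def)
        finally show ?thesis .
      qed
    qed
    then have "maxop \<rho> G x / ennreal C1 \<le> gen_inv \<Psi> (\<Phi> T)"
      using C1 by (simp add: ennreal_divide_le_iff mult.commute)
    then have "\<Psi> (maxop \<rho> G x / ennreal C1) \<le> \<Psi> (gen_inv \<Psi> (\<Phi> T))"
      by (rule monoD[OF Phi_bar_mono[OF P(2)]])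
    also have "\<dots> \<le> \<Phi> T" by (rule Phi_gen_inv_le[OF P(2)])
    finally show ?thesis by (simp add: T_def)
  qed
  show ?thesis using C1 main by (intro exI[of _ C1]) simp
qed

section \<open>Modular inequalities\<close>

text \<open>One radius r leads from a to x, and two radii s \<le> r lead from x to any point of the
  other ball.\<close>

lemma ball_subset_triple:
  assumes "x \<in> ball a r" "x \<in> ball b s" "s \<le> r"
  shows "ball b s \<subseteq> ball (a::'a::metric_space) (3 * r)"
proof
  fix y assume "y \<in> ball b s"
  then have "dist b y < s" by simp
  moreover have "dist a y \<le> dist a x + dist x b + dist b y"
    by (meson add_right_mono dist_triangle order_trans)
  ultimately show "y \<in> ball a (3 * r)" using assms by (simp add: dist_commute)
qed

lemma maxop_split:
  assumes x: "x \<in> ball a r" and L: "\<And>b s. r < s \<Longrightarrow> avg G b s \<le> L"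
  shows "maxop (\<lambda>_. 1) G x
    \<le> max (maxop (\<lambda>_. 1) (\<lambda>y. G y * indicator (ball a (3 * r)) y) x) L"
proof (rule maxop_least)
  fix b s assume s: "0 < s" "x \<in> ball b s"
  show "ennreal 1 * avg G b s \<le> max (maxop (\<lambda>_. 1) (\<lambda>y. G y * indicator (ball a (3 * r)) y) x) L"
  proof (cases "r < s")
    case True
    then show ?thesis using L[of s b] by (simp add: le_max_iff_disj)
  next
    case False
    then have "ball b s \<subseteq> ball a (3 * r)" using x s by (intro ball_subset_triple) auto
    then have "avg G b s \<le> avg (\<lambda>y. G y * indicator (ball a (3 * r)) y) b s"
      by (intro avg_mono) (auto split: split_indicator)
    then show ?thesis
      using maxop_upper[OF s, of "\<lambda>_. 1" "\<lambda>y. G y * indicator (ball a (3 * r)) y"]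
      by (intro max.coboundedI1) simp
  qed
qed

lemma large_ball_avg:
  assumes "superhomogeneous K \<Phi>" "1 \<le> C" "\<phi> s \<le> C * \<phi> r" "0 < \<phi> r"
    and "avg G b s \<le> ennreal Cs * gen_inv \<Phi> (ennreal (\<phi> s))" "0 \<le> Cs"
  shows "avg G b s \<le> ennreal (Cs * (K * C)) * gen_inv \<Phi> (ennreal (\<phi> r))"
proof -
  have K: "1 \<le> K" using assms(1) by (simp add: superhomogeneous_def)
  have "avg G b s \<le> ennreal Cs * gen_inv \<Phi> (ennreal (\<phi> s))" by fact
  also have "\<dots> \<le> ennreal Cs * gen_inv \<Phi> (ennreal C * ennreal (\<phi> r))"
    using assms by (intro mult_left_mono gen_inv_mono) (auto simp: ennreal_mult[symmetric])
  also have "\<dots> \<le> ennreal Cs * (ennreal (K * C) * gen_inv \<Phi> (ennreal (\<phi> r)))"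
    using assms by (intro mult_left_mono gen_inv_doubling) auto
  also have "\<dots> = ennreal (Cs * (K * C)) * gen_inv \<Phi> (ennreal (\<phi> r))"
    using assms K by (simp add: ennreal_mult mult.assoc)
  finally show ?thesis .
qed

lemma triple_ball_weight:
  fixes a :: "'a::euclidean_space"
  assumes "0 < r" "1 \<le> C" "\<And>r s. 0 < r \<Longrightarrow> r \<le> s \<Longrightarrow> \<phi> s \<le> C * \<phi> r" "0 < \<phi> r" "0 \<le> D"
  shows "ennreal (D * \<phi> (3 * r)) * emeasure lebesgue (ball a (3 * r))
    \<le> ennreal (D * (C * 3 ^ DIM('a))) * (ennreal (\<phi> r) * emeasure lebesgue (ball a r))"
proof -
  have "ennreal (D * \<phi> (3 * r)) * emeasure lebesgue (ball a (3 * r))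
      \<le> ennreal (D * (C * \<phi> r)) * (ennreal (3 ^ DIM('a)) * emeasure lebesgue (ball a r))"
    using assms(1,5) assms(3)[of r "3 * r"]
    by (intro mult_mono ennreal_leI mult_left_mono)
      (auto simp: emeasure_ball_scale[of 3 r a a] simp del: mult.commute)
  also have "\<dots> = ennreal (D * (C * 3 ^ DIM('a))) * (ennreal (\<phi> r) * emeasure lebesgue (ball a r))"
    using assms(2,4,5) by (simp add: ennreal_mult mult_ac)
  finally show ?thesis .
qed

text \<open>Restriction to B(a,3r) commutes with truncation, so the truncated weak type inequality
  leaves exactly the integral that \<open>tail_bound\<close> controls on the tripled ball. Both
  sides then carry a factor t, which cancels.\<close>

lemma maxop_local_weak_type:
  fixes G :: "'a::euclidean_space \<Rightarrow> ennreal"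
  assumes G[measurable]: "G \<in> borel_measurable lebesgue" and T: "tail_bound \<Phi> \<phi> D G"
    and C: "1 \<le> C" "\<And>r s. 0 < r \<Longrightarrow> r \<le> s \<Longrightarrow> \<phi> s \<le> C * \<phi> r"
    and D: "0 \<le> D" and r: "0 < r" "0 < \<phi> r" and t: "0 < t"
  shows "\<Phi> (ennreal t) * emeasure lebesgue
      {x. ennreal (2 * t) < maxop (\<lambda>_. 1) (\<lambda>y. G y * indicator (ball a (3 * r)) y) x}
    \<le> ennreal (5 ^ DIM('a) * (D * (C * 3 ^ DIM('a)))) * (ennreal (\<phi> r) * emeasure lebesgue (ball a r))"
proof -
  define H where "H = (\<lambda>y. G y * indicator (ball a (3 * r)) y)"
  have [measurable]: "H \<in> borel_measurable lebesgue" unfolding H_def by measurable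
  let ?E = "{x. ennreal (2 * t) < maxop (\<lambda>_. 1) H x}"
  have "ennreal t * (\<Phi> (ennreal t) * emeasure lebesgue ?E)
      = \<Phi> (ennreal t) * (ennreal t * emeasure lebesgue ?E)" by (simp only: mult_ac)
  also have "\<dots> \<le> \<Phi> (ennreal t) * (ennreal (5 ^ DIM('a)) * (\<integral>\<^sup>+y. tail (ennreal t) H y \<partial>lebesgue))"
    using t by (intro mult_left_mono maxop_weak_type_tail) auto
  also have "(\<integral>\<^sup>+y. tail (ennreal t) H y \<partial>lebesgue)
      = (\<integral>\<^sup>+y\<in>ball a (3 * r). tail (ennreal t) G y \<partial>lebesgue)"
    by (intro nn_integral_cong) (simp add: tail_def H_def split: split_indicator)
  also have "\<Phi> (ennreal t) * (ennreal (5 ^ DIM('a)) * \<dots>) = ennreal (5 ^ DIM('a)) * (\<Phi> (ennreal t) * \<dots>)"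
    by (simp only: mult_ac)
  also have "\<dots> \<le> ennreal (5 ^ DIM('a)) * (ennreal t * (ennreal (D * \<phi> (3 * r)) * emeasure lebesgue (ball a (3 * r))))"
    using T r t by (intro mult_left_mono) (auto simp: tail_bound_def)
  also have "\<dots> \<le> ennreal (5 ^ DIM('a)) * (ennreal t *
      (ennreal (D * (C * 3 ^ DIM('a))) * (ennreal (\<phi> r) * emeasure lebesgue (ball a r))))"
    using C D r by (intro mult_left_mono triple_ball_weight) auto
  also have "\<dots> = ennreal t * (ennreal (5 ^ DIM('a) * (D * (C * 3 ^ DIM('a)))) *
      (ennreal (\<phi> r) * emeasure lebesgue (ball a r)))"
    using C(1) D ennreal_mult[of "5 ^ DIM('a)" "D * (C * 3 ^ DIM('a))"]
    by (simp add: mult_ac)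
  finally show ?thesis
    using t by (simp add: ennreal_mult_le_mult_iff H_def)
qed

text \<open>Levels w < \<phi>(r) are trivial, since the set lies in B(a,r). For w \<ge> \<phi>(r)
  the pointwise inequality forces M G above C0 \<Phi>^-1(w), which is out of reach of the large
  balls, so the local maximal function must be that large.\<close>

lemma maxop_weak_bounded:
  assumes P: "\<Phi> \<in> Phi_bar" "\<Psi> \<in> Phi_bar" and q: "superhomogeneous K \<Phi>" "superhomogeneous K' \<Psi>"
    and \<phi>: "\<phi> \<in> G_dec DIM('a::euclidean_space)"
    and alt: "(\<phi> \<longlongrightarrow> 0) at_top \<or> almost_decreasing (\<lambda>t. gen_inv \<Psi> (ennreal t) / gen_inv \<Phi> (ennreal t))"
    and rho: "rho_condition \<rho> \<Phi> \<Psi> \<phi>" and D: "0 \<le> D"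
  shows "\<exists>C1>0. \<forall>G::'a \<Rightarrow> ennreal. G \<in> borel_measurable lebesgue \<longrightarrow> tail_bound \<Phi> \<phi> D G \<longrightarrow>
      in_weak_unit_ball \<Psi> \<phi> (\<lambda>x. maxop \<rho> G x / ennreal C1)"
proof -
  obtain C where C: "1 \<le> C" "\<And>r. 0 < r \<Longrightarrow> 0 < \<phi> r" "\<And>r s. 0 < r \<Longrightarrow> r \<le> s \<Longrightarrow> \<phi> s \<le> C * \<phi> r"
    using \<phi> by (elim G_decE) blast
  have K: "1 \<le> K" using q by (simp add: superhomogeneous_def)
  define Cs where "Cs = 2 * (1 + D)"
  define K0 where "K0 = Cs * (K * C)"
  define c where "c = max 1 (5 ^ DIM('a) * (D * (C * 3 ^ DIM('a))))"
  \<comment> \<open>With g = \<Phi>^-1(w), the first entry puts the contribution of large balls, at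
    most K0 g, below C0 g. The second makes C0 g at least 2 \<tau> for the height \<tau> chosen
    below.\<close>
  define C0 where "C0 = max K0 (4 * K * c)"
  have c: "1 \<le> c" by (simp add: c_def)
  have Cs: "0 < Cs" using D by (simp add: Cs_def)
  have C0: "0 < C0" using Cs K C(1) by (auto simp: C0_def K0_def less_max_iff_disj intro!: mult_pos_pos)
  obtain C1 where C1: "0 < C1" and pointwise: "\<forall>(G::'a \<Rightarrow> ennreal) x.
      (\<forall>a r. 0 < r \<longrightarrow> avg G a r \<le> ennreal Cs * gen_inv \<Phi> (ennreal (\<phi> r))) \<longrightarrow>
      \<Psi> (maxop \<rho> G x / ennreal C1) \<le> \<Phi> (maxop (\<lambda>_. 1) G x / ennreal C0)"
    using maxop_pointwise[OF P q(2) \<phi> alt rho C0 Cs, where 'a='a] by (elim exE conjE)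
  have main: "\<Psi> (ennreal t) * emeasure lebesgue {x \<in> ball a r. ennreal t < maxop \<rho> G x / ennreal C1}
        \<le> ennreal (\<phi> r) * emeasure lebesgue (ball a r)"
    if G[measurable]: "G \<in> borel_measurable lebesgue" and T: "tail_bound \<Phi> \<phi> D G" and r: "0 < r" and t: "0 < t"
    for G :: "'a \<Rightarrow> ennreal" and a r t
  proof -
    let ?E = "{x \<in> ball a r. ennreal t < maxop \<rho> G x / ennreal C1}"
    let ?M = "maxop (\<lambda>_. 1) (\<lambda>y. G y * indicator (ball a (3 * r)) y)"
    have avg: "avg G b s \<le> ennreal Cs * gen_inv \<Phi> (ennreal (\<phi> s))" if "0 < s" for b s
      unfolding Cs_def using G T D C(2) that by (intro tail_bound_avg P) auto
    have E_ball: "emeasure lebesgue ?E \<le> emeasure lebesgue (ball a r)"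
      by (intro emeasure_mono) auto
    show ?thesis
    proof (rule ennreal_mult_le_dense)
      show "emeasure lebesgue ?E < \<infinity>" using E_ball emeasure_ball_finite[OF r, of a] by (rule le_less_trans)
      fix w assume w: "w < \<Psi> (ennreal t)"
      show "w * emeasure lebesgue ?E \<le> ennreal (\<phi> r) * emeasure lebesgue (ball a r)"
      proof (cases "w < ennreal (\<phi> r)")
        case True
        then show ?thesis using E_ball by (intro mult_mono) auto
      next
        case False
        have "w < \<infinity>" using w by (auto intro: less_le_trans)
        have "0 < w" using False C(2)[OF r] less_le_trans[of 0 "ennreal (\<phi> r)" w] by (simp add: not_less)
        then have "0 < gen_inv \<Phi> w" "gen_inv \<Phi> w < \<infinity>"
          using \<open>w < \<infinity>\<close> P(1) by (auto intro: gen_inv_pos gen_inv_finite[simplified])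
        then obtain g where g: "gen_inv \<Phi> w = ennreal g" "0 < g" by (cases "gen_inv \<Phi> w") auto
        \<comment> \<open>The factor 2 lifts \<Phi> strictly above w, and K c gains the factor c
          needed to cancel the constant of the local weak type inequality.\<close>
        define \<tau> where "\<tau> = 2 * K * c * g"
        have \<tau>: "0 < \<tau>" using K c g by (simp add: \<tau>_def)
        have "?E \<subseteq> {x. ennreal (2 * \<tau>) < ?M x}"
        proof safe
          fix x assume x: "x \<in> ball a r" "ennreal t < maxop \<rho> G x / ennreal C1"
          have "w < \<Phi> (maxop (\<lambda>_. 1) G x / ennreal C0)"
            using w monoD[OF Phi_bar_mono[OF P(2)] less_imp_le[OF x(2)]] pointwise[rule_format, of G x, OF avg]
            by (meson less_le_trans)
          have "ennreal g < maxop (\<lambda>_. 1) G x / ennreal C0"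
          proof (rule ccontr)
            assume "\<not> ennreal g < maxop (\<lambda>_. 1) G x / ennreal C0"
            then have "\<Phi> (maxop (\<lambda>_. 1) G x / ennreal C0) \<le> \<Phi> (gen_inv \<Phi> w)"
              unfolding g by (intro monoD[OF Phi_bar_mono[OF P(1)]]) simp
            also have "\<dots> \<le> w" by (rule Phi_gen_inv_le[OF P(1)])
            finally show False using \<open>w < \<Phi> _\<close> by simp
          qed
          then have "ennreal C0 * ennreal g < maxop (\<lambda>_. 1) G x"
            using C0 by (simp add: ennreal_less_divide_real_iff)
          also have "\<dots> \<le> max (?M x) (ennreal K0 * gen_inv \<Phi> (ennreal (\<phi> r)))"
          proof (rule maxop_split[OF x(1)])
            fix b s assume "r < s"
            then show "avg G b s \<le> ennreal K0 * gen_inv \<Phi> (ennreal (\<phi> r))"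
              unfolding K0_def using r avg C Cs by (intro large_ball_avg[OF q(1)]) auto
          qed
          finally have "ennreal C0 * ennreal g < max (?M x) (ennreal K0 * gen_inv \<Phi> (ennreal (\<phi> r)))" .
          moreover have "ennreal K0 * gen_inv \<Phi> (ennreal (\<phi> r)) \<le> ennreal C0 * ennreal g"
            unfolding g(1)[symmetric] using False by (intro mult_mono gen_inv_mono ennreal_leI) (auto simp: C0_def)
          ultimately have "ennreal C0 * ennreal g < ?M x"
            by (auto simp: less_max_iff_disj)
          moreover have "ennreal (2 * \<tau>) \<le> ennreal C0 * ennreal g"
            using g C0 unfolding \<tau>_def C0_def
            by (simp add: ennreal_mult[symmetric] mult.assoc[symmetric] mult_right_mono ennreal_leI)
          ultimately show "ennreal (2 * \<tau>) < ?M x" by (rule le_less_trans[rotated])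
        qed
        then have E: "emeasure lebesgue ?E \<le> emeasure lebesgue {x. ennreal (2 * \<tau>) < ?M x}"
          using measurable_sets[OF maxop_measurable, of "{ennreal (2 * \<tau>)<..}" "\<lambda>_. 1" "\<lambda>y. G y * indicator (ball a (3 * r)) y"]
          by (intro emeasure_mono) (auto simp: vimage_def)
        have "w < \<Phi> (ennreal (2 * g))"
          by (rule gen_inv_less_imp[OF Phi_bar_mono[OF P(1)] \<open>w < \<infinity>\<close>]) (simp add: g ennreal_lessI)
        then have "ennreal c * w \<le> ennreal c * \<Phi> (ennreal (2 * g))" by (intro mult_left_mono) auto
        also have "\<dots> \<le> \<Phi> (ennreal (K * c) * ennreal (2 * g))" by (rule superhomogeneousD[OF q(1) c])
        also have "ennreal (K * c) * ennreal (2 * g) = ennreal \<tau>"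
          using K c g by (simp add: \<tau>_def ennreal_mult[symmetric] mult_ac)
        finally have "ennreal c * w * emeasure lebesgue ?E
            \<le> \<Phi> (ennreal \<tau>) * emeasure lebesgue {x. ennreal (2 * \<tau>) < ?M x}"
          using E by (intro mult_mono) auto
        also have "\<dots> \<le> ennreal (5 ^ DIM('a) * (D * (C * 3 ^ DIM('a)))) * (ennreal (\<phi> r) * emeasure lebesgue (ball a r))"
          using C D r \<tau> by (intro maxop_local_weak_type G T) auto
        also have "\<dots> \<le> ennreal c * (ennreal (\<phi> r) * emeasure lebesgue (ball a r))"
          by (intro mult_right_mono ennreal_leI) (auto simp: c_def)
        finally show ?thesis using c by (simp add: ennreal_mult_le_mult_iff mult.assoc)
      qed
    qed
  qed
  show ?thesis
    unfolding in_weak_unit_ball_def by (intro exI[of _ C1] conjI allI impI C1 main)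
qed

section \<open>The strong modular inequality for the Hardy-Littlewood operator\<close>

lemma Phi_bar_le_by_below:
  assumes "\<Phi> \<in> Phi_bar" "\<And>w. w < g \<Longrightarrow> \<Phi> w \<le> S"
  shows "\<Phi> g \<le> S"
proof -
  \<comment> \<open>The bounds below g are restated on the side of the inverse, where passing to the
    supremum is immediate; left continuity is contained in \<open>Phi_gen_inv_le\<close>.\<close>
  have "g \<le> gen_inv \<Phi> S"
  proof (rule dense_le)
    fix w assume "w < g"
    then show "w \<le> gen_inv \<Phi> S" by (intro le_gen_inv[OF Phi_bar_mono[OF assms(1)]] assms(2))
  qed
  then have "\<Phi> g \<le> \<Phi> (gen_inv \<Phi> S)" by (rule monoD[OF Phi_bar_mono[OF assms(1)]])
  also have "\<dots> \<le> S" by (rule Phi_gen_inv_le[OF assms(1)])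
  finally show ?thesis .
qed

text \<open>A discrete layer-cake formula: \<Phi>(w) for w < g is dominated by the value of \<Phi>
  one level above the last level passed, and this is a single term of the sum.\<close>

lemma Phi_le_geometric_levels:
  assumes P: "\<Phi> \<in> Phi_bar" and k: "1 < (k::real)" and e: "0 < e" "ennreal e < g"
  shows "\<Phi> g \<le> (\<Sum>j. \<Phi> (ennreal (e * k ^ Suc j)) * indicator {s. ennreal (e * k ^ j) < s} g)"
    (is "_ \<le> suminf ?f")
proof (rule Phi_bar_le_by_below[OF P])
  fix w assume w: "w < g"
  obtain m where m: "w \<le> ennreal (e * k ^ Suc m)" "ennreal (e * k ^ m) < g"
    by (rule ex_geometric_level[OF k e w])
  then have "\<Phi> w \<le> ?f m" using monoD[OF Phi_bar_mono[OF P] m(1)] by simp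
  also have "\<dots> \<le> suminf ?f"
    using sum_le_suminf[of ?f "{m}"] by (simp del: sum_mult_indicator sum_indicator_mult power_Suc)
  finally show "\<Phi> w \<le> suminf ?f" .
qed

text \<open>The quotients \<open>\<Phi>(t)/t\<close> at least double from one level to the next, so they are
  summed by their successor.\<close>

lemma nabla2_sum_quotients:
  assumes N: "nabla2 k \<Phi>" and e: "0 < e"
  shows "(\<Sum>j<m. \<Phi> (ennreal (e * k ^ Suc j)) * ennreal (1 / (e * k ^ j)))
    \<le> \<Phi> (ennreal (e * k ^ Suc m)) * ennreal (1 / (e * k ^ m))"
proof (induction m)
  case (Suc m)
  have k: "1 < k" using N by (simp add: nabla2_def)
  have "(\<Sum>j<Suc m. \<Phi> (ennreal (e * k ^ Suc j)) * ennreal (1 / (e * k ^ j)))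
      \<le> \<Phi> (ennreal (e * k ^ Suc m)) * ennreal (1 / (e * k ^ m))
        + \<Phi> (ennreal (e * k ^ Suc m)) * ennreal (1 / (e * k ^ m))"
    using Suc by (simp add: add_right_mono)
  also have "\<dots> = \<Phi> (ennreal (e * k ^ Suc m)) * ennreal (2 / (e * k ^ m))"
    using k e by (simp add: distrib_left[symmetric] ennreal_plus[symmetric] del: ennreal_plus power_Suc)
  also have "\<dots> \<le> (ennreal (1 / (2 * k)) * \<Phi> (ennreal k * ennreal (e * k ^ Suc m))) * ennreal (2 / (e * k ^ m))"
    using N k e by (intro mult_right_mono) (auto simp: nabla2_def)
  also have "\<dots> = \<Phi> (ennreal k * ennreal (e * k ^ Suc m)) * (ennreal (1 / (2 * k)) * ennreal (2 / (e * k ^ m)))"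
    by (simp only: mult_ac)
  also have "ennreal (1 / (2 * k)) * ennreal (2 / (e * k ^ m)) = ennreal (1 / (e * k ^ Suc m))"
    using k e by (simp add: ennreal_mult[symmetric])
  also have "ennreal k * ennreal (e * k ^ Suc m) = ennreal (e * k ^ Suc (Suc m))"
    using k e by (simp add: ennreal_mult[symmetric] mult_ac)
  finally show ?case .
qed simp

text \<open>Only the levels e k^j < h = H(y) contribute, say j < m with m least. Their quotients sum
  to at most \<Phi>(e k^(m+1)) / (e k^m), and h \<le> e k^m removes the denominator. Since e k^(m-1)
  < h, the argument e k^(m+1) is below k^2 h, which is the origin of the factor k^2.\<close>

lemma nabla2_sum_tails:
  assumes P: "\<Phi> \<in> Phi_bar" and N: "nabla2 k \<Phi>" and e: "0 < e"
  shows "(\<Sum>j. \<Phi> (ennreal (e * k ^ Suc j)) * (ennreal (1 / (e * k ^ j)) * tail (ennreal (e * k ^ j)) H y))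
    \<le> \<Phi> (ennreal (k ^ 2) * H y)" (is "suminf ?f \<le> _")
proof (cases "H y = \<infinity>")
  case True
  have "0 < k" using N by (simp add: nabla2_def)
  then show ?thesis using True Phi_bar_top[OF P] by (simp add: ennreal_mult_top)
next
  case False
  have k: "1 < k" using N by (simp add: nabla2_def)
  obtain h where h: "H y = ennreal h" "0 \<le> h" using False by (cases "H y") auto
  obtain n where "h / e < k ^ n" using real_arch_pow[OF k] by blast
  then have ex: "h \<le> e * k ^ n" using e by (simp add: field_simps)
  define m where "m = (LEAST m. h \<le> e * k ^ m)"
  have m: "h \<le> e * k ^ m" unfolding m_def using ex by (rule LeastI)
  have zero: "?f j = 0" if "j \<notin> {..<m}" for j
  proof -
    have "e * k ^ m \<le> e * k ^ j" using that k e by (intro mult_left_mono power_increasing) auto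
    then have "ennreal h \<le> ennreal (e * k ^ j)" using m by (intro ennreal_leI) simp
    then show ?thesis by (simp add: tail_def h)
  qed
  show ?thesis
  proof (cases m)
    case 0
    then have "suminf ?f = 0" using zero by (simp add: suminf_finite[of "{}"])
    then show ?thesis by simp
  next
    case (Suc i)
    have "\<not> h \<le> e * k ^ i" using not_less_Least[of i "\<lambda>m. h \<le> e * k ^ m"] Suc by (simp add: m_def)
    have "suminf ?f = (\<Sum>j<m. ?f j)" using zero by (intro suminf_finite) auto
    also have "\<dots> \<le> (\<Sum>j<m. \<Phi> (ennreal (e * k ^ Suc j)) * ennreal (1 / (e * k ^ j)) * ennreal h)"
      by (intro sum_mono) (simp add: tail_def h mult.assoc mult_left_mono)
    also have "\<dots> = (\<Sum>j<m. \<Phi> (ennreal (e * k ^ Suc j)) * ennreal (1 / (e * k ^ j))) * ennreal h"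
      by (rule sum_distrib_right[symmetric])
    also have "\<dots> \<le> \<Phi> (ennreal (e * k ^ Suc m)) * ennreal (1 / (e * k ^ m)) * ennreal h"
      by (intro mult_right_mono nabla2_sum_quotients N e) simp
    also have "\<dots> = \<Phi> (ennreal (e * k ^ Suc m)) * ennreal (h / (e * k ^ m))"
      using k e h by (simp add: ennreal_mult[symmetric] mult.assoc)
    also have "\<dots> \<le> \<Phi> (ennreal (e * k ^ Suc m)) * ennreal 1"
      using m k e by (intro mult_left_mono ennreal_leI) auto
    also have "\<dots> \<le> \<Phi> (ennreal (k ^ 2) * H y)"
    proof -
      have "e * k ^ Suc m = k ^ 2 * (e * k ^ i)" by (simp add: Suc power2_eq_square)
      also have "\<dots> \<le> k ^ 2 * h" using \<open>\<not> h \<le> e * k ^ i\<close> by (intro mult_left_mono) auto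
      finally have "ennreal (e * k ^ Suc m) \<le> ennreal (k ^ 2) * H y"
        using h by (simp add: ennreal_mult[symmetric] ennreal_leI)
      then show ?thesis using monoD[OF Phi_bar_mono[OF P]] by simp
    qed
    finally show ?thesis .
  qed
qed

text \<open>An interpolation argument with discrete levels: the truncated weak type inequality is
  applied at every level e k^j to its own tail of H, and exchanging sum and integral leaves the
  pointwise sum of tails. Halving the maximal function matches the threshold 2t of that inequality;
  geometric levels need a positive start e.\<close>

lemma nabla2_maxop_modular_above:
  fixes H :: "'a::euclidean_space \<Rightarrow> ennreal"
  assumes P: "\<Phi> \<in> Phi_bar" and N: "nabla2 k \<Phi>" and H[measurable]: "H \<in> borel_measurable lebesgue"
    and e: "0 < e"
  shows "(\<integral>\<^sup>+x\<in>{x. ennreal e < maxop (\<lambda>_. 1) H x / 2}. \<Phi> (maxop (\<lambda>_. 1) H x / 2) \<partial>lebesgue)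
    \<le> ennreal (5 ^ DIM('a)) * (\<integral>\<^sup>+x. \<Phi> (ennreal (k ^ 2) * H x) \<partial>lebesgue)"
proof -
  have k: "1 < k" using N by (simp add: nabla2_def)
  have [measurable]: "\<Phi> \<in> borel_measurable borel"
    using Phi_bar_mono[OF P] by (rule borel_measurable_mono_ennreal)
  let ?g = "\<lambda>x. maxop (\<lambda>_. 1) H x / 2" and ?c = "\<lambda>j. \<Phi> (ennreal (e * k ^ Suc j))"
  let ?E = "\<lambda>j. {x. ennreal (2 * (e * k ^ j)) < maxop (\<lambda>_. 1) H x}"
  have ek: "0 < e * k ^ j" for j using e k by simp
  have g_iff: "ennreal s < ?g x \<longleftrightarrow> ennreal (2 * s) < maxop (\<lambda>_. 1) H x" if "0 < s" for s x
    using that ennreal_less_divide_real_iff[of 2 "ennreal s" "maxop (\<lambda>_. 1) H x"]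
    by (simp add: ennreal_mult)
  have E[measurable]: "?E j \<in> sets lebesgue" for j
    using measurable_sets[OF maxop_measurable, of "{ennreal (2 * (e * k ^ j))<..}" "\<lambda>_. 1" H]
    by (simp add: vimage_def)
  have "(\<integral>\<^sup>+x\<in>{x. ennreal e < ?g x}. \<Phi> (?g x) \<partial>lebesgue)
      \<le> (\<integral>\<^sup>+x. (\<Sum>j. ?c j * indicator (?E j) x) \<partial>lebesgue)"
  proof (intro nn_integral_mono)
    fix x
    show "\<Phi> (?g x) * indicator {x. ennreal e < ?g x} x \<le> (\<Sum>j. ?c j * indicator (?E j) x)"
    proof (cases "ennreal e < ?g x")
      case True
      have "\<Phi> (?g x) \<le> (\<Sum>j. ?c j * indicator {s. ennreal (e * k ^ j) < s} (?g x))"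
        by (rule Phi_le_geometric_levels[OF P k e True])
      also have "(\<lambda>j. ?c j * indicator {s. ennreal (e * k ^ j) < s} (?g x)) = (\<lambda>j. ?c j * indicator (?E j) x)"
        using ek by (simp add: indicator_def g_iff fun_eq_iff)
      finally show ?thesis using True by simp
    qed simp
  qed
  also have "\<dots> = (\<Sum>j. ?c j * emeasure lebesgue (?E j))"
    by (subst nn_integral_suminf) (simp_all add: nn_integral_cmult_indicator)
  also have "\<dots> \<le> (\<Sum>j. ?c j * (ennreal (1 / (e * k ^ j)) *
      (ennreal (5 ^ DIM('a)) * (\<integral>\<^sup>+x. tail (ennreal (e * k ^ j)) H x \<partial>lebesgue))))"
  proof (intro suminf_le summableI mult_left_mono)
    fix j
    have "emeasure lebesgue (?E j) = ennreal (1 / (e * k ^ j)) * (ennreal (e * k ^ j) * emeasure lebesgue (?E j))"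
      using k e by (simp add: mult.assoc[symmetric] ennreal_mult[symmetric])
    also have "\<dots> \<le> ennreal (1 / (e * k ^ j)) *
      (ennreal (5 ^ DIM('a)) * (\<integral>\<^sup>+x. tail (ennreal (e * k ^ j)) H x \<partial>lebesgue))"
      using ek[of j] by (intro mult_left_mono maxop_weak_type_tail) auto
    finally show "emeasure lebesgue (?E j) \<le> \<dots>" .
  qed simp
  also have "\<dots> = (\<Sum>j. ennreal (5 ^ DIM('a)) *
      (\<integral>\<^sup>+x. ?c j * (ennreal (1 / (e * k ^ j)) * tail (ennreal (e * k ^ j)) H x) \<partial>lebesgue))"
    by (simp add: nn_integral_cmult nn_integral_multc mult_ac)
  also have "\<dots> = ennreal (5 ^ DIM('a)) *
      (\<Sum>j. (\<integral>\<^sup>+x. ?c j * (ennreal (1 / (e * k ^ j)) * tail (ennreal (e * k ^ j)) H x) \<partial>lebesgue))"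
    by (rule ennreal_suminf_cmult)
  also have "(\<Sum>j. (\<integral>\<^sup>+x. ?c j * (ennreal (1 / (e * k ^ j)) * tail (ennreal (e * k ^ j)) H x) \<partial>lebesgue))
      = (\<integral>\<^sup>+x. (\<Sum>j. ?c j * (ennreal (1 / (e * k ^ j)) * tail (ennreal (e * k ^ j)) H x)) \<partial>lebesgue)"
    by (intro nn_integral_suminf[symmetric]) measurable
  also have "ennreal (5 ^ DIM('a)) * \<dots> \<le> ennreal (5 ^ DIM('a)) * (\<integral>\<^sup>+x. \<Phi> (ennreal (k ^ 2) * H x) \<partial>lebesgue)"
    by (intro mult_left_mono nn_integral_mono nabla2_sum_tails P N e) simp
  finally show ?thesis .
qed

text \<open>The starting level e decreases to 0 along 1/(i+1), and monotone convergence applies.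
  Points where the maximal function vanishes contribute nothing because \<Phi>(0) = 0.\<close>

theorem nabla2_maxop_modular:
  fixes H :: "'a::euclidean_space \<Rightarrow> ennreal"
  assumes P: "\<Phi> \<in> Phi_bar" and N: "nabla2 k \<Phi>" and H[measurable]: "H \<in> borel_measurable lebesgue"
  shows "(\<integral>\<^sup>+x. \<Phi> (maxop (\<lambda>_. 1) H x / 2) \<partial>lebesgue)
    \<le> ennreal (5 ^ DIM('a)) * (\<integral>\<^sup>+x. \<Phi> (ennreal (k ^ 2) * H x) \<partial>lebesgue)"
proof -
  have [measurable]: "\<Phi> \<in> borel_measurable borel"
    using Phi_bar_mono[OF P] by (rule borel_measurable_mono_ennreal)
  let ?g = "\<lambda>x. maxop (\<lambda>_. 1) H x / 2"
  have [measurable]: "?g \<in> borel_measurable lebesgue" by measurable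
  let ?f = "\<lambda>i x. \<Phi> (?g x) * indicator {x. ennreal (inverse (Suc i)) < ?g x} x"
  have meas: "{x. ennreal s < ?g x} \<in> sets lebesgue" for s
    using measurable_sets[of ?g lebesgue borel "{ennreal s<..}"] by (simp add: vimage_def)
  have "\<Phi> (?g x) \<le> (SUP i. ?f i x)" for x
  proof (cases "?g x = 0")
    case True
    then show ?thesis using Phi_bar_0[OF P] by simp
  next
    case False
    then obtain s where "0 < s" "s < ?g x" using dense[of 0 "?g x"] by (auto simp: zero_less_iff_neq_zero)
    then obtain t where t: "s = ennreal t" "0 < t" by (cases s) auto
    obtain i where "inverse (Suc i) < t" using reals_Archimedean[OF t(2)] by blast
    then have "ennreal (inverse (Suc i)) \<le> s" using t by (intro ennreal_leI[of _ t, folded t(1)]) simp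
    then have "?f i x = \<Phi> (?g x)" using \<open>s < ?g x\<close> by (simp add: le_less_trans)
    then show ?thesis by (metis (no_types, lifting) SUP_upper UNIV_I)
  qed
  then have "(\<integral>\<^sup>+x. \<Phi> (?g x) \<partial>lebesgue) \<le> (\<integral>\<^sup>+x. (SUP i. ?f i x) \<partial>lebesgue)"
    by (intro nn_integral_mono)
  also have "\<dots> = (SUP i. \<integral>\<^sup>+x. ?f i x \<partial>lebesgue)"
  proof (rule nn_integral_monotone_convergence_SUP)
    show "incseq ?f"
    proof (intro incseq_SucI le_funI mult_left_mono)
      fix i x
      have "ennreal (inverse (Suc (Suc i))) \<le> ennreal (inverse (Suc i))"
        by (intro ennreal_leI le_imp_inverse_le) auto
      then have "ennreal (inverse (Suc (Suc i))) < ?g x" if "ennreal (inverse (Suc i)) < ?g x"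
        using that by (rule le_less_trans)
      then show "indicator {x. ennreal (inverse (Suc i)) < ?g x} x
          \<le> (indicator {x. ennreal (inverse (Suc (Suc i))) < ?g x} x :: ennreal)"
        by (simp only: indicator_def mem_Collect_eq) simp
    qed simp
    show "?f i \<in> borel_measurable lebesgue" for i
      using meas[of "inverse (Suc i)"] by measurable
  qed
  also have "\<dots> \<le> ennreal (5 ^ DIM('a)) * (\<integral>\<^sup>+x. \<Phi> (ennreal (k ^ 2) * H x) \<partial>lebesgue)"
    by (intro SUP_least nabla2_maxop_modular_above P N H) simp
  finally show ?thesis .
qed

lemma strong_avg:
  fixes G :: "'a::euclidean_space \<Rightarrow> ennreal"
  assumes P: "\<Phi> \<in> Phi_bar" "superhomogeneous K \<Phi>" and G[measurable]: "G \<in> borel_measurable lebesgue"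
    and strong: "in_unit_ball \<Phi> \<phi> G"
    and r: "0 < r" "0 < \<phi> r"
  shows "avg G a r \<le> ennreal (4 * K) * gen_inv \<Phi> (ennreal (\<phi> r))"
proof -
  have K: "1 \<le> K" using P by (simp add: superhomogeneous_def)
  have "avg (\<lambda>y. G y / ennreal K) a r \<le> ennreal (2 * (1 + 1)) * gen_inv \<Phi> (ennreal (\<phi> r))"
    using r by (intro tail_bound_avg[OF P(1)] tail_bound_strong P G strong) auto
  then have "avg G a r \<le> ennreal K * (ennreal 4 * gen_inv \<Phi> (ennreal (\<phi> r)))"
    using K by (simp add: avg_cdiv[OF G] ennreal_le_mult_of_divide_le)
  then show ?thesis using K by (simp add: ennreal_mult mult_ac)
qed

text \<open>On B(a,r) the maximal function is at most the larger of a local part and a constant from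
  large balls. Each is allotted half of \<phi>(r)|B(a,r)|.\<close>

lemma maxop_strong_bounded:
  assumes P: "\<Phi> \<in> Phi_bar" "\<Psi> \<in> Phi_bar" and q: "superhomogeneous K \<Phi>" "superhomogeneous K' \<Psi>"
    and \<phi>: "\<phi> \<in> G_dec DIM('a::euclidean_space)"
    and alt: "(\<phi> \<longlongrightarrow> 0) at_top \<or> almost_decreasing (\<lambda>t. gen_inv \<Psi> (ennreal t) / gen_inv \<Phi> (ennreal t))"
    and rho: "rho_condition \<rho> \<Phi> \<Psi> \<phi>" and N: "nabla2 k \<Phi>"
  shows "\<exists>C1>0. \<forall>G::'a \<Rightarrow> ennreal. G \<in> borel_measurable lebesgue \<longrightarrow> in_unit_ball \<Phi> \<phi> G \<longrightarrow>
      in_unit_ball \<Psi> \<phi> (\<lambda>x. maxop \<rho> G x / ennreal C1)"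
proof -
  obtain C where C: "1 \<le> C" "\<And>r. 0 < r \<Longrightarrow> 0 < \<phi> r" "\<And>r s. 0 < r \<Longrightarrow> r \<le> s \<Longrightarrow> \<phi> s \<le> C * \<phi> r"
    using \<phi> by (elim G_decE) blast
  have K: "1 \<le> K" using q by (simp add: superhomogeneous_def)
  have k: "1 < k" using N by (simp add: nabla2_def)
  have [measurable]: "\<Phi> \<in> borel_measurable borel"
    using Phi_bar_mono[OF P(1)] by (rule borel_measurable_mono_ennreal)
  define Cs where "Cs = 4 * K"
  define K0 where "K0 = Cs * (K * C)"
  define D where "D = 5 ^ DIM('a) * (C * 3 ^ DIM('a))"
  have D: "1 \<le> D" unfolding D_def using C(1) by (intro one_le_mult_iff[THEN iffD2] mult_ge1_I) auto
  define c where "c = 2 * D"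
  \<comment> \<open>The first entry reduces the large-ball bound K0 g to g/(2K). In the second, 2
    and k^2 are the dilations in \<open>nabla2_maxop_modular\<close>, and K c absorbs c = 2D, where
    D collects 5^n and the cost C 3^n of the tripled ball.\<close>
  define C0 where "C0 = max (2 * K * K0) (2 * K * c * k ^ 2)"
  have Cs: "0 < Cs" using K by (simp add: Cs_def)
  have K0: "0 < K0" using Cs K C(1) by (simp add: K0_def)
  have C0: "0 < C0" using K0 K by (simp add: C0_def less_max_iff_disj)
  obtain C1 where C1: "0 < C1" and pointwise: "\<forall>(G::'a \<Rightarrow> ennreal) x.
      (\<forall>a r. 0 < r \<longrightarrow> avg G a r \<le> ennreal Cs * gen_inv \<Phi> (ennreal (\<phi> r))) \<longrightarrow>
      \<Psi> (maxop \<rho> G x / ennreal C1) \<le> \<Phi> (maxop (\<lambda>_. 1) G x / ennreal C0)"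
    using maxop_pointwise[OF P q(2) \<phi> alt rho C0 Cs, where 'a='a] by (elim exE conjE)
  have main: "(\<integral>\<^sup>+y\<in>ball a r. \<Psi> (maxop \<rho> G y / ennreal C1) \<partial>lebesgue)
      \<le> ennreal (\<phi> r) * emeasure lebesgue (ball a r)"
    if G[measurable]: "G \<in> borel_measurable lebesgue" and
      strong: "in_unit_ball \<Phi> \<phi> G"
      and r: "0 < r"
    for G :: "'a \<Rightarrow> ennreal" and a r
  proof -
    let ?v = "ennreal (\<phi> r) * emeasure lebesgue (ball a r)"
    have avg: "avg G b s \<le> ennreal Cs * gen_inv \<Phi> (ennreal (\<phi> s))" if "0 < s" for b s
      unfolding Cs_def using strong that C(2) by (intro strong_avg P q G) auto
    define H where "H = (\<lambda>y. G y * indicator (ball a (3 * r)) y)"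
    have H[measurable]: "H \<in> borel_measurable lebesgue" unfolding H_def by measurable
    have "gen_inv \<Phi> (ennreal (\<phi> r)) < \<infinity>" using P(1) by (intro gen_inv_finite) auto
    then obtain g where g: "gen_inv \<Phi> (ennreal (\<phi> r)) = ennreal g" "0 \<le> g"
      by (cases "gen_inv \<Phi> (ennreal (\<phi> r))") auto
    \<comment> \<open>Superhomogeneity with factor 2 at g/(2K) arrives exactly at g, where \<Phi> is
      at most \<phi>(r).\<close>
    have half: "ennreal 2 * \<Phi> (ennreal (g / (2 * K))) \<le> ennreal (\<phi> r)"
    proof -
      have "ennreal 2 * \<Phi> (ennreal (g / (2 * K))) \<le> \<Phi> (ennreal (K * 2) * ennreal (g / (2 * K)))"
        by (rule superhomogeneousD[OF q(1)]) simp
      also have "ennreal (K * 2) * ennreal (g / (2 * K)) = gen_inv \<Phi> (ennreal (\<phi> r))"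
        using K g by (simp add: ennreal_mult[symmetric])
      also have "\<Phi> \<dots> \<le> ennreal (\<phi> r)" by (rule Phi_gen_inv_le[OF P(1)])
      finally show ?thesis .
    qed
    have split: "\<Phi> (maxop (\<lambda>_. 1) G x / ennreal C0)
        \<le> \<Phi> (maxop (\<lambda>_. 1) H x / ennreal C0) + \<Phi> (ennreal (g / (2 * K)))" if x: "x \<in> ball a r" for x
    proof -
      have "maxop (\<lambda>_. 1) G x \<le> max (maxop (\<lambda>_. 1) H x) (ennreal K0 * gen_inv \<Phi> (ennreal (\<phi> r)))"
        unfolding H_def
      proof (rule maxop_split[OF x])
        fix b s assume "r < s"
        then show "avg G b s \<le> ennreal K0 * gen_inv \<Phi> (ennreal (\<phi> r))"
          unfolding K0_def using r avg C Cs by (intro large_ball_avg[OF q(1)]) auto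
      qed
      then consider "maxop (\<lambda>_. 1) G x \<le> maxop (\<lambda>_. 1) H x" | "maxop (\<lambda>_. 1) G x \<le> ennreal (K0 * g)"
        using g K0 by (auto simp: le_max_iff_disj ennreal_mult)
      then show ?thesis
      proof cases
        case 1
        then have "\<Phi> (maxop (\<lambda>_. 1) G x / ennreal C0) \<le> \<Phi> (maxop (\<lambda>_. 1) H x / ennreal C0)"
          by (intro monoD[OF Phi_bar_mono[OF P(1)]] divide_right_mono_ennreal)
        then show ?thesis by (rule order_trans) simp
      next
        case 2
        then have "maxop (\<lambda>_. 1) G x / ennreal C0 \<le> ennreal (K0 * g) / ennreal C0"
          by (rule divide_right_mono_ennreal)
        also have "\<dots> = ennreal (K0 * g / C0)" using K0 g C0 by (intro divide_ennreal) auto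
        also have "\<dots> \<le> ennreal (g / (2 * K))"
        proof (rule ennreal_leI)
          have "K0 * g / C0 \<le> K0 * g / (2 * K * K0)"
            using K0 g K C0 by (intro divide_left_mono) (auto simp: C0_def)
          then show "K0 * g / C0 \<le> g / (2 * K)" using K0 by simp
        qed
        finally have "\<Phi> (maxop (\<lambda>_. 1) G x / ennreal C0) \<le> \<Phi> (ennreal (g / (2 * K)))"
          by (rule monoD[OF Phi_bar_mono[OF P(1)]])
        then show ?thesis by (rule order_trans) simp
      qed
    qed
    have local: "ennreal 2 * (\<integral>\<^sup>+x. \<Phi> (maxop (\<lambda>_. 1) H x / ennreal C0) \<partial>lebesgue) \<le> ?v"
    proof -
      define d where "d = K * c * k ^ 2"
      have d: "0 < d" using K k D by (simp add: d_def c_def)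
      let ?H = "\<lambda>y. H y / ennreal d"
      have "(\<integral>\<^sup>+x. \<Phi> (maxop (\<lambda>_. 1) H x / ennreal C0) \<partial>lebesgue) \<le> (\<integral>\<^sup>+x. \<Phi> (maxop (\<lambda>_. 1) ?H x / 2) \<partial>lebesgue)"
      proof (intro nn_integral_mono monoD[OF Phi_bar_mono[OF P(1)]])
        fix x
        have "maxop (\<lambda>_. 1) ?H x / 2 = maxop (\<lambda>_. 1) H x / ennreal (d * 2)"
          using ennreal_divide_divide[OF d, of 2 "maxop (\<lambda>_. 1) H x"] by (simp add: maxop_cdiv[OF H])
        moreover have "maxop (\<lambda>_. 1) H x / ennreal C0 \<le> maxop (\<lambda>_. 1) H x / ennreal (d * 2)"
        proof -
          have "d * 2 \<le> C0" by (simp add: d_def C0_def)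
          then have "inverse C0 \<le> inverse (d * 2)" using d by (intro le_imp_inverse_le) auto
          then show ?thesis
            unfolding divide_ennreal_def using d C0
            by (intro mult_left_mono) (simp_all add: inverse_ennreal ennreal_leI del: inverse_mult_distrib)
        qed
        ultimately show "maxop (\<lambda>_. 1) H x / ennreal C0 \<le> maxop (\<lambda>_. 1) ?H x / 2" by simp
      qed
      also have "\<dots> \<le> ennreal (5 ^ DIM('a)) * (\<integral>\<^sup>+x. \<Phi> (ennreal (k ^ 2) * ?H x) \<partial>lebesgue)"
        by (intro nabla2_maxop_modular P N) measurable
      finally have "ennreal c * (\<integral>\<^sup>+x. \<Phi> (maxop (\<lambda>_. 1) H x / ennreal C0) \<partial>lebesgue)
          \<le> ennreal c * (ennreal (5 ^ DIM('a)) * (\<integral>\<^sup>+x. \<Phi> (ennreal (k ^ 2) * ?H x) \<partial>lebesgue))"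
        by (rule mult_left_mono) simp
      also have "\<dots> = ennreal (5 ^ DIM('a)) * (\<integral>\<^sup>+x. ennreal c * \<Phi> (ennreal (k ^ 2) * ?H x) \<partial>lebesgue)"
        by (subst nn_integral_cmult) (auto simp: mult_ac)
      also have "\<dots> \<le> ennreal (5 ^ DIM('a)) * (\<integral>\<^sup>+x\<in>ball a (3 * r). \<Phi> (G x) \<partial>lebesgue)"
      proof (intro mult_left_mono nn_integral_mono)
        fix x
        have "ennreal c * \<Phi> (ennreal (k ^ 2) * ?H x) \<le> \<Phi> (ennreal (K * c) * (ennreal (k ^ 2) * ?H x))"
          using D by (intro superhomogeneousD[OF q(1)]) (simp add: c_def)
        also have "ennreal (K * c) * (ennreal (k ^ 2) * ?H x) = ennreal d * ?H x"
          using K D by (simp add: d_def c_def ennreal_mult mult.assoc)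
        also have "\<dots> = H x"
          using d by (simp add: ennreal_times_divide mult.commute[of "ennreal d"] ennreal_mult_divide_eq)
        also have "\<Phi> (H x) = \<Phi> (G x) * indicator (ball a (3 * r)) x"
          using Phi_bar_0[OF P(1)] by (simp add: H_def indicator_def)
        finally show "ennreal c * \<Phi> (ennreal (k ^ 2) * ?H x) \<le> \<Phi> (G x) * indicator (ball a (3 * r)) x" .
      qed simp
      also have "\<dots> \<le> ennreal (5 ^ DIM('a)) * (ennreal (1 * \<phi> (3 * r)) * emeasure lebesgue (ball a (3 * r)))"
        using strong r by (intro mult_left_mono) (auto simp: in_unit_ball_def)
      also have "\<dots> \<le> ennreal (5 ^ DIM('a)) * (ennreal (1 * (C * 3 ^ DIM('a))) * ?v)"
        using C r by (intro mult_left_mono triple_ball_weight) auto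
      also have "\<dots> = ennreal D * ?v"
        using C(1) by (simp add: D_def ennreal_mult mult.assoc)
      finally have "ennreal D * (ennreal 2 * (\<integral>\<^sup>+x. \<Phi> (maxop (\<lambda>_. 1) H x / ennreal C0) \<partial>lebesgue)) \<le> ennreal D * ?v"
        using D by (simp add: c_def ennreal_mult mult_ac)
      then show ?thesis using D by (simp add: ennreal_mult_le_mult_iff)
    qed
    have "ennreal 2 * (\<integral>\<^sup>+y\<in>ball a r. \<Psi> (maxop \<rho> G y / ennreal C1) \<partial>lebesgue)
        \<le> ennreal 2 * (\<integral>\<^sup>+y. \<Phi> (maxop (\<lambda>_. 1) H y / ennreal C0)
            + \<Phi> (ennreal (g / (2 * K))) * indicator (ball a r) y \<partial>lebesgue)"
    proof (intro mult_left_mono nn_integral_mono)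
      fix y
      show "\<Psi> (maxop \<rho> G y / ennreal C1) * indicator (ball a r) y
          \<le> \<Phi> (maxop (\<lambda>_. 1) H y / ennreal C0) + \<Phi> (ennreal (g / (2 * K))) * indicator (ball a r) y"
        using split[of y] pointwise[rule_format, of G y, OF avg]
        by (cases "y \<in> ball a r") (auto intro: order_trans)
    qed simp
    also have "\<dots> = ennreal 2 * (\<integral>\<^sup>+y. \<Phi> (maxop (\<lambda>_. 1) H y / ennreal C0) \<partial>lebesgue)
        + ennreal 2 * \<Phi> (ennreal (g / (2 * K))) * emeasure lebesgue (ball a r)"
      by (subst nn_integral_add) (auto simp: nn_integral_cmult_indicator distrib_left mult.assoc)
    also have "\<dots> \<le> ?v + ?v" using half by (intro add_mono local mult_right_mono) auto
    also have "\<dots> = ennreal 2 * ?v" by (simp add: mult_2)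
    finally show ?thesis by (simp add: ennreal_mult_le_mult_iff)
  qed
  show ?thesis
    using main C1 unfolding in_unit_ball_def[of \<Psi>] by (intro exI[of _ C1] conjI allI impI)
qed

section \<open>Orlicz--Morrey norms\<close>

lemma e2ennreal_divide: "0 \<le> y \<Longrightarrow> 0 < l \<Longrightarrow> e2ennreal (y / ereal l) = e2ennreal y / ennreal l"
  by (cases y) (auto simp: divide_ennreal ennreal_top_divide)

lemma less_e2ennreal_iff: "0 \<le> y \<Longrightarrow> 0 \<le> t \<Longrightarrow> ennreal t < e2ennreal y \<longleftrightarrow> ereal t < y"
  by (cases y) (auto simp: ennreal_less_iff)

lemma abs_divide_ereal: "0 < l \<Longrightarrow> \<bar>y / ereal l\<bar> = \<bar>y\<bar> / ereal l"
  by (cases y) auto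

lemma M_op_measurable [measurable]: "M_op \<rho> f \<in> borel_measurable lebesgue"
  unfolding M_frac_eq_maxop by measurable

section \<open>Norm bounds as modular conditions\<close>

lemma weight_le_iff:
  assumes "0 < r" "0 < \<phi> r"
  shows "X / (ennreal (\<phi> r) * emeasure lebesgue (ball (a::'a::euclidean_space) r)) \<le> 1 \<longleftrightarrow>
    X \<le> ennreal (\<phi> r) * emeasure lebesgue (ball a r)"
  using assms emeasure_ball_pos[of r a] emeasure_ball_finite[of r a]
  by (subst ennreal_divide_le_iff) (auto simp: ennreal_zero_less_mult_iff ennreal_mult_less_top)

lemma ball_norm_condition_iff:
  assumes "0 < l" "0 < r" "0 < \<phi> r"
  shows "(\<integral>\<^sup>+x\<in>ball a r. \<Phi> (e2ennreal (\<bar>f x\<bar> / ereal l)) \<partial>lebesgue)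
       / (ennreal (\<phi> r) * emeasure lebesgue (ball a r)) \<le> 1 \<longleftrightarrow>
    (\<integral>\<^sup>+x\<in>ball a r. \<Phi> (e2ennreal \<bar>f x\<bar> / ennreal l) \<partial>lebesgue)
       \<le> ennreal (\<phi> r) * emeasure lebesgue (ball a r)"
  using assms by (simp add: weight_le_iff e2ennreal_divide)

lemma ball_norm_weak_condition_iff:
  assumes "0 < l" "0 < r" "0 < \<phi> r"
  shows "(SUP t\<in>{0<..}. \<Phi> (ennreal t) * distr_fun (ball a r) (\<lambda>x. f x / ereal l) t
       / (emeasure lebesgue (ball a r) * ennreal (\<phi> r))) \<le> 1 \<longleftrightarrow>
    (\<forall>t>0. \<Phi> (ennreal t) * emeasure lebesgue {x \<in> ball a r. ennreal t < e2ennreal \<bar>f x\<bar> / ennreal l}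
       \<le> ennreal (\<phi> r) * emeasure lebesgue (ball a r))"
proof -
  have "distr_fun (ball a r) (\<lambda>x. f x / ereal l) t
      = emeasure lebesgue {x \<in> ball a r. ennreal t < e2ennreal \<bar>f x\<bar> / ennreal l}" if "0 < t" for t
  proof -
    have "ereal t < \<bar>f x / ereal l\<bar> \<longleftrightarrow> ennreal t < e2ennreal \<bar>f x\<bar> / ennreal l" for x
      using less_e2ennreal_iff[of "\<bar>f x / ereal l\<bar>" t] that assms(1)
      by (simp add: abs_divide_ereal e2ennreal_divide)
    then show ?thesis by (simp add: distr_fun_def)
  qed
  then show ?thesis
    using assms by (simp add: SUP_le_iff Ball_def weight_le_iff mult.commute[of "emeasure lebesgue (ball a r)"])
qed

text \<open>A strict bound supplies on every ball an admissible l' < l, and monotonicity of \<Phi>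
  replaces it by the common value l. No attainment of the infimum is involved.\<close>

lemma L_norm_less_imp:
  assumes m: "mono \<Phi>" and \<phi>: "\<And>r. 0 < r \<Longrightarrow> 0 < \<phi> r" and l: "L_norm \<Phi> \<phi> f < ennreal l"
  shows "in_unit_ball \<Phi> \<phi> (\<lambda>x. e2ennreal \<bar>f x\<bar> / ennreal l)"
  unfolding in_unit_ball_def
proof (intro allI impI)
  fix a :: 'a and r :: real assume r: "0 < r"
  have "ball_norm \<Phi> \<phi> a r f \<le> L_norm \<Phi> \<phi> f"
    unfolding L_norm_def using r by (intro SUP_upper2[of "(a, r)"]) auto
  then have "ball_norm \<Phi> \<phi> a r f < ennreal l" using l by (rule le_less_trans)
  then obtain l' where l': "0 < l'" "ennreal l' < ennreal l"
    "(\<integral>\<^sup>+x\<in>ball a r. \<Phi> (e2ennreal (\<bar>f x\<bar> / ereal l')) \<partial>lebesgue)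
       / (ennreal (\<phi> r) * emeasure lebesgue (ball a r)) \<le> 1"
    unfolding ball_norm_def Inf_less_iff by blast
  have "(\<integral>\<^sup>+x\<in>ball a r. \<Phi> (e2ennreal \<bar>f x\<bar> / ennreal l) \<partial>lebesgue)
      \<le> (\<integral>\<^sup>+x\<in>ball a r. \<Phi> (e2ennreal \<bar>f x\<bar> / ennreal l') \<partial>lebesgue)"
    unfolding divide_ennreal_def using l'
    by (intro nn_integral_mono mult_right_mono monoD[OF m] mult_left_mono)
      (auto simp: inverse_ennreal ennreal_less_iff intro!: ennreal_leI le_imp_inverse_le)
  also have "\<dots> \<le> ennreal (\<phi> r) * emeasure lebesgue (ball a r)"
    using l'(1,3) r \<phi>[OF r] by (simp add: ball_norm_condition_iff)
  finally show "(\<integral>\<^sup>+x\<in>ball a r. \<Phi> (e2ennreal \<bar>f x\<bar> / ennreal l) \<partial>lebesgue)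
      \<le> ennreal (\<phi> r) * emeasure lebesgue (ball a r)" .
qed

lemma L_norm_le:
  assumes \<phi>: "\<And>r. 0 < r \<Longrightarrow> 0 < \<phi> r" and l: "0 < l"
    and s: "in_unit_ball \<Phi> \<phi> (\<lambda>x. e2ennreal \<bar>f x\<bar> / ennreal l)"
  shows "L_norm \<Phi> \<phi> f \<le> ennreal l"
  unfolding L_norm_def
proof (rule SUP_least, clarsimp)
  fix a :: 'a and r :: real assume r: "0 < r"
  show "ball_norm \<Phi> \<phi> a r f \<le> ennreal l"
    unfolding ball_norm_def using s l r \<phi>[OF r]
    by (intro Inf_lower) (auto simp: ball_norm_condition_iff in_unit_ball_def)
qed

lemma wL_norm_less_imp:
  assumes [measurable]: "f \<in> borel_measurable lebesgue"
    and \<phi>: "\<And>r. 0 < r \<Longrightarrow> 0 < \<phi> r" and l: "wL_norm \<Phi> \<phi> f < ennreal l"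
  shows "in_weak_unit_ball \<Phi> \<phi> (\<lambda>x. e2ennreal \<bar>f x\<bar> / ennreal l)"
  unfolding in_weak_unit_ball_def
proof (intro allI impI)
  fix a :: 'a and r t :: real assume r: "0 < r" and t: "0 < t"
  have "ball_norm_weak \<Phi> \<phi> a r f \<le> wL_norm \<Phi> \<phi> f"
    unfolding wL_norm_def using r by (intro SUP_upper2[of "(a, r)"]) auto
  then have "ball_norm_weak \<Phi> \<phi> a r f < ennreal l" using l by (rule le_less_trans)
  then obtain l' where l': "0 < l'" "ennreal l' < ennreal l"
    "(SUP t\<in>{0<..}. \<Phi> (ennreal t) * distr_fun (ball a r) (\<lambda>x. f x / ereal l') t
       / (emeasure lebesgue (ball a r) * ennreal (\<phi> r))) \<le> 1"
    unfolding ball_norm_weak_def Inf_less_iff by blast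
  have le: "e2ennreal \<bar>f x\<bar> / ennreal l \<le> e2ennreal \<bar>f x\<bar> / ennreal l'" for x
    unfolding divide_ennreal_def using l'
    by (intro mult_left_mono) (auto simp: inverse_ennreal ennreal_less_iff intro!: ennreal_leI le_imp_inverse_le)
  have "\<Phi> (ennreal t) * emeasure lebesgue {x \<in> ball a r. ennreal t < e2ennreal \<bar>f x\<bar> / ennreal l}
      \<le> \<Phi> (ennreal t) * emeasure lebesgue {x \<in> ball a r. ennreal t < e2ennreal \<bar>f x\<bar> / ennreal l'}"
  proof (intro mult_left_mono emeasure_mono)
    show "{x \<in> ball a r. ennreal t < e2ennreal \<bar>f x\<bar> / ennreal l}
        \<subseteq> {x \<in> ball a r. ennreal t < e2ennreal \<bar>f x\<bar> / ennreal l'}"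
    proof safe
      fix x assume "ennreal t < e2ennreal \<bar>f x\<bar> / ennreal l"
      then show "ennreal t < e2ennreal \<bar>f x\<bar> / ennreal l'" using le by (rule less_le_trans)
    qed
    have "(\<lambda>x. e2ennreal \<bar>f x\<bar> / ennreal l') \<in> borel_measurable lebesgue" by measurable
    then have "(\<lambda>x. e2ennreal \<bar>f x\<bar> / ennreal l') -` {ennreal t<..} \<inter> space lebesgue \<in> sets lebesgue"
      by (rule measurable_sets) simp
    then have "ball a r \<inter> ((\<lambda>x. e2ennreal \<bar>f x\<bar> / ennreal l') -` {ennreal t<..} \<inter> space lebesgue) \<in> sets lebesgue"
      by (rule sets.Int[OF ball_sets_lebesgue])
    then show "{x \<in> ball a r. ennreal t < e2ennreal \<bar>f x\<bar> / ennreal l'} \<in> sets lebesgue"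
      by (simp add: Int_def vimage_def)
  qed simp
  also have "\<dots> \<le> ennreal (\<phi> r) * emeasure lebesgue (ball a r)"
    by (rule iffD1[OF ball_norm_weak_condition_iff[where \<phi>=\<phi>, OF l'(1) r \<phi>[OF r]] l'(3), rule_format, OF t])
  finally show "\<Phi> (ennreal t) * emeasure lebesgue {x \<in> ball a r. ennreal t < e2ennreal \<bar>f x\<bar> / ennreal l}
      \<le> ennreal (\<phi> r) * emeasure lebesgue (ball a r)" .
qed

lemma wL_norm_le:
  assumes \<phi>: "\<And>r. 0 < r \<Longrightarrow> 0 < \<phi> r" and l: "0 < l"
    and s: "in_weak_unit_ball \<Phi> \<phi> (\<lambda>x. e2ennreal \<bar>f x\<bar> / ennreal l)"
  shows "wL_norm \<Phi> \<phi> f \<le> ennreal l"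
  unfolding wL_norm_def
proof (rule SUP_least, clarsimp)
  fix a :: 'a and r :: real assume r: "0 < r"
  show "ball_norm_weak \<Phi> \<phi> a r f \<le> ennreal l"
    unfolding ball_norm_weak_def using s l r \<phi>[OF r]
    by (intro Inf_lower) (auto simp: ball_norm_weak_condition_iff in_weak_unit_ball_def)
qed

text \<open>Testing every l strictly above the norm of f and letting l decrease also covers
  functions of norm 0, which cannot be normalised by their norm.\<close>

lemma bounded_from_toI:
  assumes C: "0 < C" and meas: "\<And>f. f \<in> X \<Longrightarrow> T f \<in> borel_measurable lebesgue"
    and X: "\<And>f. f \<in> X \<Longrightarrow> nX f < \<infinity>"
    and Y: "\<And>g. g \<in> borel_measurable lebesgue \<Longrightarrow> nY g < \<infinity> \<Longrightarrow> g \<in> Y"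
    and le: "\<And>f l. f \<in> X \<Longrightarrow> 0 < l \<Longrightarrow> nX f < ennreal l \<Longrightarrow> nY (T f) \<le> ennreal (C * l)"
  shows "bounded_from_to T X nX Y nY"
  unfolding bounded_from_to_def
proof (intro exI[of _ C] conjI ballI C)
  fix f assume f: "f \<in> X"
  have "nY (T f) / ennreal C \<le> nX f"
  proof (rule dense_ge)
    fix z assume z: "nX f < z"
    show "nY (T f) / ennreal C \<le> z"
    proof (cases "z = \<infinity>")
      case False
      then obtain l where l: "z = ennreal l" "0 \<le> l" by (cases z) auto
      with z have "0 < l" by (cases "l = 0") auto
      then have "nY (T f) \<le> ennreal C * z"
        using le[OF f, of l] z l C by (simp add: ennreal_mult)
      then show ?thesis using C by (intro divide_le_posI_ennreal) auto
    qed simp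
  qed
  then show *: "nY (T f) \<le> ennreal C * nX f"
    using C by (rule ennreal_le_mult_of_divide_le[rotated])
  have "ennreal C * nX f < \<infinity>" using X[OF f] by (simp add: ennreal_mult_less_top)
  with * have "nY (T f) < \<infinity>" by (rule le_less_trans)
  with meas[OF f] show "T f \<in> Y" by (rule Y)
qed

lemma AE_zero_of_avg_zero:
  assumes [measurable]: "F \<in> borel_measurable lebesgue" and "\<And>r. 0 < r \<Longrightarrow> avg F (0::'a::euclidean_space) r = 0"
  shows "AE x in lebesgue. F x = 0"
proof -
  have "AE x in lebesgue. F x * indicator (ball 0 (real (Suc n))) x = 0" for n
  proof -
    have "(\<integral>\<^sup>+x\<in>ball 0 (real (Suc n)). F x \<partial>lebesgue) = 0"
      using avg_le_iff[of "real (Suc n)" F 0 0] assms(2)[of "real (Suc n)"] by simp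
    then show ?thesis by (subst (asm) nn_integral_0_iff_AE) auto
  qed
  then have "AE x in lebesgue. \<forall>n. F x * indicator (ball 0 (real (Suc n))) x = 0"
    by (subst AE_all_countable) blast
  then show ?thesis
  proof eventually_elim
    fix x :: 'a assume *: "\<forall>n. F x * indicator (ball 0 (real (Suc n))) x = 0"
    obtain n where "norm x < real n" using reals_Archimedean2 by blast
    then have "x \<in> ball 0 (real (Suc n))" by simp
    then show "F x = 0" using *[rule_format, of n] by simp
  qed
qed

text \<open>The pointwise inequality divides by the norm N. If N were 0, every l > 0 would be
  admissible and the averages of |f| would be bounded by l times a finite number; hence they vanish,
  and f = 0 almost everywhere.\<close>

lemma norm_pos_of_avg_bound:
  fixes f :: "'a::euclidean_space \<Rightarrow> ereal"
  assumes P: "\<Phi> \<in> Phi_bar" and [measurable]: "f \<in> borel_measurable lebesgue"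
    and avg: "\<And>l a r. 0 < l \<Longrightarrow> N < ennreal l \<Longrightarrow> 0 < r \<Longrightarrow>
      avg (\<lambda>x. e2ennreal \<bar>f x\<bar> / ennreal l) a r \<le> ennreal Cs * gen_inv \<Phi> (ennreal (\<phi> r))"
    and nz: "\<not> (AE x in lebesgue. f x = 0)"
  shows "0 < N"
proof (rule ccontr)
  assume "\<not> 0 < N"
  then have N: "N < ennreal l" if "0 < l" for l using that by simp
  let ?F = "\<lambda>x. e2ennreal \<bar>f x\<bar>"
  have "avg ?F 0 r = 0" if r: "0 < r" for r
  proof -
    have "gen_inv \<Phi> (ennreal (\<phi> r)) < \<infinity>" using P by (intro gen_inv_finite) auto
    then obtain y where y: "ennreal Cs * gen_inv \<Phi> (ennreal (\<phi> r)) = ennreal y" "0 \<le> y"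
      by (cases "ennreal Cs * gen_inv \<Phi> (ennreal (\<phi> r))") (auto simp: ennreal_mult_eq_top_iff)
    have "avg ?F 0 r \<le> ennreal e" if e: "0 < e" for e
    proof -
      \<comment> \<open>The summand 1 keeps the denominator positive when y = 0.\<close>
      define l where "l = e / (1 + y)"
      have l: "0 < l" using e y by (simp add: l_def)
      have "avg ?F 0 r / ennreal l \<le> ennreal y"
        using avg[OF l N[OF l] r, of 0] y by (simp add: avg_cdiv)
      then have "avg ?F 0 r \<le> ennreal l * ennreal y" using l by (intro ennreal_le_mult_of_divide_le)
      also have "\<dots> = ennreal (l * y)" using l y by (simp add: ennreal_mult)
      also have "\<dots> \<le> ennreal e" using e y by (intro ennreal_leI) (simp add: l_def field_simps)
      finally show ?thesis .
    qed
    then have "avg ?F 0 r \<le> 0 + ennreal e" if "0 < e" for e using that by simp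
    then have "avg ?F 0 r \<le> 0" by (rule ennreal_le_epsilon)
    then show ?thesis by simp
  qed
  then have "AE x in lebesgue. ?F x = 0" by (intro AE_zero_of_avg_zero) auto
  moreover have "y = 0" if "e2ennreal \<bar>y\<bar> = 0" for y :: ereal
    using that less_e2ennreal_iff[of "\<bar>y\<bar>" 0] by (cases y) auto
  ultimately have "AE x in lebesgue. f x = 0" by (auto elim: eventually_mono)
  then show False using nz by simp
qed

lemma strong_to_weak_bounded:
  assumes P: "\<Phi> \<in> Phi_bar" "\<Psi> \<in> Phi_bar" and q: "superhomogeneous K \<Phi>" "superhomogeneous K' \<Psi>"
    and \<phi>: "\<phi> \<in> G_dec DIM('a::euclidean_space)"
    and alt: "(\<phi> \<longlongrightarrow> 0) at_top \<or> almost_decreasing (\<lambda>t. gen_inv \<Psi> (ennreal t) / gen_inv \<Phi> (ennreal t))"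
    and rho: "rho_condition \<rho> \<Phi> \<Psi> \<phi>"
  shows "bounded_from_to (M_op \<rho> :: ('a \<Rightarrow> ereal) \<Rightarrow> _)
    (L_space \<Phi> \<phi>) (L_norm \<Phi> \<phi>) (wL_space \<Psi> \<phi>) (wL_norm \<Psi> \<phi>)"
proof -
  have pos: "0 < \<phi> r" if "0 < r" for r using \<phi> that by (simp add: G_dec_def)
  have K: "1 \<le> K" using q by (simp add: superhomogeneous_def)
  obtain C1 where C1: "0 < C1" "\<forall>G::'a \<Rightarrow> ennreal. G \<in> borel_measurable lebesgue \<longrightarrow> tail_bound \<Phi> \<phi> 1 G \<longrightarrow>
      in_weak_unit_ball \<Psi> \<phi> (\<lambda>x. maxop \<rho> G x / ennreal C1)"
    using maxop_weak_bounded[OF P q \<phi> alt rho, of 1] by auto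
  show ?thesis
  proof (rule bounded_from_toI[of "K * C1"])
    fix f :: "'a \<Rightarrow> ereal" and l assume f: "f \<in> L_space \<Phi> \<phi>" and l: "0 < l" "L_norm \<Phi> \<phi> f < ennreal l"
    let ?F = "\<lambda>x. e2ennreal \<bar>f x\<bar>"
    have f'[measurable]: "f \<in> borel_measurable lebesgue" using f by (simp add: L_space_def)
    have F: "?F \<in> borel_measurable lebesgue" "(\<lambda>x. ?F x / ennreal l) \<in> borel_measurable lebesgue"
      "(\<lambda>x. ?F x / ennreal l / ennreal K) \<in> borel_measurable lebesgue"
      by measurable
    have "in_unit_ball \<Phi> \<phi> (\<lambda>x. ?F x / ennreal l)"
      by (rule L_norm_less_imp[OF Phi_bar_mono[OF P(1)] pos l(2)])
    then have "tail_bound \<Phi> \<phi> 1 (\<lambda>x. ?F x / ennreal l / ennreal K)"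
      by (rule tail_bound_strong[OF P(1) q(1) F(2)])
    then have "in_weak_unit_ball \<Psi> \<phi> (\<lambda>x. maxop \<rho> (\<lambda>x. ?F x / ennreal l / ennreal K) x / ennreal C1)"
      using C1(2) F(3) by blast
    moreover have "maxop \<rho> (\<lambda>x. ?F x / ennreal l / ennreal K) x / ennreal C1
        = maxop \<rho> ?F x / ennreal (K * C1 * l)" for x
      using K C1(1) l(1)
      by (simp add: maxop_cdiv F ennreal_divide_divide mult_ac)
    ultimately show "wL_norm \<Psi> \<phi> (M_op \<rho> f) \<le> ennreal (K * C1 * l)"
      using K C1(1) l(1) by (intro wL_norm_le pos) (auto simp: M_frac_eq_maxop)
  qed (use K C1 in \<open>auto simp: L_space_def wL_space_def\<close>)
qed

lemma weak_to_weak_bounded: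
  assumes P: "\<Phi> \<in> Phi_bar" "\<Psi> \<in> Phi_bar" and q: "superhomogeneous K \<Phi>" "superhomogeneous K' \<Psi>"
    and \<phi>: "\<phi> \<in> G_dec DIM('a::euclidean_space)"
    and alt: "(\<phi> \<longlongrightarrow> 0) at_top \<or> almost_decreasing (\<lambda>t. gen_inv \<Psi> (ennreal t) / gen_inv \<Phi> (ennreal t))"
    and rho: "rho_condition \<rho> \<Phi> \<Psi> \<phi>" and N: "nabla2 k \<Phi>"
  shows "bounded_from_to (M_op \<rho> :: ('a \<Rightarrow> ereal) \<Rightarrow> _)
    (wL_space \<Phi> \<phi>) (wL_norm \<Phi> \<phi>) (wL_space \<Psi> \<phi>) (wL_norm \<Psi> \<phi>)"
proof -
  have pos: "0 < \<phi> r" if "0 < r" for r using \<phi> that by (simp add: G_dec_def)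
  have k: "0 \<le> 2 * k" using N by (simp add: nabla2_def)
  obtain C1 where C1: "0 < C1" "\<forall>G::'a \<Rightarrow> ennreal. G \<in> borel_measurable lebesgue \<longrightarrow> tail_bound \<Phi> \<phi> (2 * k) G \<longrightarrow>
      in_weak_unit_ball \<Psi> \<phi> (\<lambda>x. maxop \<rho> G x / ennreal C1)"
    using maxop_weak_bounded[OF P q \<phi> alt rho k] by auto
  show ?thesis
  proof (rule bounded_from_toI[of C1])
    fix f :: "'a \<Rightarrow> ereal" and l assume f: "f \<in> wL_space \<Phi> \<phi>" and l: "0 < l" "wL_norm \<Phi> \<phi> f < ennreal l"
    let ?F = "\<lambda>x. e2ennreal \<bar>f x\<bar>"
    have f'[measurable]: "f \<in> borel_measurable lebesgue" using f by (simp add: wL_space_def)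
    have F: "?F \<in> borel_measurable lebesgue" "(\<lambda>x. ?F x / ennreal l) \<in> borel_measurable lebesgue"
      by measurable
    have "in_weak_unit_ball \<Phi> \<phi> (\<lambda>x. ?F x / ennreal l)"
      by (rule wL_norm_less_imp[OF f' pos l(2)])
    then have "tail_bound \<Phi> \<phi> (2 * k) (\<lambda>x. ?F x / ennreal l)"
      by (rule tail_bound_weak[OF N F(2) _ pos])
    then have "in_weak_unit_ball \<Psi> \<phi> (\<lambda>x. maxop \<rho> (\<lambda>x. ?F x / ennreal l) x / ennreal C1)"
      using C1(2) F(2) by blast
    moreover have "maxop \<rho> (\<lambda>x. ?F x / ennreal l) x / ennreal C1
        = maxop \<rho> ?F x / ennreal (C1 * l)" for x
      using C1(1) l(1) by (simp add: maxop_cdiv F ennreal_divide_divide mult_ac)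
    ultimately show "wL_norm \<Psi> \<phi> (M_op \<rho> f) \<le> ennreal (C1 * l)"
      using C1(1) l(1) by (intro wL_norm_le pos) (auto simp: M_frac_eq_maxop)
  qed (use C1 in \<open>auto simp: wL_space_def\<close>)
qed

lemma strong_to_strong_bounded:
  assumes P: "\<Phi> \<in> Phi_bar" "\<Psi> \<in> Phi_bar" and q: "superhomogeneous K \<Phi>" "superhomogeneous K' \<Psi>"
    and \<phi>: "\<phi> \<in> G_dec DIM('a::euclidean_space)"
    and alt: "(\<phi> \<longlongrightarrow> 0) at_top \<or> almost_decreasing (\<lambda>t. gen_inv \<Psi> (ennreal t) / gen_inv \<Phi> (ennreal t))"
    and rho: "rho_condition \<rho> \<Phi> \<Psi> \<phi>" and N: "nabla2 k \<Phi>"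
  shows "bounded_from_to (M_op \<rho> :: ('a \<Rightarrow> ereal) \<Rightarrow> _)
    (L_space \<Phi> \<phi>) (L_norm \<Phi> \<phi>) (L_space \<Psi> \<phi>) (L_norm \<Psi> \<phi>)"
proof -
  have pos: "0 < \<phi> r" if "0 < r" for r using \<phi> that by (simp add: G_dec_def)
  obtain C1 where C1: "0 < C1" "\<forall>G::'a \<Rightarrow> ennreal. G \<in> borel_measurable lebesgue \<longrightarrow> in_unit_ball \<Phi> \<phi> G \<longrightarrow>
      in_unit_ball \<Psi> \<phi> (\<lambda>x. maxop \<rho> G x / ennreal C1)"
    using maxop_strong_bounded[OF P q \<phi> alt rho N] by auto
  show ?thesis
  proof (rule bounded_from_toI[of C1])
    fix f :: "'a \<Rightarrow> ereal" and l assume f: "f \<in> L_space \<Phi> \<phi>" and l: "0 < l" "L_norm \<Phi> \<phi> f < ennreal l"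
    let ?F = "\<lambda>x. e2ennreal \<bar>f x\<bar>"
    have f'[measurable]: "f \<in> borel_measurable lebesgue" using f by (simp add: L_space_def)
    have F: "?F \<in> borel_measurable lebesgue" "(\<lambda>x. ?F x / ennreal l) \<in> borel_measurable lebesgue"
      by measurable
    have "in_unit_ball \<Phi> \<phi> (\<lambda>x. ?F x / ennreal l)"
      by (rule L_norm_less_imp[OF Phi_bar_mono[OF P(1)] pos l(2)])
    then have "in_unit_ball \<Psi> \<phi> (\<lambda>x. maxop \<rho> (\<lambda>x. ?F x / ennreal l) x / ennreal C1)"
      using C1(2) F(2) by blast
    moreover have "maxop \<rho> (\<lambda>x. ?F x / ennreal l) x / ennreal C1
        = maxop \<rho> ?F x / ennreal (C1 * l)" for x
      using C1(1) l(1) by (simp add: maxop_cdiv F ennreal_divide_divide mult_ac)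
    ultimately show "L_norm \<Psi> \<phi> (M_op \<rho> f) \<le> ennreal (C1 * l)"
      using C1(1) l(1) by (intro L_norm_le pos) (auto simp: M_frac_eq_maxop)
  qed (use C1 in \<open>auto simp: L_space_def\<close>)
qed

text \<open>The bound on averages is known only for l strictly above the norm N, so f is divided by
  2N. The 2 is returned by using C0/2 on the side of M and 2 C1 on the side of M_\<rho>.\<close>

lemma pointwise_at_norm:
  fixes f :: "'a::euclidean_space \<Rightarrow> ereal"
  assumes P: "\<Phi> \<in> Phi_bar" and f[measurable]: "f \<in> borel_measurable lebesgue"
    and N: "N < \<infinity>"
    and avg: "\<And>l a r. 0 < l \<Longrightarrow> N < ennreal l \<Longrightarrow> 0 < r \<Longrightarrow>
      avg (\<lambda>x. e2ennreal \<bar>f x\<bar> / ennreal l) a r \<le> ennreal Cs * gen_inv \<Phi> (ennreal (\<phi> r))"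
    and nz: "\<not> (AE x in lebesgue. f x = 0)" and C: "0 < C0" "0 < C1"
    and pointwise: "\<forall>(G::'a \<Rightarrow> ennreal) x.
      (\<forall>a r. 0 < r \<longrightarrow> avg G a r \<le> ennreal Cs * gen_inv \<Phi> (ennreal (\<phi> r))) \<longrightarrow>
      \<Psi> (maxop \<rho> G x / ennreal C1) \<le> \<Phi> (maxop (\<lambda>_. 1) G x / ennreal (C0 / 2))"
  shows "\<Psi> (M_frac \<rho> f x / (ennreal (2 * C1) * N)) \<le> \<Phi> (M_HL f x / (ennreal C0 * N))"
proof -
  let ?F = "\<lambda>x. e2ennreal \<bar>f x\<bar>"
  have F: "?F \<in> borel_measurable lebesgue" by measurable
  have "0 < N" by (rule norm_pos_of_avg_bound[OF P f avg nz])
  then obtain n where n: "N = ennreal n" "0 < n" using N by (cases N) auto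
  have "N < ennreal (2 * n)" using n by (simp add: ennreal_lessI)
  then have "\<Psi> (maxop \<rho> (\<lambda>x. ?F x / ennreal (2 * n)) x / ennreal C1)
      \<le> \<Phi> (maxop (\<lambda>_. 1) (\<lambda>x. ?F x / ennreal (2 * n)) x / ennreal (C0 / 2))"
    using n avg by (intro pointwise[rule_format]) auto
  moreover have "maxop \<rho> (\<lambda>x. ?F x / ennreal (2 * n)) x / ennreal C1 = M_frac \<rho> f x / (ennreal (2 * C1) * N)"
    using n C by (simp add: maxop_cdiv[OF F] M_frac_eq_maxop ennreal_divide_divide ennreal_mult[symmetric] mult_ac)
  moreover have "maxop (\<lambda>_. 1) (\<lambda>x. ?F x / ennreal (2 * n)) x / ennreal (C0 / 2) = M_HL f x / (ennreal C0 * N)"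
    using n C by (simp add: maxop_cdiv[OF F] M_frac_eq_maxop ennreal_divide_divide ennreal_mult[symmetric] mult_ac)
  ultimately show ?thesis by simp
qed

lemma M_frac_pointwise:
  assumes P: "\<Phi> \<in> Phi_bar" "\<Psi> \<in> Phi_bar" and q: "superhomogeneous K \<Phi>" "superhomogeneous K' \<Psi>"
    and \<phi>: "\<phi> \<in> G_dec DIM('a::euclidean_space)"
    and alt: "(\<phi> \<longlongrightarrow> 0) at_top \<or> almost_decreasing (\<lambda>t. gen_inv \<Psi> (ennreal t) / gen_inv \<Phi> (ennreal t))"
    and rho: "rho_condition \<rho> \<Phi> \<Psi> \<phi>" and C0: "0 < C0"
  shows "\<exists>C1>0.
    (\<forall>f \<in> (L_space \<Phi> \<phi> :: ('a \<Rightarrow> ereal) set). \<not> (AE x in lebesgue. f x = 0) \<longrightarrow>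
      (\<forall>x. \<Psi> (M_frac \<rho> f x / (ennreal C1 * L_norm \<Phi> \<phi> f))
         \<le> \<Phi> (M_HL f x / (ennreal C0 * L_norm \<Phi> \<phi> f)))) \<and>
    (\<Phi> \<in> Nabla2_bar \<longrightarrow>
      (\<forall>f \<in> (wL_space \<Phi> \<phi> :: ('a \<Rightarrow> ereal) set). \<not> (AE x in lebesgue. f x = 0) \<longrightarrow>
        (\<forall>x. \<Psi> (M_frac \<rho> f x / (ennreal C1 * wL_norm \<Phi> \<phi> f))
           \<le> \<Phi> (M_HL f x / (ennreal C0 * wL_norm \<Phi> \<phi> f)))))"
proof -
  have pos: "0 < \<phi> r" if "0 < r" for r using \<phi> that by (simp add: G_dec_def)
  have K: "1 \<le> K" using q by (simp add: superhomogeneous_def)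
  \<comment> \<open>Without the nabla-2 condition k is set to 1, merely so that the next constant is
    defined.\<close>
  obtain k where k: "\<Phi> \<in> Nabla2_bar \<Longrightarrow> nabla2 k \<Phi>" "0 < k"
  proof (cases "\<Phi> \<in> Nabla2_bar")
    case True
    then obtain k where "nabla2 k \<Phi>" by (auto simp: Nabla2_bar_def nabla2_def)
    then show ?thesis using that[of k] by (simp add: nabla2_def)
  next
    case False
    then show ?thesis using that[of 1] by simp
  qed
  \<comment> \<open>A single C1 must serve both norms, so the larger averaging constant is taken: 4K
    for the strong norm, and the one for tail constant 2k for the weak norm.\<close>
  define Cs where "Cs = max (4 * K) (2 * (1 + 2 * k))"
  have Cs: "0 < Cs" using K by (simp add: Cs_def less_max_iff_disj)
  have Cs_le: "ennreal (4 * K) * y \<le> ennreal Cs * y" "ennreal (2 * (1 + 2 * k)) * y \<le> ennreal Cs * y" for y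
    by (auto intro!: mult_right_mono ennreal_leI simp: Cs_def)
  have "0 < C0 / 2" using C0 by simp
  then obtain C1 where C1: "0 < C1" "\<forall>(G::'a \<Rightarrow> ennreal) x.
      (\<forall>a r. 0 < r \<longrightarrow> avg G a r \<le> ennreal Cs * gen_inv \<Phi> (ennreal (\<phi> r))) \<longrightarrow>
      \<Psi> (maxop \<rho> G x / ennreal C1) \<le> \<Phi> (maxop (\<lambda>_. 1) G x / ennreal (C0 / 2))"
    using maxop_pointwise[OF P q(2) \<phi> alt rho _ Cs, where 'a='a] by blast
  show ?thesis
  proof (intro exI[of _ "2 * C1"] conjI ballI allI impI)
    show "0 < 2 * C1" using C1 by simp
  next
    fix f :: "'a \<Rightarrow> ereal" and x
    assume f: "f \<in> L_space \<Phi> \<phi>" and nz: "\<not> (AE x in lebesgue. f x = 0)"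
    have f': "f \<in> borel_measurable lebesgue" "L_norm \<Phi> \<phi> f < \<infinity>" using f by (auto simp: L_space_def)
    note [measurable] = f'(1)
    show "\<Psi> (M_frac \<rho> f x / (ennreal (2 * C1) * L_norm \<Phi> \<phi> f)) \<le> \<Phi> (M_HL f x / (ennreal C0 * L_norm \<Phi> \<phi> f))"
    proof (rule pointwise_at_norm[OF P(1) f' _ nz C0 C1])
      fix l a r :: real and a' :: 'a assume l: "L_norm \<Phi> \<phi> f < ennreal l" and r: "0 < r"
      have "avg (\<lambda>x. e2ennreal \<bar>f x\<bar> / ennreal l) a' r \<le> ennreal (4 * K) * gen_inv \<Phi> (ennreal (\<phi> r))"
        by (rule strong_avg[OF P(1) q(1) _ L_norm_less_imp[OF Phi_bar_mono[OF P(1)] pos l] r pos[OF r]]) measurable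
      then show "avg (\<lambda>x. e2ennreal \<bar>f x\<bar> / ennreal l) a' r \<le> ennreal Cs * gen_inv \<Phi> (ennreal (\<phi> r))"
        using Cs_le(1) by (rule order_trans)
    qed
  next
    fix f :: "'a \<Rightarrow> ereal" and x
    assume N: "\<Phi> \<in> Nabla2_bar" and f: "f \<in> wL_space \<Phi> \<phi>" and nz: "\<not> (AE x in lebesgue. f x = 0)"
    have f': "f \<in> borel_measurable lebesgue" "wL_norm \<Phi> \<phi> f < \<infinity>" using f by (auto simp: wL_space_def)
    note [measurable] = f'(1)
    show "\<Psi> (M_frac \<rho> f x / (ennreal (2 * C1) * wL_norm \<Phi> \<phi> f)) \<le> \<Phi> (M_HL f x / (ennreal C0 * wL_norm \<Phi> \<phi> f))"
    proof (rule pointwise_at_norm[OF P(1) f' _ nz C0 C1])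
      fix l r :: real and a :: 'a assume l: "wL_norm \<Phi> \<phi> f < ennreal l" and r: "0 < r"
      have F: "(\<lambda>x. e2ennreal \<bar>f x\<bar> / ennreal l) \<in> borel_measurable lebesgue" by measurable
      have "tail_bound \<Phi> \<phi> (2 * k) (\<lambda>x. e2ennreal \<bar>f x\<bar> / ennreal l)"
        by (rule tail_bound_weak[OF k(1)[OF N] F wL_norm_less_imp[OF f'(1) pos l] pos])
      then have "avg (\<lambda>x. e2ennreal \<bar>f x\<bar> / ennreal l) a r \<le> ennreal (2 * (1 + 2 * k)) * gen_inv \<Phi> (ennreal (\<phi> r))"
        using k(2) pos[OF r] r by (intro tail_bound_avg[OF P(1) F]) auto
      then show "avg (\<lambda>x. e2ennreal \<bar>f x\<bar> / ennreal l) a r \<le> ennreal Cs * gen_inv \<Phi> (ennreal (\<phi> r))"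
        using Cs_le(2) by (rule order_trans)
    qed
  qed
qed

section \<open>Necessity\<close>

lemma ball_weight_almost_monotone:
  fixes a b :: "'a::euclidean_space"
  assumes "0 < r" "r \<le> s" "\<phi> r * r ^ DIM('a) \<le> C * (\<phi> s * s ^ DIM('a))" "0 < \<phi> s" "0 \<le> C"
  shows "ennreal (\<phi> r) * emeasure lebesgue (ball b r) \<le> ennreal (C * \<phi> s) * emeasure lebesgue (ball a s)"
proof -
  let ?u = "unit_ball_vol (real DIM('a))"
  have "\<phi> r * (?u * r ^ DIM('a)) \<le> C * \<phi> s * (?u * s ^ DIM('a))"
    using mult_left_mono[OF assms(3), of ?u] by (simp add: mult_ac)
  then show ?thesis using assms
    by (simp add: emeasure_lebesgue_ball ennreal_mult''[symmetric] ennreal_leI)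
qed

lemma e2ennreal_1: "e2ennreal 1 = 1"
  and e2ennreal_0: "e2ennreal 0 = 0"
  by (simp_all add: one_ereal_def e2ennreal_neg)

lemma e2ennreal_indicator: "e2ennreal (indicator A x) = indicator A x"
  by (simp add: indicator_def e2ennreal_1 e2ennreal_0)

text \<open>With l = K C / g one has C \<Phi>(1/l) \<le> \<Phi>(g) \<le> \<phi>(r). Each half of
  \<open>G_dec\<close> settles one kind of test ball B(a,s): almost decrease of \<phi> for s \<le>
  r, and almost increase of \<phi>(s) s^n for s > r, where the intersection has at most the volume
  of B(0,r).\<close>

lemma L_norm_indicator_le:
  assumes P: "\<Phi> \<in> Phi_bar" and q: "superhomogeneous K \<Phi>" and \<phi>: "\<phi> \<in> G_dec DIM('a::euclidean_space)"
  obtains B where "0 < B"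
    "\<And>r g. 0 < r \<Longrightarrow> 0 < g \<Longrightarrow> gen_inv \<Phi> (ennreal (\<phi> r)) = ennreal g \<Longrightarrow>
      L_norm \<Phi> \<phi> (indicator (ball (0::'a) r)) \<le> ennreal (B / g)"
proof -
  obtain C where C: "1 \<le> C" and pos: "\<And>r. 0 < r \<Longrightarrow> 0 < \<phi> r"
    and dec: "\<And>r s. 0 < r \<Longrightarrow> r \<le> s \<Longrightarrow> \<phi> s \<le> C * \<phi> r"
    and inc: "\<And>r s. 0 < r \<Longrightarrow> r \<le> s \<Longrightarrow> \<phi> r * r ^ DIM('a) \<le> C * (\<phi> s * s ^ DIM('a))"
    using \<phi> by (elim G_decE) blast
  have K: "1 \<le> K" using q by (simp add: superhomogeneous_def)
  have "L_norm \<Phi> \<phi> (indicator (ball (0::'a) r)) \<le> ennreal (K * C / g)"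
    if r: "0 < r" and g: "0 < g" "gen_inv \<Phi> (ennreal (\<phi> r)) = ennreal g" for r g
  proof (rule L_norm_le)
    let ?l = "K * C / g"
    show l: "0 < ?l" using K C g by simp
    have y: "ennreal C * \<Phi> (ennreal (1 / ?l)) \<le> ennreal (\<phi> r)"
    proof -
      have "ennreal C * \<Phi> (ennreal (1 / ?l)) \<le> \<Phi> (ennreal (K * C) * ennreal (1 / ?l))"
        using q C by (rule superhomogeneousD)
      also have "ennreal (K * C) * ennreal (1 / ?l) = gen_inv \<Phi> (ennreal (\<phi> r))"
        using K C g by (simp add: ennreal_mult[symmetric])
      also have "\<Phi> \<dots> \<le> ennreal (\<phi> r)" by (rule Phi_gen_inv_le[OF P])
      finally show ?thesis .
    qed
    show "in_unit_ball \<Phi> \<phi> (\<lambda>x. e2ennreal \<bar>indicator (ball (0::'a) r) x\<bar> / ennreal ?l)"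
      unfolding in_unit_ball_def
    proof (intro allI impI)
      fix a :: 'a and s :: real assume s: "0 < s"
      let ?y = "\<Phi> (ennreal (1 / ?l))"
      have "\<Phi> (e2ennreal \<bar>indicator (ball (0::'a) r) x\<bar> / ennreal ?l) * indicator (ball a s) x
          = ?y * indicator (ball 0 r \<inter> ball a s) x" for x
        using l Phi_bar_0[OF P] divide_ennreal[of 1 ?l]
        by (cases "x \<in> ball 0 r") (simp_all add: e2ennreal_1 e2ennreal_0 indicator_inter_arith)
      then have "(\<integral>\<^sup>+x\<in>ball a s. \<Phi> (e2ennreal \<bar>indicator (ball (0::'a) r) x\<bar> / ennreal ?l) \<partial>lebesgue)
          = ?y * emeasure lebesgue (ball 0 r \<inter> ball a s)"
        by (simp add: nn_integral_cmult_indicator)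
      moreover have "ennreal C * (?y * emeasure lebesgue (ball 0 r \<inter> ball a s))
          \<le> ennreal C * (ennreal (\<phi> s) * emeasure lebesgue (ball a s))"
      proof -
        have "ennreal C * (?y * emeasure lebesgue (ball 0 r \<inter> ball a s))
            \<le> ennreal (\<phi> r) * emeasure lebesgue (ball 0 r \<inter> ball a s)"
          using y by (simp add: mult.assoc[symmetric] mult_right_mono)
        also have "\<dots> \<le> ennreal (C * \<phi> s) * emeasure lebesgue (ball a s)"
        proof (cases "s \<le> r")
          case True
          then show ?thesis using dec[OF s True]
            by (intro mult_mono ennreal_leI emeasure_mono) auto
        next
          case False
          have "ennreal (\<phi> r) * emeasure lebesgue (ball 0 r \<inter> ball a s)
              \<le> ennreal (\<phi> r) * emeasure lebesgue (ball (0::'a) r)"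
            by (intro mult_left_mono emeasure_mono) auto
          also have "\<dots> \<le> ennreal (C * \<phi> s) * emeasure lebesgue (ball a s)"
            using False r s C pos by (intro ball_weight_almost_monotone inc) auto
          finally show ?thesis .
        qed
        also have "\<dots> = ennreal C * (ennreal (\<phi> s) * emeasure lebesgue (ball a s))"
          using C pos[OF s] by (simp add: ennreal_mult mult.assoc)
        finally show ?thesis .
      qed
      ultimately show "(\<integral>\<^sup>+x\<in>ball a s. \<Phi> (e2ennreal \<bar>indicator (ball (0::'a) r) x\<bar> / ennreal ?l) \<partial>lebesgue)
          \<le> ennreal (\<phi> s) * emeasure lebesgue (ball a s)"
        using C by (simp add: ennreal_mult_le_mult_iff)
    qed
  qed (rule pos)
  moreover have "0 < K * C" using K C by simp
  ultimately show ?thesis using that[of "K * C"] by blast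
qed

lemma maxop_indicator_ge:
  assumes x: "x \<in> ball (0::'a::euclidean_space) r"
  shows "(SUP t\<in>{0<..r}. ennreal (\<rho> t)) \<le> maxop \<rho> (indicator (ball 0 r)) x"
proof (rule SUP_least)
  fix t assume "t \<in> {0<..r}"
  then have t: "0 < t" "t \<le> r" by auto
  have nx: "norm x < r" using x by simp
  \<comment> \<open>Moving x towards 0 by the fraction t/r changes it by less than t and leaves norm
    at most r - t, so the ball of radius t about z contains x and stays inside B(0,r).\<close>
  define z where "z = (1 - t / r) *\<^sub>R x"
  have "x - z = (t / r) *\<^sub>R x" by (simp add: z_def algebra_simps)
  then have "dist z x = t / r * norm x"
    using t by (simp add: dist_norm norm_minus_commute[of z x])
  also have "\<dots> < t" using t nx by (simp add: field_simps)
  finally have xz: "x \<in> ball z t" by simp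
  have "norm z \<le> r - t"
  proof -
    have "norm z = (1 - t / r) * norm x" using t by (simp add: z_def)
    also have "\<dots> \<le> (1 - t / r) * r" using t nx by (intro mult_left_mono) auto
    also have "\<dots> = r - t" using t by (simp add: algebra_simps)
    finally show ?thesis .
  qed
  then have sub: "ball z t \<subseteq> ball 0 r"
  proof (intro subsetI)
    fix y assume "y \<in> ball z t"
    then have "norm (y - z) < t" by (simp add: dist_norm norm_minus_commute)
    then show "y \<in> ball 0 r"
      using \<open>norm z \<le> r - t\<close> norm_triangle_ineq[of z "y - z"] by simp
  qed
  have "(\<integral>\<^sup>+y\<in>ball z t. indicator (ball 0 r) y \<partial>lebesgue) = (\<integral>\<^sup>+y. indicator (ball z t) y \<partial>lebesgue)"
    using sub by (intro nn_integral_cong) (auto simp: indicator_def)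
  then have "avg (indicator (ball 0 r)) z t = 1"
    using emeasure_ball_pos[OF t(1), of z] emeasure_ball_finite[OF t(1), of z]
    by (simp add: avg_def)
  then show "ennreal (\<rho> t) \<le> maxop \<rho> (indicator (ball 0 r)) x"
    using maxop_upper[OF t(1) xz, of \<rho> "indicator (ball 0 r)"] by simp
qed

text \<open>The target norm enters only through \<open>lower\<close>, which lets the weak
  Orlicz--Morrey target and the L^1 target share one argument.\<close>

lemma rho_condition_of_indicators:
  fixes nY :: "('a::euclidean_space \<Rightarrow> ereal) \<Rightarrow> ennreal"
  assumes P: "\<Phi> \<in> Phi_bar" and q: "superhomogeneous K \<Phi>" and \<phi>: "\<phi> \<in> G_dec DIM('a)"
    and bdd: "bounded_from_to (M_op \<rho>) (L_space \<Phi> \<phi>) (L_norm \<Phi> \<phi>) Y nY"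
    and lower: "\<And>r l f. 0 < r \<Longrightarrow> 0 < l \<Longrightarrow> nY (M_op \<rho> f) < ennreal l \<Longrightarrow>
      f = indicator (ball 0 r) \<Longrightarrow>
      (SUP t\<in>{0<..r}. ennreal (\<rho> t)) / ennreal l \<le> gen_inv \<Psi> (ennreal (\<phi> r))"
  shows "rho_condition \<rho> \<Phi> \<Psi> \<phi>"
proof -
  obtain C where C: "0 < C" "\<And>f. f \<in> L_space \<Phi> \<phi> \<Longrightarrow> nY (M_op \<rho> f) \<le> ennreal C * L_norm \<Phi> \<phi> f"
    using bdd by (auto simp: bounded_from_to_def)
  obtain B where B: "0 < B" "\<And>r g. 0 < r \<Longrightarrow> 0 < g \<Longrightarrow> gen_inv \<Phi> (ennreal (\<phi> r)) = ennreal g \<Longrightarrow>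
      L_norm \<Phi> \<phi> (indicator (ball (0::'a) r)) \<le> ennreal (B / g)"
    by (rule L_norm_indicator_le[OF P q \<phi>]) blast
  have "(SUP t\<in>{0<..r}. ennreal (\<rho> t)) * gen_inv \<Phi> (ennreal (\<phi> r))
      \<le> ennreal (2 * C * B) * gen_inv \<Psi> (ennreal (\<phi> r))" if r: "0 < r" for r
  proof -
    have "0 < \<phi> r" using \<phi> r by (simp add: G_dec_def)
    then have "0 < gen_inv \<Phi> (ennreal (\<phi> r))" "gen_inv \<Phi> (ennreal (\<phi> r)) < \<infinity>"
      by (auto intro!: gen_inv_pos gen_inv_finite[simplified] P)
    then obtain g where g: "gen_inv \<Phi> (ennreal (\<phi> r)) = ennreal g" "0 < g"
      by (cases "gen_inv \<Phi> (ennreal (\<phi> r))") auto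
    let ?f = "indicator (ball (0::'a) r) :: 'a \<Rightarrow> ereal"
    have norm: "L_norm \<Phi> \<phi> ?f \<le> ennreal (B / g)" using B(2) r g by blast
    then have "L_norm \<Phi> \<phi> ?f < \<infinity>" by (rule le_less_trans) simp
    moreover have "?f \<in> borel_measurable lebesgue" by (intro borel_measurable_indicator ball_sets_lebesgue)
    ultimately have "?f \<in> L_space \<Phi> \<phi>" by (simp add: L_space_def)
    then have "nY (M_op \<rho> ?f) \<le> ennreal C * L_norm \<Phi> \<phi> ?f" by (rule C)
    also have "\<dots> \<le> ennreal C * ennreal (B / g)" using norm by (rule mult_left_mono) simp
    also have "\<dots> = ennreal (C * (B / g))" using C B g by (simp add: ennreal_mult[symmetric])
    \<comment> \<open>Doubling creates the strict inequality that \<open>lower\<close>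
      demands.\<close>
    also have "\<dots> < ennreal (2 * (C * (B / g)))"
      using mult_pos_pos[OF C(1) divide_pos_pos[OF B(1) g(2)]] by (intro ennreal_lessI) (simp_all only: mult_2 less_add_same_cancel1 add_pos_pos)
    finally have "(SUP t\<in>{0<..r}. ennreal (\<rho> t)) / ennreal (2 * (C * (B / g))) \<le> gen_inv \<Psi> (ennreal (\<phi> r))"
      using C B g r by (intro lower[of r _ ?f]) auto
    then have "(SUP t\<in>{0<..r}. ennreal (\<rho> t)) \<le> ennreal (2 * (C * (B / g))) * gen_inv \<Psi> (ennreal (\<phi> r))"
      using C B g by (intro ennreal_le_mult_of_divide_le) auto
    then have "(SUP t\<in>{0<..r}. ennreal (\<rho> t)) * ennreal g
        \<le> ennreal (2 * (C * (B / g))) * gen_inv \<Psi> (ennreal (\<phi> r)) * ennreal g"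
      by (rule mult_right_mono) simp
    also have "\<dots> = ennreal (2 * (C * (B / g)) * g) * gen_inv \<Psi> (ennreal (\<phi> r))"
      using C B g by (subst ennreal_mult) (auto simp: mult_ac)
    also have "2 * (C * (B / g)) * g = 2 * C * B" using g by simp
    finally show ?thesis by (simp add: g)
  qed
  then show ?thesis using C B unfolding rho_condition_def by (intro exI[of _ "2 * C * B"]) auto
qed

text \<open>For w strictly below the scaled supremum of \<rho> the superlevel set is all of B(0,r),
  so the weak condition reduces to \<Psi>(w) \<le> \<phi>(r). Approaching from below suits the
  strict superlevel sets and permits an infinite supremum.\<close>

lemma wL_norm_maxop_indicator_lower:
  fixes f :: "'a::euclidean_space \<Rightarrow> ereal"
  assumes P: "\<Psi> \<in> Phi_bar" and pos: "\<And>r. 0 < r \<Longrightarrow> 0 < \<phi> r" and r: "0 < r" and l: "0 < l"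
    and n: "wL_norm \<Psi> \<phi> (M_op \<rho> f) < ennreal l" and f: "f = indicator (ball 0 r)"
  shows "(SUP t\<in>{0<..r}. ennreal (\<rho> t)) / ennreal l \<le> gen_inv \<Psi> (ennreal (\<phi> r))"
proof (rule dense_le)
  let ?R = "SUP t\<in>{0<..r}. ennreal (\<rho> t)" and ?M = "maxop \<rho> (indicator (ball (0::'a) r))"
  fix w assume w: "w < ?R / ennreal l"
  show "w \<le> gen_inv \<Psi> (ennreal (\<phi> r))"
  proof (cases "w = 0")
    case False
    then obtain t where t: "w = ennreal t" "0 < t" using w by (cases w) auto
    have "in_weak_unit_ball \<Psi> \<phi> (\<lambda>x. ?M x / ennreal l)"
      using wL_norm_less_imp[OF M_op_measurable pos n]
      by (simp add: M_frac_eq_maxop f e2ennreal_indicator)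
    then have "\<Psi> w * emeasure lebesgue {y \<in> ball 0 r. w < ?M y / ennreal l}
        \<le> ennreal (\<phi> r) * emeasure lebesgue (ball (0::'a) r)"
      unfolding in_weak_unit_ball_def t(1) using t(2) r by blast
    moreover have "{y \<in> ball 0 r. w < ?M y / ennreal l} = ball 0 r"
    proof -
      have "w < ?M y / ennreal l" if "y \<in> ball 0 r" for y
        using w divide_right_mono_ennreal[OF maxop_indicator_ge[OF that]] by (rule less_le_trans)
      then show ?thesis by blast
    qed
    ultimately have "\<Psi> w \<le> ennreal (\<phi> r)"
      using emeasure_ball_pos[OF r, of "0::'a"] emeasure_ball_finite[OF r, of "0::'a"]
      by (simp add: mult.commute[of _ "emeasure lebesgue (ball 0 r)"] ennreal_mult_le_mult_iff)
    then show ?thesis by (rule le_gen_inv[OF Phi_bar_mono[OF P]])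
  qed simp
qed

text \<open>The maximal function is bounded below by a constant on B(0,r), so its average over that
  same ball already gives the bound.\<close>

lemma L1_norm_maxop_indicator_lower:
  fixes f :: "'a::euclidean_space \<Rightarrow> ereal"
  assumes P: "\<Psi> \<in> Phi_bar" and pos: "\<And>r. 0 < r \<Longrightarrow> 0 < \<phi> r" and r: "0 < r" and l: "0 < l"
    and n: "L1_norm (inv_comp \<Psi> \<phi>) (M_op \<rho> f) < ennreal l" and f: "f = indicator (ball 0 r)"
  shows "(SUP t\<in>{0<..r}. ennreal (\<rho> t)) / ennreal l \<le> gen_inv \<Psi> (ennreal (\<phi> r))"
proof -
  let ?R = "SUP t\<in>{0<..r}. ennreal (\<rho> t)" and ?M = "maxop \<rho> (indicator (ball (0::'a) r))"
  have fin: "0 < gen_inv \<Psi> (ennreal (\<phi> s))" "gen_inv \<Psi> (ennreal (\<phi> s)) < \<infinity>" if "0 < s" for s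
    using pos[OF that] P by (auto intro: gen_inv_pos gen_inv_finite[simplified])
  then have inv_pos: "0 < inv_comp \<Psi> \<phi> s" if "0 < s" for s
    using that by (auto simp: inv_comp_def enn2real_positive_iff)
  have inv: "ennreal (inv_comp \<Psi> \<phi> r) = gen_inv \<Psi> (ennreal (\<phi> r))"
    using fin[OF r] by (simp add: inv_comp_def ennreal_enn2real_if)
  have "in_unit_ball (\<lambda>t. t) (inv_comp \<Psi> \<phi>) (\<lambda>x. ?M x / ennreal l)"
    using L_norm_less_imp[OF _ inv_pos n]
    by (simp add: mono_def M_frac_eq_maxop f e2ennreal_indicator)
  then have "(\<integral>\<^sup>+y\<in>ball 0 r. ?M y / ennreal l \<partial>lebesgue)
      \<le> gen_inv \<Psi> (ennreal (\<phi> r)) * emeasure lebesgue (ball (0::'a) r)"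
    unfolding in_unit_ball_def inv[symmetric] using r by blast
  moreover have "(\<integral>\<^sup>+y. ?R / ennreal l * indicator (ball (0::'a) r) y \<partial>lebesgue)
      \<le> (\<integral>\<^sup>+y\<in>ball 0 r. ?M y / ennreal l \<partial>lebesgue)"
    by (intro nn_integral_mono)
      (auto split: split_indicator intro!: divide_right_mono_ennreal maxop_indicator_ge)
  ultimately have "?R / ennreal l * emeasure lebesgue (ball (0::'a) r)
      \<le> gen_inv \<Psi> (ennreal (\<phi> r)) * emeasure lebesgue (ball (0::'a) r)"
    by (simp add: nn_integral_cmult_indicator)
  then show ?thesis
    using emeasure_ball_pos[OF r, of "0::'a"] emeasure_ball_finite[OF r, of "0::'a"]
    by (simp add: mult.commute[of _ "emeasure lebesgue (ball 0 r)"] ennreal_mult_le_mult_iff)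
qed

theorem theorem3p5:
  fixes \<Phi> \<Psi> :: "ennreal \<Rightarrow> ennreal" and \<phi> \<rho> :: "real \<Rightarrow> real"
  assumes "\<Phi> \<in> Phi_bar_Young" and "\<Psi> \<in> Phi_bar_Young"
    and "\<phi> \<in> G_dec CARD('n::finite)"
    and "\<And>r. r > 0 \<Longrightarrow> \<rho> r > 0"
  shows
    "(((\<phi> \<longlongrightarrow> 0) at_top \<or>
        almost_decreasing (\<lambda>t. gen_inv \<Psi> (ennreal t) / gen_inv \<Phi> (ennreal t))) \<and>
      rho_condition \<rho> \<Phi> \<Psi> \<phi> \<longrightarrow>
        (\<forall>C\<^sub>0::real. C\<^sub>0 > 0 \<longrightarrow> (\<exists>C\<^sub>1::real. C\<^sub>1 > 0 \<and>
          (\<forall>f \<in> (L_space \<Phi> \<phi> :: (real ^ 'n \<Rightarrow> ereal) set). \<not> (AE x in lebesgue. f x = 0) \<longrightarrow>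
            (\<forall>x. \<Psi> (M_frac \<rho> f x / (ennreal C\<^sub>1 * L_norm \<Phi> \<phi> f))
                   \<le> \<Phi> (M_HL f x / (ennreal C\<^sub>0 * L_norm \<Phi> \<phi> f)))) \<and>
          (\<Phi> \<in> Nabla2_bar \<longrightarrow>
            (\<forall>f \<in> (wL_space \<Phi> \<phi> :: (real ^ 'n \<Rightarrow> ereal) set). \<not> (AE x in lebesgue. f x = 0) \<longrightarrow>
              (\<forall>x. \<Psi> (M_frac \<rho> f x / (ennreal C\<^sub>1 * wL_norm \<Phi> \<phi> f))
                     \<le> \<Phi> (M_HL f x / (ennreal C\<^sub>0 * wL_norm \<Phi> \<phi> f))))))) \<and>
        bounded_from_to (M_op \<rho> :: (real ^ 'n \<Rightarrow> ereal) \<Rightarrow> _)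
          (L_space \<Phi> \<phi>) (L_norm \<Phi> \<phi>) (wL_space \<Psi> \<phi>) (wL_norm \<Psi> \<phi>) \<and>
        (\<Phi> \<in> Nabla2_bar \<longrightarrow>
          bounded_from_to (M_op \<rho> :: (real ^ 'n \<Rightarrow> ereal) \<Rightarrow> _)
            (L_space \<Phi> \<phi>) (L_norm \<Phi> \<phi>) (L_space \<Psi> \<phi>) (L_norm \<Psi> \<phi>) \<and>
          bounded_from_to (M_op \<rho> :: (real ^ 'n \<Rightarrow> ereal) \<Rightarrow> _)
            (wL_space \<Phi> \<phi>) (wL_norm \<Phi> \<phi>) (wL_space \<Psi> \<phi>) (wL_norm \<Psi> \<phi>)))
     \<and>
     (bounded_from_to (M_op \<rho> :: (real ^ 'n \<Rightarrow> ereal) \<Rightarrow> _)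
        (L_space \<Phi> \<phi>) (L_norm \<Phi> \<phi>) (wL_space \<Psi> \<phi>) (wL_norm \<Psi> \<phi>)
      \<longrightarrow> rho_condition \<rho> \<Phi> \<Psi> \<phi>)
     \<and>
     (bounded_from_to (M_op \<rho> :: (real ^ 'n \<Rightarrow> ereal) \<Rightarrow> _)
        (L_space \<Phi> \<phi>) (L_norm \<Phi> \<phi>)
        (L1_space (inv_comp \<Psi> \<phi>)) (L1_norm (inv_comp \<Psi> \<phi>))
      \<longrightarrow> rho_condition \<rho> \<Phi> \<Psi> \<phi>)"
proof (intro conjI impI)
  note P = assms(1,2)[unfolded Phi_bar_Young_def, THEN CollectD, THEN conjunct1]
  \<comment> \<open>Equivalence to Young functions enters only through the two constants obtained
    here; the rest works with \<open>Phi_bar\<close> and superhomogeneity.\<close>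
  obtain K where K: "superhomogeneous K \<Phi>" by (rule Phi_bar_Young_superhomogeneous[OF assms(1)])
  obtain K' where K': "superhomogeneous K' \<Psi>" by (rule Phi_bar_Young_superhomogeneous[OF assms(2)])
  have \<phi>: "\<phi> \<in> G_dec DIM(real ^ 'n)" using assms(3) by simp
  have pos: "0 < \<phi> r" if "0 < r" for r using assms(3) that by (simp add: G_dec_def)
  {
    assume *: "((\<phi> \<longlongrightarrow> 0) at_top \<or>
        almost_decreasing (\<lambda>t. gen_inv \<Psi> (ennreal t) / gen_inv \<Phi> (ennreal t))) \<and>
      rho_condition \<rho> \<Phi> \<Psi> \<phi>"
    note main = P K K' \<phi> conjunct1[OF *] conjunct2[OF *]
    show "\<forall>C\<^sub>0::real. C\<^sub>0 > 0 \<longrightarrow> (\<exists>C\<^sub>1::real. C\<^sub>1 > 0 \<and>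
          (\<forall>f \<in> (L_space \<Phi> \<phi> :: (real ^ 'n \<Rightarrow> ereal) set). \<not> (AE x in lebesgue. f x = 0) \<longrightarrow>
            (\<forall>x. \<Psi> (M_frac \<rho> f x / (ennreal C\<^sub>1 * L_norm \<Phi> \<phi> f))
                   \<le> \<Phi> (M_HL f x / (ennreal C\<^sub>0 * L_norm \<Phi> \<phi> f)))) \<and>
          (\<Phi> \<in> Nabla2_bar \<longrightarrow>
            (\<forall>f \<in> (wL_space \<Phi> \<phi> :: (real ^ 'n \<Rightarrow> ereal) set). \<not> (AE x in lebesgue. f x = 0) \<longrightarrow>
              (\<forall>x. \<Psi> (M_frac \<rho> f x / (ennreal C\<^sub>1 * wL_norm \<Phi> \<phi> f))
                     \<le> \<Phi> (M_HL f x / (ennreal C\<^sub>0 * wL_norm \<Phi> \<phi> f))))))"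
      by (intro allI impI M_frac_pointwise[OF main])
    show "bounded_from_to (M_op \<rho> :: (real ^ 'n \<Rightarrow> ereal) \<Rightarrow> _)
          (L_space \<Phi> \<phi>) (L_norm \<Phi> \<phi>) (wL_space \<Psi> \<phi>) (wL_norm \<Psi> \<phi>)"
      by (rule strong_to_weak_bounded[OF main])
    assume "\<Phi> \<in> Nabla2_bar"
    then obtain k where k: "nabla2 k \<Phi>" by (auto simp: Nabla2_bar_def nabla2_def)
    show "bounded_from_to (M_op \<rho> :: (real ^ 'n \<Rightarrow> ereal) \<Rightarrow> _)
          (L_space \<Phi> \<phi>) (L_norm \<Phi> \<phi>) (L_space \<Psi> \<phi>) (L_norm \<Psi> \<phi>)"
      by (rule strong_to_strong_bounded[OF main k])
    show "bounded_from_to (M_op \<rho> :: (real ^ 'n \<Rightarrow> ereal) \<Rightarrow> _)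
          (wL_space \<Phi> \<phi>) (wL_norm \<Phi> \<phi>) (wL_space \<Psi> \<phi>) (wL_norm \<Psi> \<phi>)"
      by (rule weak_to_weak_bounded[OF main k])
  }
  {
    assume "bounded_from_to (M_op \<rho> :: (real ^ 'n \<Rightarrow> ereal) \<Rightarrow> _)
        (L_space \<Phi> \<phi>) (L_norm \<Phi> \<phi>) (wL_space \<Psi> \<phi>) (wL_norm \<Psi> \<phi>)"
    then show "rho_condition \<rho> \<Phi> \<Psi> \<phi>"
      by (rule rho_condition_of_indicators[OF P(1) K \<phi>]) (rule wL_norm_maxop_indicator_lower[where \<phi>=\<phi>, OF P(2) pos])
  }
  {
    assume "bounded_from_to (M_op \<rho> :: (real ^ 'n \<Rightarrow> ereal) \<Rightarrow> _)
        (L_space \<Phi> \<phi>) (L_norm \<Phi> \<phi>)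
        (L1_space (inv_comp \<Psi> \<phi>)) (L1_norm (inv_comp \<Psi> \<phi>))"
    then show "rho_condition \<rho> \<Phi> \<Psi> \<phi>"
      by (rule rho_condition_of_indicators[OF P(1) K \<phi>]) (rule L1_norm_maxop_indicator_lower[where \<phi>=\<phi>, OF P(2) pos])
  }
qed

end
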